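(* Let $m\ge 2$, let $p\in(-1,\infty)$ and let $\xi\in\Xi^+$, with $\mathbf M=\mathbf M(\xi)$. Define $$t=\operatorname{tr}(\mathbf M^{-p}),\qquad \epsilon=\max_{\mathbf x\in\mathcal X}\mathbf x^\top\mathbf M^{-(p+1)}\mathbf x-t\ (\ge 0),$$ $$\alpha=\frac{\lambda_{\min}(\mathbf M^{-p})}{\operatorname{tr}(\mathbf M^{-p})},\qquad \gamma=\max\{1,(1+\epsilon/t)^{-p}\},\qquad B(t,\epsilon)=t\,\min\{1,(1+\epsilon/t)^{-p}\}.$$ Then the equation in $\tau$ $$F(\tau;\alpha,\epsilon,t,\gamma,p)=\frac{\alpha}{\tau^{p+1}}+\frac{(1-\alpha)^{p+2}}{(1+\epsilon/t-\alpha\tau)^{p+1}}-\gamma=0$$ has exactly one solution $\omega_1$ in the interval $\big((\alpha/\gamma)^{1/(p+1)},\,(1/\gamma)^{1/(p+1)}\big]$. Moreover, every point $\mathbf x_*\in\mathcal X$ with $$\mathbf x_*^\top\mathbf M^{-(p+1)}(\xi)\,\mathbf x_*<C(\xi,p):=\omega_1^{p+1}\,B(t,\epsilon)$$ is not a support point of any $\phi_p$-optimal design measure $\xi_p^*$. Equivalently, every support point $\mathbf x_*$ of every $\phi_p$-optimal design satisfies $\mathbf x_*^\top\mathbf M^{-(p+1)}(\xi)\mathbf x_*\ge C(\xi,p)$. Furthermore, if $t_*=\operatorname{tr}(\mathbf M_*^{-p})$ is known (e.g. when $p=0$, where $t_*=m$), the same conclusions hold with $B(t,\epsilon)$ replaced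 by $t_*$ and $\gamma$ replaced by $\gamma_*=t_*/t$ in the definitions of the interval, of $F$, and of $C(\xi,p)$.
   Context: Let $\mathcal X\subset\mathbb R^m$ be compact and let $\Xi$ be the set of probability measures (design measures) on $\mathcal X$. For $\xi\in\Xi$ set $\mathbf M(\xi)=\int_{\mathcal X}\mathbf x\mathbf x^\top\,\xi(d\mathbf x)$, and let $\Xi^+=\{\xi\in\Xi:\mathbf M(\xi)\text{ nonsingular}\}$, assumed nonempty. For a symmetric nonnegative definite $m\times m$ matrix $\mathbf M$ and $p\in(-1,\infty)$, $p\neq 0$, define $\Phi_p^+(\mathbf M)=\big[\tfrac1m\operatorname{tr}(\mathbf M^{-p})\big]^{-1/p}$ when $\mathbf M$ is positive definite. For $p>0$ and $\mathbf M$ singular, set $\Phi_p^+(\mathbf M)=0$. For $p\in(-1,0)$ the formula makes sense for all nonnegative definite $\mathbf M$, since $\mathbf M^{-p}=\mathbf M^{|p|}$. For $p=0$, set $\Phi_0^+(\mathbf M)=(\det\mathbf M)^{1/m}$. Let $\phi_p(\xi)=\Phi_p^+[\mathbf M(\xi)]$. A design $\xi_p^*\in\Xi$ is $\phi_p$-optimal if it maximizes $\phi_p$ over $\Xi$. Such designs exist and are nonsingular. All $\phi_p$-optimal designs share the same information matrix $\mathbf M_*=\mathbf M(\xi_p^* )$. A support point of a design is a point of the support of the measure. Matrix powers $\mathbf M^{s}$ of positive definite $\mathbf M$ are defined via the spectral decomposition, with $\mathbf M^0=\mathbf I_m$. *)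

theory Defs
  imports "HOL-Probability.Probability"
begin

definition design :: "(real^'m) set \<Rightarrow> (real^'m) measure \<Rightarrow> bool" where
  "design X \<xi> \<longleftrightarrow> sets \<xi> = sets borel \<and> prob_space \<xi> \<and> emeasure \<xi> X = 1"

definition info_matrix :: "(real^'m) measure \<Rightarrow> real^'m^'m" where
  "info_matrix \<xi> = (\<chi> i j. integral\<^sup>L \<xi> (\<lambda>x. x $ i * x $ j))"

definition support :: "(real^'m) measure \<Rightarrow> (real^'m) set" where
  "support \<xi> = {x. \<forall>e>0. emeasure \<xi> (ball x e) > 0}"

definition diag_mat :: "('m \<Rightarrow> real) \<Rightarrow> real^'m^'m" where
  "diag_mat l = (\<chi> i j. if i = j then l i else 0)"

text \<open>Matrix power of a symmetric nonnegative definite matrix via the spectral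
  decomposition M = Q diag(l) Q^T: M^s = Q diag(l^s) Q^T.  For positive definite
  M and s = 0 this gives the identity.\<close>
definition mpow :: "real^'m^'m \<Rightarrow> real \<Rightarrow> real^'m^'m" where
  "mpow M s = (SOME A. \<exists>Q l. orthogonal_matrix Q \<and> (\<forall>i. l i \<ge> 0) \<and>
       M = Q ** diag_mat l ** transpose Q \<and>
       A = Q ** diag_mat (\<lambda>i. l i powr s) ** transpose Q)"

definition lambda_min :: "real^'m^'m \<Rightarrow> real" where
  "lambda_min A = Min {l. \<exists>v. v \<noteq> 0 \<and> A *v v = l *\<^sub>R v}"

definition Phi_plus :: "real \<Rightarrow> real^'m^'m \<Rightarrow> real" where
  "Phi_plus p M =
     (if p = 0 then det M powr (1 / real CARD('m))
      else if p > 0 then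
        (if invertible M then (trace (mpow M (-p)) / real CARD('m)) powr (-1/p) else 0)
      else (trace (mpow M (-p)) / real CARD('m)) powr (-1/p))"

definition phi_optimal :: "(real^'m) set \<Rightarrow> real \<Rightarrow> (real^'m) measure \<Rightarrow> bool" where
  "phi_optimal X p \<xi> \<longleftrightarrow> design X \<xi> \<and>
     (\<forall>\<eta>. design X \<eta> \<longrightarrow> Phi_plus p (info_matrix \<eta>) \<le> Phi_plus p (info_matrix \<xi>))"

definition F_fun :: "real \<Rightarrow> real \<Rightarrow> real \<Rightarrow> real \<Rightarrow> real \<Rightarrow> real \<Rightarrow> real" where
  "F_fun \<tau> \<alpha> \<epsilon> t \<gamma> p =
     \<alpha> / \<tau> powr (p + 1) + (1 - \<alpha>) powr (p + 2) / (1 + \<epsilon> / t - \<alpha> * \<tau>) powr (p + 1) - \<gamma>"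

end

theory Submission
  imports Defs
begin

text \<open>Write \<open>q = p + 1\<close>, let \<open>N\<close> be the optimal information matrix and \<open>t\<^sub>* = tr (N powr (-p))\<close>.
  By the first-order optimality conditions, a support point \<open>x\<close> of an optimal design satisfies
  \<open>x \<bullet> (N powr (-q)) x = t\<^sub>*\<close>, while \<open>tr (N powr (-q) M) \<le> t\<^sub>*\<close> and \<open>tr (M powr (-q) N) \<le> t + \<epsilon>\<close>.
  The first identity bounds \<open>x \<bullet> (M powr (-q)) x\<close> from below by \<open>\<tau> powr q * t\<^sub>*\<close> whenever
  \<open>M powr (-q)\<close> dominates \<open>\<tau> powr q\<close> times \<open>N powr (-q)\<close>; the two trace bounds force
  \<open>F \<tau> \<le> 0\<close>, hence \<open>\<tau> \<ge> \<omega>\<close>.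

  Since \<open>M\<close> and \<open>N\<close> need not commute, the last step rests on the inequality \<open>gap_bound\<close>: for
  \<open>0 < e \<le> 1\<close>, the quantity \<open>tr (A C powr (-e)) + e tr (A powr (-e) C) - (e + 1) tr (A powr (1 - e))\<close>
  is at least its contribution from one generalized eigenvalue of \<open>C\<close> relative to \<open>A\<close>, placed at
  the smallest eigenvalue of \<open>A\<close>. The integral representation of the power reduces it to
  resolvents, where it is an instance of the Cauchy--Schwarz inequality with a rank-one test
  matrix built from that generalized eigenvector.\<close>

subsection \<open>Spectral calculus\<close>

text \<open>The shape of \<open>F_fun\<close> is that of the commuting case. Give the eigenvalues
  \<open>z\<close> of \<open>N\<close> relative to \<open>M\<close> the weights
  \<open>\<mu>^(-p) / t\<close>, which sum to 1. The two trace bounds say that \<open>z\<close> has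
  mean at most \<beta> = 1 + \<epsilon> / t and that z^(-q) has mean at most
  \<open>t\<^sub>* / t\<close>, hence at most \<gamma>. One eigenvalue \<tau> of weight \<alpha>,
  with the others averaged to s = (\<beta> - \<alpha> \<tau>) / (1 - \<alpha>), then gives by
  Jensen's inequality \<alpha> \<tau>^(-q) + (1 - \<alpha>) s^(-q) \<le> \<gamma>, which is
  F(\<tau>) \<le> 0. The weight \<alpha> is the smallest one because the position of the extremal
  direction is unknown. Without commutativity a tangent inequality takes the place of Jensen's: the
  gap is the excess of z^(-q) over its tangent at 1, and dividing \<open>N\<close> by
  \<open>s\<close> moves the point of contact to \<open>s\<close>. Keeping just the contribution of
  \<tau> to the gap then yields the same inequality.\<close>

definition spec :: "real^'m^'m \<Rightarrow> ('m \<Rightarrow> real) \<Rightarrow> real^'m^'m" where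
  "spec Q l = Q ** diag_mat l ** transpose Q"

lemma diag_mat_mult: "diag_mat k ** diag_mat l = diag_mat (\<lambda>i. k i * l i)"
  by (simp add: diag_mat_def matrix_matrix_mult_def vec_eq_iff mult_delta_left)

lemma diag_mat_mult_vec: "diag_mat l *v x = (\<chi> i. l i * x $ i)"
  by (simp add: diag_mat_def matrix_vector_mult_def vec_eq_iff if_distrib if_distribR
      sum.delta cong: if_cong)

lemma diag_mat_one: "diag_mat (\<lambda>i. 1) = mat 1"
  by (simp add: diag_mat_def mat_def)

lemma transpose_diag_mat: "transpose (diag_mat l) = diag_mat l"
  by (simp add: diag_mat_def transpose_def vec_eq_iff)

lemma trace_diag_mat: "trace (diag_mat l) = sum l UNIV"
  by (simp add: trace_def diag_mat_def)

lemma transpose_spec: "transpose (spec Q l) = spec Q l"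
  by (simp add: spec_def matrix_transpose_mul transpose_diag_mat matrix_mul_assoc)

lemma orthogonal_matrix_cancel:
  "orthogonal_matrix Q \<Longrightarrow> A ** transpose Q ** (Q ** B) = A ** B"
  by (metis matrix_mul_assoc matrix_mul_lid orthogonal_matrix_def)

lemma spec_mult:
  assumes "orthogonal_matrix Q"
  shows "spec Q k ** spec Q l = spec Q (\<lambda>i. k i * l i)"
proof -
  have "spec Q k ** spec Q l = (Q ** diag_mat k) ** transpose Q ** (Q ** (diag_mat l ** transpose Q))"
    by (simp add: spec_def matrix_mul_assoc)
  also have "\<dots> = Q ** (diag_mat k ** diag_mat l) ** transpose Q"
    by (subst orthogonal_matrix_cancel[OF assms]) (simp add: matrix_mul_assoc)
  finally show ?thesis by (simp add: diag_mat_mult spec_def)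
qed

lemma spec_one: "orthogonal_matrix Q \<Longrightarrow> spec Q (\<lambda>i. 1) = mat 1"
  by (simp add: spec_def diag_mat_one orthogonal_matrix_def)

text \<open>The vector \<open>x v* Q\<close> is \<open>transpose Q *v x\<close>, that is, the
  coordinates of \<open>x\<close> in the basis formed by the columns of \<open>Q\<close>.\<close>

lemma inner_spec:
  "x \<bullet> (spec Q l *v y) = (\<Sum>i\<in>UNIV. l i * (x v* Q) $ i * (y v* Q) $ i)"
proof -
  have "x \<bullet> (spec Q l *v y) = x \<bullet> (Q *v (diag_mat l *v (y v* Q)))"
    by (simp add: spec_def matrix_vector_mul_assoc[symmetric])
  also have "\<dots> = (x v* Q) \<bullet> (diag_mat l *v (y v* Q))"
    by (simp add: dot_lmul_matrix)
  finally show ?thesis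
    by (simp add: diag_mat_mult_vec inner_vec_def mult_ac)
qed

lemma inner_orthogonal_coords:
  fixes Q :: "real^'m^'m"
  assumes "orthogonal_matrix Q"
  shows "x \<bullet> y = (\<Sum>i\<in>UNIV. (x v* Q) $ i * (y v* Q) $ i)"
  using inner_spec[of x Q "\<lambda>i. 1" y] by (simp add: spec_one[OF assms])

lemma spec_coords:
  fixes Q :: "real^'m^'m"
  assumes "orthogonal_matrix Q"
  shows "((spec Q l *v x) v* Q) $ i = l i * (x v* Q) $ i"
proof -
  have "transpose Q ** spec Q l = transpose Q ** Q ** (diag_mat l ** transpose Q)"
    by (simp add: spec_def matrix_mul_assoc)
  also have "\<dots> = diag_mat l ** transpose Q" using assms by (simp add: orthogonal_matrix_def)
  finally have "transpose Q *v (spec Q l *v x) = diag_mat l *v (transpose Q *v x)"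
    by (metis matrix_vector_mul_assoc)
  thus ?thesis by (simp add: diag_mat_mult_vec)
qed

lemma trace_spec:
  fixes Q :: "real^'m^'m"
  assumes "orthogonal_matrix Q" shows "trace (spec Q l) = sum l UNIV"
proof -
  have "trace (spec Q l) = trace (transpose Q ** (Q ** diag_mat l))"
    unfolding spec_def by (rule trace_mul_sym)
  also have "\<dots> = trace (diag_mat l)"
    using assms by (simp add: matrix_mul_assoc orthogonal_matrix_def)
  finally show ?thesis by (simp add: trace_diag_mat)
qed

text \<open>The inner product of column \<open>i\<close> of \<open>Q\<close> with column
  \<open>k\<close> of \<open>R\<close>. For orthogonal matrices the squares form a doubly stochastic
  matrix, which turns traces of products of noncommuting matrices into weighted double sums of
  scalar terms.\<close>

definition overlap :: "real^'m^'m \<Rightarrow> real^'m^'m \<Rightarrow> 'm \<Rightarrow> 'm \<Rightarrow> real" where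
  "overlap Q R i k = (transpose Q ** R) $ i $ k"

lemma overlap_coords:
  fixes Q R :: "real^'m^'m"
  assumes "orthogonal_matrix R"
  shows "(\<Sum>k\<in>UNIV. overlap Q R i k * (x v* R) $ k) = (x v* Q) $ i"
proof -
  have "(transpose Q ** R) *v (x v* R) = x v* Q"
    using assms by (metis matrix_vector_mul_assoc matrix_vector_mul_lid orthogonal_matrix_def
        transpose_matrix_vector)
  thus ?thesis by (simp add: overlap_def matrix_vector_mult_def vec_eq_iff)
qed

lemma trace_spec_spec:
  fixes Q R :: "real^'m^'m"
  shows "trace (spec Q k ** spec R l) = (\<Sum>i\<in>UNIV. \<Sum>j\<in>UNIV. (overlap Q R i j)\<^sup>2 * (k i * l j))"
proof -
  let ?O = "transpose Q ** R"
  have "trace (spec Q k ** spec R l)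
      = trace (Q ** (diag_mat k ** ?O ** diag_mat l ** transpose R))"
    by (simp add: spec_def matrix_mul_assoc)
  also have "\<dots> = trace (diag_mat k ** ?O ** diag_mat l ** (transpose R ** Q))"
    by (subst trace_mul_sym) (simp add: matrix_mul_assoc)
  also have "transpose R ** Q = transpose ?O" by (simp add: matrix_transpose_mul)
  finally have *: "trace (spec Q k ** spec R l) = trace (diag_mat k ** ?O ** diag_mat l ** transpose ?O)" .
  have e1: "(diag_mat k ** A) $ i $ j = k i * A $ i $ j" for A :: "real^'m^'m" and i j
    by (simp add: matrix_matrix_mult_def diag_mat_def mult_delta_left)
  have e2: "(A ** diag_mat l) $ i $ j = A $ i $ j * l j" for A :: "real^'m^'m" and i j
    by (simp add: matrix_matrix_mult_def diag_mat_def mult_delta_right)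
  have e3: "(A ** transpose B) $ i $ j = (\<Sum>h\<in>UNIV. A $ i $ h * B $ j $ h)" for A B :: "real^'m^'m" and i j
    by (simp add: matrix_matrix_mult_def transpose_def)
  show ?thesis unfolding * unfolding overlap_def trace_def
    by (simp add: e1 e2 e3 power2_eq_square mult_ac)
qed

lemma overlap_sums:
  fixes Q R :: "real^'m^'m"
  assumes "orthogonal_matrix Q" "orthogonal_matrix R"
  shows "(\<Sum>k\<in>UNIV. (overlap Q R i k)\<^sup>2) = 1" "(\<Sum>j\<in>UNIV. (overlap Q R j k)\<^sup>2) = 1"
proof -
  have o: "orthogonal_matrix (transpose Q ** R)"
    using assms by (simp add: orthogonal_matrix_mul)
  have "((transpose Q ** R) ** transpose (transpose Q ** R)) $ i $ i = 1"
    using o by (simp add: orthogonal_matrix_def mat_def)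
  thus "(\<Sum>k\<in>UNIV. (overlap Q R i k)\<^sup>2) = 1"
    by (simp add: overlap_def matrix_matrix_mult_def transpose_def power2_eq_square)
  have "(transpose (transpose Q ** R) ** (transpose Q ** R)) $ k $ k = 1"
    using o by (simp add: orthogonal_matrix_def mat_def)
  thus "(\<Sum>j\<in>UNIV. (overlap Q R j k)\<^sup>2) = 1"
    by (simp add: overlap_def matrix_matrix_mult_def transpose_def power2_eq_square)
qed

lemma sum_overlap_left:
  fixes Q R :: "real^'m^'m"
  assumes "orthogonal_matrix Q" "orthogonal_matrix R"
  shows "(\<Sum>i\<in>UNIV. \<Sum>j\<in>UNIV. (overlap Q R i j)\<^sup>2 * k i) = sum k UNIV"
  by (simp add: sum_distrib_right[symmetric] overlap_sums[OF assms])

lemma sum_overlap_right: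
  fixes Q R :: "real^'m^'m"
  assumes "orthogonal_matrix Q" "orthogonal_matrix R"
  shows "(\<Sum>i\<in>UNIV. \<Sum>j\<in>UNIV. (overlap Q R i j)\<^sup>2 * k j) = sum k UNIV"
  by (subst sum.swap) (simp add: sum_distrib_right[symmetric] overlap_sums[OF assms])

text \<open>Both sides evaluated in the two eigenbases: an overlap that is nonzero forces the
  two eigenvalues to agree, so the functional calculus does not depend on the diagonalization.\<close>

lemma spec_cong:
  fixes Q R :: "real^'m^'m"
  assumes Q: "orthogonal_matrix Q" and R: "orthogonal_matrix R" and eq: "spec Q k = spec R l"
  shows "spec Q (\<lambda>i. f (k i)) = spec R (\<lambda>i. f (l i))"
proof -
  let ?O = "transpose Q ** R"
  have inter: "spec Q k' = spec R l' \<longleftrightarrow> diag_mat k' ** ?O = ?O ** diag_mat l'" for k' l'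
  proof
    assume a: "spec Q k' = spec R l'"
    have "transpose Q ** spec Q k' ** R = transpose Q ** spec R l' ** R" by (simp add: a)
    moreover have "transpose Q ** spec Q k' ** R = (transpose Q ** Q) ** diag_mat k' ** ?O"
      by (simp add: spec_def matrix_mul_assoc)
    moreover have "transpose Q ** spec R l' ** R = ?O ** diag_mat l' ** (transpose R ** R)"
      by (simp add: spec_def matrix_mul_assoc)
    ultimately show "diag_mat k' ** ?O = ?O ** diag_mat l'"
      using Q R by (simp add: orthogonal_matrix_def)
  next
    assume a: "diag_mat k' ** ?O = ?O ** diag_mat l'"
    have "Q ** (diag_mat k' ** ?O) ** transpose R = Q ** (?O ** diag_mat l') ** transpose R"
      by (simp add: a)
    moreover have "Q ** (diag_mat k' ** ?O) ** transpose R = Q ** diag_mat k' ** transpose Q ** (R ** transpose R)"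
      by (simp add: matrix_mul_assoc)
    moreover have "Q ** (?O ** diag_mat l') ** transpose R = (Q ** transpose Q) ** R ** diag_mat l' ** transpose R"
      by (simp add: matrix_mul_assoc)
    ultimately show "spec Q k' = spec R l'"
      using Q R by (simp add: orthogonal_matrix_def spec_def)
  qed
  have entries: "diag_mat k' ** ?O = ?O ** diag_mat l' \<longleftrightarrow> (\<forall>i j. k' i * ?O $ i $ j = ?O $ i $ j * l' j)" for k' l'
    by (simp add: vec_eq_iff matrix_matrix_mult_def[of _ ?O] matrix_matrix_mult_def[of ?O]
        diag_mat_def if_distrib if_distribR sum.delta cong: if_cong)
  show ?thesis using eq unfolding inter entries
    by (metis mult.commute mult_cancel_right)
qed

text \<open>By \<open>spec_cong\<close> every admissible diagonalization gives the same power, so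
  the choice in \<open>mpow\<close> is determined. A zero eigenvalue has power 0 for every exponent,
  because \<open>0 powr s = 0\<close>.\<close>

lemma mpow_spec:
  fixes Q :: "real^'m^'m"
  assumes "orthogonal_matrix Q" "\<And>i. l i \<ge> 0"
  shows "mpow (spec Q l) s = spec Q (\<lambda>i. l i powr s)"
  unfolding mpow_def spec_def[symmetric]
proof (rule someI2)
  show "\<exists>Q' l'. orthogonal_matrix Q' \<and> (\<forall>i. 0 \<le> l' i) \<and> spec Q l = spec Q' l' \<and>
      spec Q (\<lambda>i. l i powr s) = spec Q' (\<lambda>i. l' i powr s)"
    using assms by blast
next
  fix A assume "\<exists>Q' l'. orthogonal_matrix Q' \<and> (\<forall>i. 0 \<le> l' i) \<and> spec Q l = spec Q' l' \<and>
      A = spec Q' (\<lambda>i. l' i powr s)"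
  thus "A = spec Q (\<lambda>i. l i powr s)"
    using spec_cong[OF assms(1), of _ l _ "\<lambda>x. x powr s"] by metis
qed

section \<open>Spectral theorem by maximization of the Rayleigh quotient\<close>

text \<open>Along the line through \<open>x\<close> in direction \<open>v\<close> the form is a
  nonnegative quadratic polynomial without constant term, so its linear coefficient vanishes. This
  replaces differentiation at the maximizers of Rayleigh quotients.\<close>

lemma psd_kernel:
  fixes A :: "real^'m^'m"
  assumes S: "subspace S" and sym: "transpose A = A"
    and psd: "\<And>v. v \<in> S \<Longrightarrow> v \<bullet> (A *v v) \<ge> 0"
    and x: "x \<in> S" "x \<bullet> (A *v x) = 0" and v: "v \<in> S"
  shows "v \<bullet> (A *v x) = 0"
proof (rule ccontr)
  assume nz: "v \<bullet> (A *v x) \<noteq> 0"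
  define b c where "b = v \<bullet> (A *v x)" and "c = v \<bullet> (A *v v)"
  have sym': "x \<bullet> (A *v v) = b"
    unfolding b_def by (metis dot_lmul_matrix inner_commute sym vector_transpose_matrix)
  have c0: "c \<ge> 0" using psd v by (simp add: c_def)
  have "0 \<le> 2 * t * b + t\<^sup>2 * c" for t
  proof -
    have "x + t *\<^sub>R v \<in> S" using S x v by (simp add: subspace_add subspace_scale)
    from psd[OF this] have "0 \<le> x \<bullet> (A *v x) + t * (x \<bullet> (A *v v)) + t * (v \<bullet> (A *v x)) + t * (t * (v \<bullet> (A *v v)))"
      by (simp add: matrix_vector_right_distrib matrix_vector_mult_scaleR inner_add_left inner_add_right algebra_simps)
    thus ?thesis by (simp add: x(2) sym' b_def[symmetric] c_def[symmetric] power2_eq_square algebra_simps)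
  qed
  hence "0 \<le> (c + 1)\<^sup>2 * (2 * t * b + t\<^sup>2 * c)" for t by simp
  \<comment> \<open>The minimizer would be -b / c, but \<open>c\<close> may be 0; the shifted
    denominator still gives a negative value.\<close>
  moreover define t where "t = - b / (c + 1)"
  ultimately have "0 \<le> (c + 1)\<^sup>2 * (2 * t * b + t\<^sup>2 * c)" by blast
  moreover have "t * (c + 1) = - b" using c0 by (simp add: t_def)
  hence "(c + 1)\<^sup>2 * (2 * t * b + t\<^sup>2 * c) = 2 * (- b) * b * (c + 1) + (- b)\<^sup>2 * c"
    by algebra
  ultimately have "2 * b\<^sup>2 * (c + 1) \<le> b\<^sup>2 * c" by (simp add: power2_eq_square algebra_simps)
  moreover have "b\<^sup>2 > 0" using nz b_def by simp
  moreover have "b\<^sup>2 * c \<ge> 0" using c0 by simp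
  moreover have "2 * b\<^sup>2 * (c + 1) = 2 * (b\<^sup>2 * c) + 2 * b\<^sup>2" by (simp add: algebra_simps)
  ultimately show False by linarith
qed

lemma symmetric_dot:
  fixes A :: "real^'m^'m"
  assumes "transpose A = A"
  shows "x \<bullet> (A *v y) = (A *v x) \<bullet> y"
  by (metis assms dot_lmul_matrix vector_transpose_matrix)

text \<open>Each new eigenvector maximizes the quadratic form on the unit sphere of the orthogonal
  complement \<open>S\<close> of the earlier ones. With \<open>l\<close> the maximum,
  \<open>l *\<^sub>R mat 1 - A\<close> is nonnegative on \<open>S\<close> and degenerate at the
  maximizer, so \<open>psd_kernel\<close> applies.\<close>

lemma orthonormal_eigenvectors:
  fixes A :: "real^'m^'m"
  assumes sym: "transpose A = A"
  shows "n \<le> CARD('m) \<Longrightarrow> \<exists>B. card B = n \<and> finite B \<and> pairwise orthogonal B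
    \<and> (\<forall>b\<in>B. norm b = 1 \<and> (\<exists>l. A *v b = l *\<^sub>R b))"
proof (induction n)
  case 0 show ?case by (intro exI[of _ "{}"]) (auto simp: pairwise_def)
next
  case (Suc n)
  then obtain B where B: "card B = n" "finite B" "pairwise orthogonal B"
    "\<And>b. b \<in> B \<Longrightarrow> norm b = 1" "\<And>b. b \<in> B \<Longrightarrow> \<exists>l. A *v b = l *\<^sub>R b" by auto
  define S where "S = {x. \<forall>b\<in>B. orthogonal b x}"
  have Seq: "S = (\<Inter>b\<in>B. {x. b \<bullet> x = 0})" by (auto simp: S_def orthogonal_def)
  have subS: "subspace S" unfolding Seq by (intro subspace_Inter ballI) (auto simp: subspace_hyperplane)
  have "closed S" by (rule closed_subspace[OF subS])
  \<comment> \<open>Strictness leaves a nonzero vector orthogonal to \<open>B\<close>, so the sphere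
    in \<open>S\<close> is nonempty.\<close>
  have "dim (span B) < DIM(real^'m)"
    using B Suc.prems dim_le_card[of "span B" B] by (simp add: span_superset)
  then obtain y where y: "y \<noteq> 0" "\<And>x. x \<in> span (span B) \<Longrightarrow> orthogonal y x"
    using orthogonal_to_subspace_exists[of "span B"] by (metis dim_span span_span)
  have "y \<in> S" unfolding S_def
    using y(2) by (simp add: span_base orthogonal_commute)
  hence yS: "(1 / norm y) *\<^sub>R y \<in> S \<inter> sphere 0 1"
    using y(1) subS by (simp add: subspace_scale)
  have "compact (S \<inter> sphere 0 1)" using \<open>closed S\<close> by (simp add: closed_Int_compact)
  moreover have "continuous_on (S \<inter> sphere 0 1) (\<lambda>x. x \<bullet> (A *v x))"
    by (intro continuous_intros)
  ultimately obtain x where x: "x \<in> S \<inter> sphere 0 1"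
    and mx: "\<And>v. v \<in> S \<inter> sphere 0 1 \<Longrightarrow> v \<bullet> (A *v v) \<le> x \<bullet> (A *v x)"
    using continuous_attains_sup[of "S \<inter> sphere 0 1" "\<lambda>x. x \<bullet> (A *v x)"] yS by blast
  define l where "l = x \<bullet> (A *v x)"
  define C where "C = l *\<^sub>R mat 1 - A"
  have Cv: "C *v v = l *\<^sub>R v - A *v v" for v
    unfolding C_def by (simp add: matrix_vector_mult_diff_rdistrib scaleR_matrix_vector_assoc[symmetric])
  have nx: "norm x = 1" "x \<in> S" using x by auto
  have psd: "v \<bullet> (C *v v) \<ge> 0" if v: "v \<in> S" for v
  proof (cases "v = 0")
    case False
    have "(1 / norm v) *\<^sub>R v \<in> S \<inter> sphere 0 1" using False v subS by (simp add: subspace_scale)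
    from mx[OF this] have "v \<bullet> (A *v v) / (norm v)\<^sup>2 \<le> l"
      by (simp add: matrix_vector_mult_scaleR l_def power2_eq_square)
    hence "v \<bullet> (A *v v) \<le> l * (norm v)\<^sup>2" using False by (simp add: divide_le_eq)
    thus ?thesis by (simp add: Cv inner_diff_right power2_norm_eq_inner)
  qed simp
  have symC: "transpose C = C" using sym by (simp add: C_def transpose_def vec_eq_iff mat_def)
  \<comment> \<open>\<open>psd_kernel\<close> tests only against vectors of \<open>S\<close>;
    invariance of \<open>S\<close> under \<open>A\<close> allows \<open>C *v x\<close> itself as the
    test vector.\<close>
  have AxS: "A *v x \<in> S" unfolding S_def
  proof safe
    fix b assume b: "b \<in> B"
    then obtain k where k: "A *v b = k *\<^sub>R b" using B by blast
    have "b \<bullet> (A *v x) = (A *v b) \<bullet> x" by (rule symmetric_dot[OF sym])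
    also have "\<dots> = 0" using nx(2) b by (simp add: k S_def orthogonal_def)
    finally show "orthogonal b (A *v x)" by (simp add: orthogonal_def)
  qed
  have CxS: "C *v x \<in> S" unfolding Cv using AxS nx(2) subS
    by (simp add: subspace_diff subspace_scale)
  have "x \<bullet> (C *v x) = 0" using nx by (simp add: Cv inner_diff_right l_def[symmetric] norm_eq_1)
  from psd_kernel[OF subS symC psd nx(2) this CxS] have "C *v x = 0" by simp
  hence ev: "A *v x = l *\<^sub>R x" by (simp add: Cv)
  have "x \<notin> B" using nx unfolding S_def by (auto simp: orthogonal_def norm_eq_1)
  moreover have "pairwise orthogonal (insert x B)"
    using B(3) nx(2) by (auto simp: pairwise_insert S_def orthogonal_commute)
  ultimately show ?case using B ev nx(1)
    by (intro exI[of _ "insert x B"]) auto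
qed

theorem spectral_decomposition:
  fixes A :: "real^'m^'m"
  assumes sym: "transpose A = A"
  obtains Q l where "orthogonal_matrix Q" "A = spec Q l"
proof -
  obtain B where B: "card B = CARD('m)" "finite B" "pairwise orthogonal B"
    "\<And>b. b \<in> B \<Longrightarrow> norm b = 1" "\<And>b. b \<in> B \<Longrightarrow> \<exists>l. A *v b = l *\<^sub>R b"
    using orthonormal_eigenvectors[OF sym order_refl] by blast
  obtain f where f: "bij_betw f (UNIV :: 'm set) B"
    using B finite_same_card_bij[of "UNIV :: 'm set" B] by auto
  have fB: "f i \<in> B" for i using f by (auto simp: bij_betw_def)
  have "\<forall>i. \<exists>l. A *v f i = l *\<^sub>R f i" using B(5)[OF fB] by blast
  from choice[OF this] obtain l where l: "\<And>i. A *v f i = l i *\<^sub>R f i" by auto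
  define Q :: "real^'m^'m" where "Q = (\<chi> i j. f j $ i)"
  have col: "column j Q = f j" for j by (simp add: Q_def column_def vec_eq_iff)
  have oQ: "orthogonal_matrix Q"
    unfolding orthogonal_matrix_orthonormal_columns col
  proof (intro conjI allI impI)
    fix i j :: 'm assume "i \<noteq> j"
    hence "f i \<noteq> f j" using f by (auto simp: bij_betw_def inj_on_def)
    thus "orthogonal (f i) (f j)" using B(3) fB by (auto simp: pairwise_def)
  qed (use B fB in auto)
  have "A ** Q = Q ** diag_mat l"
  proof -
    have "(A ** Q) $ i $ j = (A *v f j) $ i" for i j
      by (simp add: matrix_matrix_mult_def matrix_vector_mult_def Q_def)
    moreover have "(Q ** diag_mat l) $ i $ j = l j * f j $ i" for i j
      by (simp add: matrix_matrix_mult_def diag_mat_def Q_def if_distrib if_distribR sum.delta cong: if_cong)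
    ultimately show ?thesis by (simp add: vec_eq_iff l)
  qed
  hence "spec Q l = A ** (Q ** transpose Q)" by (simp add: spec_def matrix_mul_assoc)
  hence "A = spec Q l" using oQ by (simp add: orthogonal_matrix_def)
  with oQ show ?thesis by (rule that)
qed

subsection \<open>Integral representation of negative powers\<close>

text \<open>The kernel is dominated by s^(-e) on [0, 1] and by s^(-e-1) beyond 1;
  \<open>e < 1\<close> gives integrability at 0 and \<open>e > 0\<close> at infinity.\<close>

lemma powr_kernel_integrable:
  assumes "0 < e" "e < (1::real)"
  shows "integrable lborel (\<lambda>s. indicator {0<..} s * (s powr (-e) / (1 + s)))"
proof -
  have 1: "set_integrable lborel {0..1} (\<lambda>s::real. s powr (-e))"
  proof -
    have "(\<lambda>s::real. s powr (-e)) absolutely_integrable_on {0..1}"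
      using assms by (intro nonnegative_absolutely_integrable_1 integrable_on_powr_from_0) auto
    thus ?thesis unfolding set_integrable_def
      by (subst (asm) integrable_completion) auto
  qed
  have 2: "set_integrable lborel {1..} (\<lambda>s::real. s powr (-e-1))"
  proof -
    have "(\<lambda>s::real. s powr (-e-1)) absolutely_integrable_on {1..}"
      using assms has_integral_powr_to_inf[of "-e-1" 1]
      by (intro nonnegative_absolutely_integrable_1) (auto simp: integrable_on_def)
    thus ?thesis unfolding set_integrable_def
      by (subst (asm) integrable_completion) auto
  qed
  have "integrable lborel (\<lambda>s::real. indicator {0..1} s *\<^sub>R s powr (-e) + indicator {1..} s *\<^sub>R s powr (-e-1))"
    using 1 2 unfolding set_integrable_def by (rule Bochner_Integration.integrable_add)
  thus ?thesis
  proof (rule Bochner_Integration.integrable_bound)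
    show "AE s in lborel. norm (indicator {0<..} s * (s powr (-e) / (1 + s)))
        \<le> norm (indicator {0..1} s *\<^sub>R s powr (-e) + indicator {1..} s *\<^sub>R s powr (-e-1))"
    proof (intro AE_I2)
      fix s :: real
      consider "s \<le> 0" | "0 < s" "s \<le> 1" | "s > 1" by linarith
      thus "norm (indicator {0<..} s * (s powr (-e) / (1 + s)))
        \<le> norm (indicator {0..1} s *\<^sub>R s powr (-e) + indicator {1..} s *\<^sub>R s powr (-e-1))"
      proof cases
        case 2
        have "s powr (-e) / (1 + s) \<le> s powr (-e) / 1" using 2 by (intro divide_left_mono) auto
        hence "s powr (-e) / (1 + s) \<le> s powr (-e)" by simp
        also have "\<dots> \<le> s powr (-e) + indicator {1..} s * s powr (-e-1)" by simp
        finally show ?thesis using 2 by (simp add: abs_of_nonneg)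
      next
        case 3
        have "s powr (-e) / (1 + s) \<le> s powr (-e) / s" using 3 by (intro divide_left_mono) auto
        also have "\<dots> = s powr (-e-1)" using 3 by (simp add: powr_diff)
        finally show ?thesis using 3 by simp
      qed simp
    qed
  qed simp
qed

lemma has_bochner_integral_nonneg:
  fixes f :: "'a \<Rightarrow> real"
  assumes "has_bochner_integral M f v" "\<And>x. 0 \<le> f x"
  shows "0 \<le> v"
  using has_bochner_integral_integral_eq[OF assms(1)] assms(2)
    Bochner_Integration.integral_nonneg[of M f] by simp

text \<open>For 0 < e < 1 this is pi / sin (pi e). Its positivity allows it to be cancelled from
  integrated inequalities.\<close>

definition powr_const :: "real \<Rightarrow> real" where
  "powr_const e = (LINT s|lborel. indicator {0<..} s * (s powr (-e) / (1 + s)))"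

lemma powr_const_pos:
  assumes "0 < e" "e < (1::real)"
  shows "powr_const e > 0"
proof -
  have "0 < 2 powr (-e) / 3" by simp
  also have "\<dots> = (LINT s|lborel. indicator {1..2::real} s * (2 powr (-e) / 3))" by simp
  also have "\<dots> \<le> powr_const e" unfolding powr_const_def
  proof (rule integral_mono)
    show "integrable lborel (\<lambda>s. indicat_real {1..2::real} s * (2 powr - e / 3))"
      by (intro integrable_mult_left integrable_real_indicator) simp_all
    show "integrable lborel (\<lambda>s. indicator {0<..} s * (s powr (-e) / (1 + s)))"
      by (rule powr_kernel_integrable[OF assms])
    fix s :: real
    show "indicat_real {1..2} s * (2 powr - e / 3) \<le> indicat_real {0<..} s * (s powr - e / (1 + s))"
    proof (cases "s \<in> {1..2}")
      case True
      hence "2 powr (-e) \<le> s powr (-e)" using assms by (intro powr_mono2') auto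
      hence "2 powr (-e) / 3 \<le> s powr (-e) / (1 + s)" using True by (intro frac_le) auto
      thus ?thesis using True by simp
    next
      case False
      thus ?thesis by (auto simp: indicator_def zero_le_divide_iff)
    qed
  qed
  finally show ?thesis .
qed

text \<open>The substitution s -> b s on the half line: a homogeneous kernel needs to be integrated
  only for the parameter 1.\<close>

lemma has_bochner_integral_scale:
  assumes b: "b > (0::real)"
    and f: "has_bochner_integral lborel (\<lambda>s. indicator {0<..} s * f s) v"
    and eq: "\<And>s. s > 0 \<Longrightarrow> g (b * s) = c * f s"
  shows "has_bochner_integral lborel (\<lambda>s. indicator {0<..} s * g s) (b * c * v)"
proof -
  have "has_bochner_integral lborel (\<lambda>s. c * (indicator {0<..} s * f s)) (c * v)"
    using f by (rule has_bochner_integral_mult_right)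
  moreover have "c * (indicator {0<..} s * f s) = indicator {0<..} (0 + b * s) * g (0 + b * s)" for s
    using b eq[of s] by (auto simp: indicator_def zero_less_mult_iff)
  ultimately have "has_bochner_integral lborel (\<lambda>s. indicator {0<..} (0 + b * s) * g (0 + b * s)) ((b * c * v) /\<^sub>R \<bar>b\<bar>)"
    using b by (simp add: field_simps)
  thus ?thesis using b by (subst lborel_has_bochner_integral_real_affine_iff[where c = b and t = 0]) auto
qed

lemma powr_resolvent_integral:
  assumes e: "0 < e" "e < (1::real)" and b: "b > 0"
  shows "has_bochner_integral lborel (\<lambda>s. indicator {0<..} s * (s powr (-e) / (b + s)))
    (powr_const e * b powr (-e))"
proof -
  have "has_bochner_integral lborel (\<lambda>s. indicator {0<..} s * (s powr (-e) / (b + s)))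
      (b * (b powr (-e) / b) * powr_const e)"
  proof (rule has_bochner_integral_scale[OF b])
    show "has_bochner_integral lborel (\<lambda>s. indicator {0<..} s * (s powr (-e) / (1 + s))) (powr_const e)"
      unfolding powr_const_def by (rule has_bochner_integral_integrable[OF powr_kernel_integrable[OF e]])
    show "(b * s) powr (-e) / (b + b * s) = b powr (-e) / b * (s powr (-e) / (1 + s))" if "s > 0" for s
      using b that by (simp add: powr_mult field_simps)
  qed
  thus ?thesis using b by (simp add: mult.commute)
qed

text \<open>The constant of the squared resolvent is not computed by integration by parts: the
  integral of the remainder is nonnegative and vanishes at \<open>b = 1\<close>, so its
  derivative there must vanish.\<close>

lemma powr_resolvent_sq_integral:
  assumes e: "0 < e" "e < (1::real)" and b: "b > 0"
  shows "has_bochner_integral lborel (\<lambda>s. indicator {0<..} s * (s powr (-e) / (b + s)\<^sup>2))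
    (e * powr_const e * b powr (-e-1))"
proof -
  have int: "integrable lborel (\<lambda>s. indicator {0<..} s * (s powr (-e) / (1 + s)\<^sup>2))"
  proof (rule Bochner_Integration.integrable_bound[OF powr_kernel_integrable[OF e]])
    show "AE s in lborel. norm (indicator {0<..} s * (s powr (-e) / (1 + s)\<^sup>2))
        \<le> norm (indicator {0<..} s * (s powr (-e) / (1 + s)))"
    proof (intro AE_I2)
      fix s :: real
      have "s powr (-e) / (1 + s)\<^sup>2 \<le> s powr (-e) / (1 + s)" if "s > 0"
        using that by (intro divide_left_mono) (auto simp: power2_eq_square)
      thus "norm (indicator {0<..} s * (s powr (-e) / (1 + s)\<^sup>2)) \<le> norm (indicator {0<..} s * (s powr (-e) / (1 + s)))"
        by (auto simp: indicator_def)
    qed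
  qed simp
  define L where "L = (LINT s|lborel. indicator {0<..} s * (s powr (-e) / (1 + s)\<^sup>2))"
  have L: "has_bochner_integral lborel (\<lambda>s. indicator {0<..} s * (s powr (-e) / (1 + s)\<^sup>2)) L"
    unfolding L_def by (rule has_bochner_integral_integrable[OF int])
  define h where "h = (\<lambda>x::real. powr_const e * x powr (-e) - powr_const e * 1 powr (-e) + (x - 1) * L)"
  have h: "0 \<le> h x" if x: "x > 0" for x
  proof -
    have "has_bochner_integral lborel (\<lambda>s. indicator {0<..} s * (s powr (-e) / (x + s))
        - indicator {0<..} s * (s powr (-e) / (1 + s))
        + (x - 1) * (indicator {0<..} s * (s powr (-e) / (1 + s)\<^sup>2))) (h x)"
      unfolding h_def
      by (intro has_bochner_integral_add has_bochner_integral_diff has_bochner_integral_mult_right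
          powr_resolvent_integral e x L) simp_all
    moreover have "0 \<le> indicator {0<..} s * (s powr (-e) / (x + s))
        - indicator {0<..} s * (s powr (-e) / (1 + s))
        + (x - 1) * (indicator {0<..} s * (s powr (-e) / (1 + s)\<^sup>2))" for s
    proof (cases "s > 0")
      case True
      have "s powr (-e) / (x + s) - s powr (-e) / (1 + s) + (x - 1) * (s powr (-e) / (1 + s)\<^sup>2)
          = s powr (-e) * ((x - 1)\<^sup>2 / ((1 + s)\<^sup>2 * (x + s)))"
        using True x by (simp add: divide_simps) algebra
      also have "\<dots> \<ge> 0" using True x by simp
      finally show ?thesis using True by simp
    qed simp
    ultimately show ?thesis by (rule has_bochner_integral_nonneg)
  qed
  have "(h has_real_derivative (powr_const e * (-e * 1 powr (-e-1)) + L)) (at 1)"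
    unfolding h_def by (auto intro!: derivative_eq_intros)
  moreover have "h 1 \<le> h y" if "\<bar>1 - y\<bar> < 1" for y
    using h[of y] that by (simp add: h_def)
  ultimately have "powr_const e * (-e * 1 powr (-e-1)) + L = 0"
    using DERIV_local_min[of h "powr_const e * (-e * 1 powr (-e-1)) + L" 1 1] by (metis zero_less_one)
  hence Leq: "L = e * powr_const e" by simp
  have "has_bochner_integral lborel (\<lambda>s. indicator {0<..} s * (s powr (-e) / (b + s)\<^sup>2))
      (b * (b powr (-e) / b\<^sup>2) * L)"
  proof (rule has_bochner_integral_scale[OF b L])
    show "(b * s) powr (-e) / (b + b * s)\<^sup>2 = b powr (-e) / b\<^sup>2 * (s powr (-e) / (1 + s)\<^sup>2)" if "s > 0" for s
    proof -
      have "(b + b * s)\<^sup>2 = b\<^sup>2 * (1 + s)\<^sup>2" by (simp add: power2_eq_square algebra_simps)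
      thus ?thesis using b that by (simp add: powr_mult)
    qed
  qed
  thus ?thesis using b by (simp add: Leq powr_diff power2_eq_square mult_ac)
qed

text \<open>This is \<open>a\<close> times the excess of b^(-e) over the tangent of that convex
  function at \<open>a\<close>. It is homogeneous of degree 1 - e in the pair \<open>a\<close>,
  \<open>b\<close>.\<close>

definition gap :: "real \<Rightarrow> real \<Rightarrow> real \<Rightarrow> real" where
  "gap e a b = a * b powr (-e) + e * a powr (-e) * b - (e + 1) * a powr (1 - e)"

text \<open>The kernel is s^(-e) times \<open>a\<close> times the tangent excess at \<open>a\<close>
  of b -> 1 / (b + s), namely 1/(b+s) - 1/(a+s) + (b-a)/(a+s)^2 = (b-a)^2 / ((a+s)^2 (b+s)).\<close>

lemma gap_integral:
  assumes e: "0 < e" "e < 1" and a: "a > 0" and b: "b > 0"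
  shows "has_bochner_integral lborel
    (\<lambda>s. indicator {0<..} s * (s powr (-e) * (a * (b - a)\<^sup>2 / ((a + s)\<^sup>2 * (b + s)))))
    (powr_const e * gap e a b)"
proof -
  have "has_bochner_integral lborel (\<lambda>s. a * (indicator {0<..} s * (s powr (-e) / (b + s))
        - indicator {0<..} s * (s powr (-e) / (a + s))
        + (b - a) * (indicator {0<..} s * (s powr (-e) / (a + s)\<^sup>2))))
     (a * (powr_const e * b powr (-e) - powr_const e * a powr (-e) + (b - a) * (e * powr_const e * a powr (-e-1))))"
    by (intro has_bochner_integral_add has_bochner_integral_diff has_bochner_integral_mult_right
          powr_resolvent_integral powr_resolvent_sq_integral e a b)
  moreover have "a * (indicator {0<..} s * (s powr (-e) / (b + s))
        - indicator {0<..} s * (s powr (-e) / (a + s))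
        + (b - a) * (indicator {0<..} s * (s powr (-e) / (a + s)\<^sup>2)))
    = indicator {0<..} s * (s powr (-e) * (a * (b - a)\<^sup>2 / ((a + s)\<^sup>2 * (b + s))))" for s
    using a b by (cases "s > 0") (simp_all add: divide_simps, algebra)
  moreover have "a * (powr_const e * b powr (-e) - powr_const e * a powr (-e) + (b - a) * (e * powr_const e * a powr (-e-1)))
      = powr_const e * gap e a b"
    using a by (simp add: gap_def powr_diff powr_add powr_minus field_simps)
  ultimately show ?thesis by simp
qed

subsection \<open>A trace inequality along a generalized eigenvector\<close>

text \<open>Here \<open>w\<close> stands for the overlaps of the eigenbases of \<open>A\<close> and
  \<open>C\<close>, with eigenvalues \<mu> and \<nu>, and \<open>x\<close>, \<open>y\<close> for the
  coordinates of one vector z with C z = n A z. The right side is the squared Frobenius norm of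
  v(A)^(1/2) (C - A) (C + s)^(-1/2) with v(A) = A (A + s)^(-2).\<close>

lemma resolvent_gap_bound:
  fixes w :: "'m::finite \<Rightarrow> 'm \<Rightarrow> real"
  assumes w1: "\<And>i. (\<Sum>k\<in>UNIV. w i k * y k) = x i"
    and w2: "\<And>i. (\<Sum>k\<in>UNIV. w i k * (\<nu> k * y k)) = n * (\<mu> i * x i)"
    and xy: "(\<Sum>k\<in>UNIV. (y k)\<^sup>2) = (\<Sum>i\<in>UNIV. (x i)\<^sup>2)"
    and xy': "(\<Sum>k\<in>UNIV. \<nu> k * (y k)\<^sup>2) = n * (\<Sum>i\<in>UNIV. \<mu> i * (x i)\<^sup>2)"
    and x0: "\<exists>i. x i \<noteq> 0"
    and \<nu>: "\<And>k. \<nu> k > 0" and \<mu>: "\<And>i. \<mu> i \<ge> a" and a: "a > 0" and n: "n > 0" and s: "s \<ge> 0"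
  shows "a * (n * a - a)\<^sup>2 / ((a + s)\<^sup>2 * (n * a + s))
    \<le> (\<Sum>i\<in>UNIV. \<Sum>k\<in>UNIV. (w i k)\<^sup>2 * (\<mu> i * (\<nu> k - \<mu> i)\<^sup>2 / ((\<mu> i + s)\<^sup>2 * (\<nu> k + s))))"
    (is "?L \<le> ?S")
proof -
  define v where "v i = \<mu> i / (\<mu> i + s)\<^sup>2" for i
  define X0 where "X0 = (\<Sum>i\<in>UNIV. (x i)\<^sup>2)"
  define X1 where "X1 = (\<Sum>i\<in>UNIV. \<mu> i * (x i)\<^sup>2)"
  define Z where "Z = (\<Sum>i\<in>UNIV. v i * (\<mu> i * x i)\<^sup>2)"
  have \<mu>0: "\<mu> i > 0" for i using \<mu>[of i] a by linarith
  have v0: "v i > 0" for i using \<mu>0[of i] s by (simp add: v_def)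
  \<comment> \<open>\<open>f\<close> lists the entries of that matrix; \<open>g\<close> is the
    rank-one matrix formed from v(A)^(1/2) A z and (C + s)^(1/2) z. Since (C - A) z = (n - 1) A z,
    their inner product is (n - 1) \<open>Z\<close>, and the unknown eigenvalues drop out.\<close>
  define f where "f = (\<lambda>(i,k). w i k * (\<nu> k - \<mu> i) * sqrt (v i) / sqrt (\<nu> k + s))"
  define g where "g = (\<lambda>(i,k). sqrt (v i) * (\<mu> i * x i) * (y k * sqrt (\<nu> k + s)))"
  have pos: "\<nu> k + s > 0" for k using \<nu>[of k] s by linarith
  have ff: "(\<Sum>p\<in>UNIV \<times> UNIV. (f p)\<^sup>2) = ?S"
    unfolding f_def sum.cartesian_product
    by (intro sum.cong refl)
      (use v0 pos in \<open>simp add: power_divide power_mult_distrib less_imp_le v_def mult_ac split: prod.splits\<close>)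
  have fg: "(\<Sum>p\<in>UNIV \<times> UNIV. f p * g p) = (n - 1) * Z"
  proof -
    have fgp: "f (i,k) * g (i,k) = v i * (\<mu> i * x i) * (w i k * (\<nu> k * y k)) - v i * (\<mu> i * x i) * \<mu> i * (w i k * y k)" for i k
    proof -
      have "f (i,k) * g (i,k) = (sqrt (v i) * sqrt (v i)) * (w i k * (\<nu> k - \<mu> i) * (\<mu> i * x i) * y k)"
        using pos[of k] by (simp add: f_def g_def)
      also have "sqrt (v i) * sqrt (v i) = v i" using v0[of i] by simp
      finally show ?thesis by (simp add: algebra_simps)
    qed
    have "(\<Sum>p\<in>UNIV \<times> UNIV. f p * g p) = (\<Sum>i\<in>UNIV. \<Sum>k\<in>UNIV. f (i,k) * g (i,k))"
      by (simp add: sum.cartesian_product)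
    also have "\<dots> = (\<Sum>i\<in>UNIV. v i * (\<mu> i * x i) * (n * (\<mu> i * x i)) - v i * (\<mu> i * x i) * \<mu> i * x i)"
      by (simp only: fgp sum_subtractf sum_distrib_left[symmetric] w1 w2)
    also have "\<dots> = (n - 1) * Z"
      unfolding Z_def sum_distrib_left
      by (intro sum.cong refl) (simp add: power2_eq_square algebra_simps)
    finally show ?thesis .
  qed
  have gg: "(\<Sum>p\<in>UNIV \<times> UNIV. (g p)\<^sup>2) = Z * (n * X1 + s * X0)"
  proof -
    have "(g (i,k))\<^sup>2 = (v i * (\<mu> i * x i)\<^sup>2) * (\<nu> k * (y k)\<^sup>2 + s * (y k)\<^sup>2)" for i k
      using v0[of i] pos[of k] by (simp add: g_def power_mult_distrib less_imp_le algebra_simps)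
    hence "(\<Sum>p\<in>UNIV \<times> UNIV. (g p)\<^sup>2) = Z * (\<Sum>k\<in>UNIV. \<nu> k * (y k)\<^sup>2 + s * (y k)\<^sup>2)"
      unfolding Z_def sum_product sum.cartesian_product
      by (intro sum.cong) auto
    also have "(\<Sum>k\<in>UNIV. \<nu> k * (y k)\<^sup>2 + s * (y k)\<^sup>2) = n * X1 + s * X0"
      by (simp add: sum.distrib sum_distrib_left[symmetric] xy xy' X0_def X1_def)
    finally show ?thesis .
  qed
  have CS: "((n - 1) * Z)\<^sup>2 \<le> ?S * (Z * (n * X1 + s * X0))"
    using Cauchy_Schwarz_ineq_sum[of f g "UNIV \<times> UNIV"] by (simp only: ff fg gg)
  obtain i0 where i0: "x i0 \<noteq> 0" using x0 by blast
  have X1: "X1 > 0" unfolding X1_def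
    by (rule sum_pos2[of _ i0]) (use i0 \<mu>0 in \<open>auto simp: less_imp_le\<close>)
  have Z: "Z > 0" unfolding Z_def
  proof (rule sum_pos2[of _ i0])
    show "0 < v i0 * (\<mu> i0 * x i0)\<^sup>2" using i0 \<mu>0[of i0] v0[of i0] by simp
  qed (use v0 in \<open>auto simp: less_imp_le\<close>)
  \<comment> \<open>From here \<mu> i \<ge> a replaces the spectrum of \<open>A\<close> by
    \<open>a\<close>: the bound on \<open>X0\<close> controls the norm of \<open>g\<close>, and
    \<open>ZX\<close> bounds \<open>Z\<close> below because u / (u + s) increases with u.\<close>
  have X0: "X0 \<le> X1 / a"
  proof -
    have "a * X0 \<le> X1" unfolding X0_def X1_def sum_distrib_left
      by (intro sum_mono mult_right_mono \<mu>) auto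
    thus ?thesis using a by (simp add: field_simps)
  qed
  have X00: "X0 \<ge> 0" unfolding X0_def by (intro sum_nonneg) auto
  have ZX: "(a / (a + s))\<^sup>2 * X1 \<le> Z" unfolding X1_def Z_def sum_distrib_left
  proof (intro sum_mono)
    fix i
    have "a * (\<mu> i + s) \<le> \<mu> i * (a + s)"
      using mult_right_mono[OF \<mu>[of i] s] by (simp add: algebra_simps)
    moreover have "a + s > 0" "\<mu> i + s > 0" using a s \<mu>0[of i] by linarith+
    ultimately have "a / (a + s) \<le> \<mu> i / (\<mu> i + s)" by (simp add: divide_simps mult.commute)
    hence "(a / (a + s))\<^sup>2 \<le> (\<mu> i / (\<mu> i + s))\<^sup>2" using a s by (intro power_mono) auto
    hence "(a / (a + s))\<^sup>2 * (\<mu> i * (x i)\<^sup>2) \<le> (\<mu> i / (\<mu> i + s))\<^sup>2 * (\<mu> i * (x i)\<^sup>2)"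
      using \<mu>0[of i] by (intro mult_right_mono) auto
    also have "\<dots> = v i * (\<mu> i * x i)\<^sup>2"
      by (simp add: v_def power_divide power_mult_distrib)
    finally show "(a / (a + s))\<^sup>2 * (\<mu> i * (x i)\<^sup>2) \<le> v i * (\<mu> i * x i)\<^sup>2" .
  qed
  have S0: "?S \<ge> 0"
    by (intro sum_nonneg mult_nonneg_nonneg divide_nonneg_nonneg) (use \<mu>0 pos in \<open>auto simp: less_imp_le\<close>)
  have "(n - 1)\<^sup>2 * Z \<le> ?S * (n * X1 + s * X0)"
  proof -
    have "Z * ((n - 1)\<^sup>2 * Z) \<le> Z * (?S * (n * X1 + s * X0))"
      using CS by (simp add: power_mult_distrib power2_eq_square mult_ac)
    thus ?thesis using Z by simp
  qed
  also have "\<dots> \<le> ?S * (n * X1 + s * (X1 / a))"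
    using S0 s X0 by (intro mult_left_mono add_left_mono) auto
  finally have "(n - 1)\<^sup>2 * ((a / (a + s))\<^sup>2 * X1) \<le> ?S * (n * X1 + s * (X1 / a))"
    using ZX by (meson mult_left_mono order_trans zero_le_power2)
  hence "X1 * ((n - 1)\<^sup>2 * (a / (a + s))\<^sup>2) \<le> X1 * (?S * (n + s / a))"
    by (simp add: algebra_simps)
  hence main: "(n - 1)\<^sup>2 * (a / (a + s))\<^sup>2 \<le> ?S * (n + s / a)" using X1 by simp
  have na: "n * a + s > 0" using n a s by (simp add: add_pos_nonneg)
  have "?L = ((n - 1)\<^sup>2 * (a / (a + s))\<^sup>2) / ((n * a + s) / a)"
  proof -
    have "n * a - a = (n - 1) * a" by (simp add: algebra_simps)
    thus ?thesis using a by (simp add: power_divide power_mult_distrib power2_eq_square)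
  qed
  also have "(n * a + s) / a = n + s / a" using a by (simp add: field_simps)
  also have "((n - 1)\<^sup>2 * (a / (a + s))\<^sup>2) / (n + s / a) \<le> ?S"
    using main n s a by (subst pos_divide_le_eq) (auto simp: add_pos_nonneg)
  finally show ?thesis .
qed

text \<open>The weights are squares and the kernels come from \<open>gap_integral\<close>, so the
  resolvent bound integrates termwise.\<close>

lemma gap_bound:
  fixes w :: "'m::finite \<Rightarrow> 'm \<Rightarrow> real"
  assumes e: "0 < e" "e \<le> 1"
    and w1: "\<And>i. (\<Sum>k\<in>UNIV. w i k * y k) = x i"
    and w2: "\<And>i. (\<Sum>k\<in>UNIV. w i k * (\<nu> k * y k)) = n * (\<mu> i * x i)"
    and xy: "(\<Sum>k\<in>UNIV. (y k)\<^sup>2) = (\<Sum>i\<in>UNIV. (x i)\<^sup>2)"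
    and xy': "(\<Sum>k\<in>UNIV. \<nu> k * (y k)\<^sup>2) = n * (\<Sum>i\<in>UNIV. \<mu> i * (x i)\<^sup>2)"
    and x0: "\<exists>i. x i \<noteq> 0"
    and \<nu>: "\<And>k. \<nu> k > 0" and \<mu>: "\<And>i. \<mu> i \<ge> a" and a: "a > 0" and n: "n > 0"
  shows "gap e a (n * a) \<le> (\<Sum>i\<in>UNIV. \<Sum>k\<in>UNIV. (w i k)\<^sup>2 * gap e (\<mu> i) (\<nu> k))"
proof -
  have \<mu>0: "\<mu> i > 0" for i using \<mu>[of i] a by linarith
  note bound = resolvent_gap_bound[where w = w, OF w1 w2 xy xy' x0 \<nu> \<mu> a n]
  show ?thesis
  proof (cases "e = 1")
    \<comment> \<open>At e = 1 the integral diverges, but the gap is itself the resolvent kernel at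
      s = 0.\<close>
    case True
    have "gap e a' b' = a' * (b' - a')\<^sup>2 / ((a' + 0)\<^sup>2 * (b' + 0))" if "a' > 0" "b' > 0" for a' b'
      using that by (simp add: gap_def True powr_minus field_simps power2_eq_square)
    thus ?thesis using bound[of 0] \<mu>0 \<nu> a n by simp
  next
    case False
    hence e1: "e < 1" using e by simp
    define kf where "kf a b s = indicator {0<..} s * (s powr (-e) * (a * (b - a)\<^sup>2 / ((a + s)\<^sup>2 * (b + s))))"
      for a b s :: real
    have I: "has_bochner_integral lborel (kf a' b') (powr_const e * gap e a' b')" if "a' > 0" "b' > 0" for a' b'
      unfolding kf_def by (rule gap_integral) (use e e1 that in auto)
    have 1: "has_bochner_integral lborel (\<lambda>s. \<Sum>i\<in>UNIV. \<Sum>k\<in>UNIV. (w i k)\<^sup>2 * kf (\<mu> i) (\<nu> k) s)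
       (\<Sum>i\<in>UNIV. \<Sum>k\<in>UNIV. (w i k)\<^sup>2 * (powr_const e * gap e (\<mu> i) (\<nu> k)))"
      by (intro has_bochner_integral_sum has_bochner_integral_mult_right I \<mu>0 \<nu>)
    have 2: "has_bochner_integral lborel (kf a (n * a)) (powr_const e * gap e a (n * a))"
      by (rule I) (use a n in auto)
    have le: "kf a (n * a) s \<le> (\<Sum>i\<in>UNIV. \<Sum>k\<in>UNIV. (w i k)\<^sup>2 * kf (\<mu> i) (\<nu> k) s)" for s
    proof (cases "s > 0")
      case True
      have "kf a (n * a) s = s powr (-e) * (a * (n * a - a)\<^sup>2 / ((a + s)\<^sup>2 * (n * a + s)))"
        using True by (simp add: kf_def)
      also have "\<dots> \<le> s powr (-e) * (\<Sum>i\<in>UNIV. \<Sum>k\<in>UNIV. (w i k)\<^sup>2 * (\<mu> i * (\<nu> k - \<mu> i)\<^sup>2 / ((\<mu> i + s)\<^sup>2 * (\<nu> k + s))))"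
        using bound[of s] True by (intro mult_left_mono) auto
      also have "\<dots> = (\<Sum>i\<in>UNIV. \<Sum>k\<in>UNIV. (w i k)\<^sup>2 * kf (\<mu> i) (\<nu> k) s)"
        unfolding sum_distrib_left kf_def using True by (intro sum.cong refl) simp
      finally show ?thesis .
    qed (simp add: kf_def)
    have "powr_const e * gap e a (n * a) \<le> (\<Sum>i\<in>UNIV. \<Sum>k\<in>UNIV. (w i k)\<^sup>2 * (powr_const e * gap e (\<mu> i) (\<nu> k)))"
      unfolding has_bochner_integral_integral_eq[OF 1, symmetric] has_bochner_integral_integral_eq[OF 2, symmetric]
      using 1 2 le by (intro integral_mono) (auto dest: has_bochner_integral_integrable simp: has_bochner_integral_iff)
    also have "\<dots> = powr_const e * (\<Sum>i\<in>UNIV. \<Sum>k\<in>UNIV. (w i k)\<^sup>2 * gap e (\<mu> i) (\<nu> k))"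
      unfolding sum_distrib_left by (intro sum.cong refl) simp
    finally show ?thesis using powr_const_pos[OF e(1) e1] by simp
  qed
qed

section \<open>Generalized eigenvectors and order reversal of negative powers\<close>

lemma spec_scaleR: "spec Q (\<lambda>i. c * l i) = c *\<^sub>R spec Q l"
proof -
  have "diag_mat (\<lambda>i. c * l i) = c *\<^sub>R diag_mat l"
    by (simp add: diag_mat_def vec_eq_iff)
  thus ?thesis
    by (simp add: spec_def scalar_matrix_assoc[symmetric] matrix_scalar_ac)
qed

lemma spec_pos:
  fixes Q :: "real^'m^'m"
  assumes Q: "orthogonal_matrix Q" and l: "\<And>i. l i > 0" and x: "x \<noteq> 0"
  shows "x \<bullet> (spec Q l *v x) > 0"
proof -
  have "(\<Sum>i\<in>UNIV. ((x v* Q) $ i)\<^sup>2) = x \<bullet> x"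
    using inner_orthogonal_coords[OF Q, of x x] by (simp add: power2_eq_square)
  hence "(\<Sum>i\<in>UNIV. ((x v* Q) $ i)\<^sup>2) \<noteq> 0" using x by simp
  then obtain i where "(x v* Q) $ i \<noteq> 0"
    by (metis (no_types, lifting) power_zero_numeral sum.neutral)
  hence "0 < (\<Sum>i\<in>UNIV. l i * ((x v* Q) $ i)\<^sup>2)"
    by (intro sum_pos2[of _ i]) (use l in \<open>auto simp: less_imp_le\<close>)
  thus ?thesis by (simp add: inner_spec power2_eq_square mult.assoc)
qed

text \<open>A maximizer of the quotient of the forms of \<open>C\<close> and \<open>A\<close> exists
  on the compact unit sphere. With \<open>n\<close> the maximum, \<open>n *\<^sub>R A - C\<close> is
  nonnegative and degenerate there, so \<open>psd_kernel\<close> makes it annihilate the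
  maximizer.\<close>

lemma extremal_generalized_eigenvector:
  fixes A C :: "real^'m^'m"
  assumes A: "transpose A = A" "\<And>x. x \<noteq> 0 \<Longrightarrow> x \<bullet> (A *v x) > 0" and C: "transpose C = C"
  obtains n x where "x \<noteq> 0" "C *v x = n *\<^sub>R (A *v x)" "\<And>v. v \<bullet> (C *v v) \<le> n * (v \<bullet> (A *v v))"
proof -
  define S where "S = sphere (0::real^'m) 1"
  have "axis undefined 1 \<in> S" by (simp add: S_def norm_axis_1)
  moreover have "continuous_on S (\<lambda>x. x \<bullet> (C *v x) / (x \<bullet> (A *v x)))"
  proof (intro continuous_intros ballI)
    fix x assume "x \<in> S"
    hence "x \<noteq> 0" by (auto simp: S_def)
    from A(2)[OF this] show "x \<bullet> (A *v x) \<noteq> 0" by simp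
  qed
  ultimately obtain x where x: "x \<in> S"
    and mx: "\<And>v. v \<in> S \<Longrightarrow> v \<bullet> (C *v v) / (v \<bullet> (A *v v)) \<le> x \<bullet> (C *v x) / (x \<bullet> (A *v x))"
    using continuous_attains_sup[of S "\<lambda>x. x \<bullet> (C *v x) / (x \<bullet> (A *v x))"] by (auto simp: S_def)
  define n where "n = x \<bullet> (C *v x) / (x \<bullet> (A *v x))"
  have x0: "x \<noteq> 0" using x by (auto simp: S_def)
  have le: "v \<bullet> (C *v v) \<le> n * (v \<bullet> (A *v v))" for v
  proof (cases "v = 0")
    case False
    define u where "u = (1 / norm v) *\<^sub>R v"
    have v: "v = norm v *\<^sub>R u" and u: "u \<in> S" using False by (auto simp: u_def S_def)
    hence u0: "u \<noteq> 0" by (auto simp: S_def)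
    have "u \<bullet> (C *v u) \<le> n * (u \<bullet> (A *v u))"
      using mx[OF u] A(2)[OF u0] by (simp add: n_def[symmetric] divide_le_eq)
    hence "(norm v)\<^sup>2 * (u \<bullet> (C *v u)) \<le> (norm v)\<^sup>2 * (n * (u \<bullet> (A *v u)))"
      by (rule mult_left_mono) simp
    thus ?thesis
      by (subst (1 2 3 4) v) (simp add: matrix_vector_mult_scaleR power2_eq_square mult_ac)
  qed simp
  define D where "D = n *\<^sub>R A - C"
  have Dv: "D *v v = n *\<^sub>R (A *v v) - C *v v" for v
    unfolding D_def by (simp add: matrix_vector_mult_diff_rdistrib scaleR_matrix_vector_assoc[symmetric])
  have symD: "transpose D = D" using A(1) C by (simp add: D_def transpose_def vec_eq_iff)
  have "x \<bullet> (D *v x) = 0" using A(2)[OF x0] by (simp add: Dv inner_diff_right n_def)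
  moreover have "v \<bullet> (D *v v) \<ge> 0" for v using le[of v] by (simp add: Dv inner_diff_right)
  ultimately have "(D *v x) \<bullet> (D *v x) = 0"
    using psd_kernel[OF subspace_UNIV symD _ UNIV_I _ UNIV_I] by blast
  hence "C *v x = n *\<^sub>R (A *v x)" by (simp add: Dv)
  with x0 le show ?thesis using that by blast
qed

lemma gap_sum_trace:
  fixes Q R :: "real^'m^'m"
  assumes "orthogonal_matrix Q" "orthogonal_matrix R"
  shows "(\<Sum>i\<in>UNIV. \<Sum>k\<in>UNIV. (overlap Q R i k)\<^sup>2 * gap e (\<mu> i) (\<nu> k))
    = trace (spec Q \<mu> ** spec R (\<lambda>k. \<nu> k powr (-e)))
      + e * trace (spec Q (\<lambda>i. \<mu> i powr (-e)) ** spec R \<nu>) - (e + 1) * (\<Sum>i\<in>UNIV. \<mu> i powr (1 - e))"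
proof -
  have "(\<Sum>i\<in>UNIV. \<Sum>k\<in>UNIV. (overlap Q R i k)\<^sup>2 * gap e (\<mu> i) (\<nu> k))
    = (\<Sum>i\<in>UNIV. \<Sum>k\<in>UNIV. (overlap Q R i k)\<^sup>2 * (\<mu> i * \<nu> k powr (-e)))
     + e * (\<Sum>i\<in>UNIV. \<Sum>k\<in>UNIV. (overlap Q R i k)\<^sup>2 * (\<mu> i powr (-e) * \<nu> k))
     - (e + 1) * (\<Sum>i\<in>UNIV. \<Sum>k\<in>UNIV. (overlap Q R i k)\<^sup>2 * (\<mu> i powr (1 - e)))"
    unfolding sum_distrib_left sum.distrib[symmetric] sum_subtractf[symmetric]
    by (intro sum.cong refl) (simp add: gap_def algebra_simps)
  thus ?thesis by (simp only: trace_spec_spec sum_overlap_left[OF assms])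
qed

text \<open>The coordinates of \<open>x\<close> in the two eigenbases feed \<open>gap_bound\<close>:
  the overlaps convert one set into the other, and the eigenvector equation gives the same
  conversion for the images of \<open>x\<close>.\<close>

lemma spec_gap_bound:
  fixes Q R :: "real^'m^'m"
  assumes Q: "orthogonal_matrix Q" and R: "orthogonal_matrix R"
    and e: "0 < e" "e \<le> 1" and a: "0 < a" and \<mu>: "\<And>i. a \<le> \<mu> i" and \<nu>: "\<And>i. 0 < \<nu> i"
    and x: "x \<noteq> 0" and ev: "spec R \<nu> *v x = n *\<^sub>R (spec Q \<mu> *v x)"
  shows "n > 0" and "gap e a (n * a) \<le> trace (spec Q \<mu> ** spec R (\<lambda>k. \<nu> k powr (-e)))
      + e * trace (spec Q (\<lambda>i. \<mu> i powr (-e)) ** spec R \<nu>) - (e + 1) * (\<Sum>i\<in>UNIV. \<mu> i powr (1 - e))"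
proof -
  have \<mu>0: "0 < \<mu> i" for i using \<mu>[of i] a by linarith
  have xx: "x \<bullet> (spec R \<nu> *v x) = n * (x \<bullet> (spec Q \<mu> *v x))" by (simp add: ev)
  show n: "n > 0"
    using xx spec_pos[where l = \<mu>, OF Q \<mu>0 x] spec_pos[where l = \<nu>, OF R \<nu> x] by (simp add: zero_less_mult_iff)
  show "gap e a (n * a) \<le> trace (spec Q \<mu> ** spec R (\<lambda>k. \<nu> k powr (-e)))
      + e * trace (spec Q (\<lambda>i. \<mu> i powr (-e)) ** spec R \<nu>) - (e + 1) * (\<Sum>i\<in>UNIV. \<mu> i powr (1 - e))"
    unfolding gap_sum_trace[OF Q R, symmetric]
  proof (rule gap_bound[OF e, where y = "\<lambda>k. (x v* R) $ k" and x = "\<lambda>i. (x v* Q) $ i"])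
    show "(\<Sum>k\<in>UNIV. overlap Q R i k * (x v* R) $ k) = (x v* Q) $ i" for i
      by (rule overlap_coords[OF R])
    show "(\<Sum>k\<in>UNIV. overlap Q R i k * (\<nu> k * (x v* R) $ k)) = n * (\<mu> i * (x v* Q) $ i)" for i
    proof -
      have "(\<Sum>k\<in>UNIV. overlap Q R i k * ((spec R \<nu> *v x) v* R) $ k) = ((spec R \<nu> *v x) v* Q) $ i"
        by (rule overlap_coords[OF R])
      also have "\<dots> = n * ((spec Q \<mu> *v x) v* Q) $ i"
        by (simp add: ev vector_matrix_mult_def sum_distrib_left mult_ac)
      finally show ?thesis by (simp only: spec_coords[OF R] spec_coords[OF Q])
    qed
    show "(\<Sum>k\<in>UNIV. ((x v* R) $ k)\<^sup>2) = (\<Sum>i\<in>UNIV. ((x v* Q) $ i)\<^sup>2)"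
      using inner_orthogonal_coords[OF Q, of x x] inner_orthogonal_coords[OF R, of x x]
      by (simp add: power2_eq_square)
    show "(\<Sum>k\<in>UNIV. \<nu> k * ((x v* R) $ k)\<^sup>2) = n * (\<Sum>i\<in>UNIV. \<mu> i * ((x v* Q) $ i)\<^sup>2)"
      using xx by (simp add: inner_spec power2_eq_square mult.assoc)
    show "\<exists>i. (x v* Q) $ i \<noteq> 0"
    proof (rule ccontr)
      assume "\<not> (\<exists>i. (x v* Q) $ i \<noteq> 0)"
      hence "x \<bullet> x = 0" by (simp add: inner_orthogonal_coords[OF Q, of x x])
      with x show False by simp
    qed
  qed (use \<mu> \<nu> a n in auto)
qed

text \<open>Inversion reverses the order after every shift \<open>s\<close>: \<open>f s\<close> and
  \<open>g s\<close> are the forms at \<open>x\<close> of the inverses of C + s and n A + s, where A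
  = \<open>spec Q \<mu>\<close> and C = \<open>spec R \<nu>\<close>. Integration against s^(-e)
  passes to powers; e = 1 is the shift s = 0.\<close>

lemma loewner_heinz:
  fixes Q R :: "real^'m^'m"
  assumes Q: "orthogonal_matrix Q" and R: "orthogonal_matrix R"
    and e: "0 < e" "e \<le> 1" and \<mu>: "\<And>i. 0 < \<mu> i" and \<nu>: "\<And>i. 0 < \<nu> i" and n: "n > 0"
    and le: "\<And>x. n * (x \<bullet> (spec Q \<mu> *v x)) \<le> x \<bullet> (spec R \<nu> *v x)"
  shows "x \<bullet> (spec R (\<lambda>i. \<nu> i powr (-e)) *v x) \<le> n powr (-e) * (x \<bullet> (spec Q (\<lambda>i. \<mu> i powr (-e)) *v x))"
proof -
  define f where "f s = (\<Sum>i\<in>UNIV. ((x v* R) $ i)\<^sup>2 * (1 / (\<nu> i + s)))" for s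
  define g where "g s = (\<Sum>i\<in>UNIV. ((x v* Q) $ i)\<^sup>2 * (1 / (n * \<mu> i + s)))" for s
  have fg: "f s \<le> g s" if s: "s \<ge> 0" for s
  proof -
    have \<nu>s: "\<nu> i + s > 0" for i using \<nu>[of i] s by linarith
    have \<mu>s: "n * \<mu> i + s > 0" for i using \<mu>[of i] n s by (simp add: add_pos_nonneg)
    \<comment> \<open>For this \<open>w\<close> both the inner product with \<open>x\<close> and the
      form of C + s at \<open>w\<close> equal \<open>f s\<close>, so Cauchy-Schwarz in the form of n
      A + s becomes f^2 \<le> g f.\<close>
    define w where "w = spec R (\<lambda>i. 1 / (\<nu> i + s)) *v x"
    have wR: "(w v* R) $ i = (x v* R) $ i / (\<nu> i + s)" for i
      unfolding w_def spec_coords[OF R] by simp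
    have xw: "x \<bullet> w = f s"
      unfolding w_def f_def inner_spec by (intro sum.cong refl) (simp add: power2_eq_square)
    have ww: "w \<bullet> (spec R \<nu> *v w) + s * (w \<bullet> w) = f s"
    proof -
      have "w \<bullet> (spec R \<nu> *v w) + s * (w \<bullet> w) = (\<Sum>i\<in>UNIV. (\<nu> i + s) * ((w v* R) $ i)\<^sup>2)"
        unfolding inner_spec inner_orthogonal_coords[OF R, of w w] sum_distrib_left sum.distrib[symmetric]
        by (intro sum.cong refl) (simp add: power2_eq_square algebra_simps)
      also have "\<dots> = f s" unfolding f_def wR
      proof (intro sum.cong refl)
        fix i show "(\<nu> i + s) * ((x v* R) $ i / (\<nu> i + s))\<^sup>2 = ((x v* R) $ i)\<^sup>2 * (1 / (\<nu> i + s))"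
          using \<nu>s[of i] by (simp add: power2_eq_square)
      qed
      finally show ?thesis .
    qed
    have "(x \<bullet> w)\<^sup>2 = (\<Sum>i\<in>UNIV. ((x v* Q) $ i / sqrt (n * \<mu> i + s)) * ((w v* Q) $ i * sqrt (n * \<mu> i + s)))\<^sup>2"
      unfolding inner_orthogonal_coords[OF Q, of x w]
      by (intro arg_cong[of _ _ "\<lambda>x. x\<^sup>2"] sum.cong refl) (use \<mu>s in \<open>simp add: less_imp_neq[OF \<mu>s, symmetric]\<close>)
    also have "\<dots> \<le> (\<Sum>i\<in>UNIV. ((x v* Q) $ i / sqrt (n * \<mu> i + s))\<^sup>2) * (\<Sum>i\<in>UNIV. ((w v* Q) $ i * sqrt (n * \<mu> i + s))\<^sup>2)"
      by (rule Cauchy_Schwarz_ineq_sum)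
    also have "(\<Sum>i\<in>UNIV. ((x v* Q) $ i / sqrt (n * \<mu> i + s))\<^sup>2) = g s"
      unfolding g_def by (intro sum.cong refl) (use \<mu>s in \<open>simp add: power_divide less_imp_le\<close>)
    also have "(\<Sum>i\<in>UNIV. ((w v* Q) $ i * sqrt (n * \<mu> i + s))\<^sup>2) = n * (w \<bullet> (spec Q \<mu> *v w)) + s * (w \<bullet> w)"
      unfolding inner_spec inner_orthogonal_coords[OF Q, of w w] sum_distrib_left sum.distrib[symmetric]
      by (intro sum.cong refl) (use \<mu>s in \<open>simp add: power_mult_distrib less_imp_le power2_eq_square algebra_simps\<close>)
    finally have 1: "(f s)\<^sup>2 \<le> g s * (n * (w \<bullet> (spec Q \<mu> *v w)) + s * (w \<bullet> w))" by (simp add: xw)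
    have g0: "g s \<ge> 0" unfolding g_def by (intro sum_nonneg) (use \<mu>s in \<open>simp add: less_imp_le\<close>)
    have f0: "f s \<ge> 0" unfolding f_def by (intro sum_nonneg) (use \<nu>s in \<open>simp add: less_imp_le\<close>)
    have "g s * (n * (w \<bullet> (spec Q \<mu> *v w)) + s * (w \<bullet> w)) \<le> g s * f s"
      using le[of w] g0 by (intro mult_left_mono) (auto simp: ww[symmetric])
    with 1 have "f s * f s \<le> g s * f s" by (simp add: power2_eq_square)
    thus ?thesis using f0 g0 by (cases "f s = 0") auto
  qed
  show ?thesis
  proof (cases "e = 1")
    case True
    have "x \<bullet> (spec R (\<lambda>i. \<nu> i powr (-e)) *v x) = f 0"
      unfolding inner_spec f_def True using \<nu>
      by (intro sum.cong refl) (simp add: powr_minus power2_eq_square field_simps abs_of_pos less_imp_neq[symmetric])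
    moreover have "n powr (-e) * (x \<bullet> (spec Q (\<lambda>i. \<mu> i powr (-e)) *v x)) = g 0"
      unfolding inner_spec g_def True sum_distrib_left using \<mu> n
      by (intro sum.cong refl) (simp add: powr_minus power2_eq_square field_simps abs_of_pos less_imp_neq[symmetric])
    ultimately show ?thesis using fg[of 0] by simp
  next
    case False
    hence e1: "e < 1" using e by simp
    have F: "has_bochner_integral lborel (\<lambda>s. \<Sum>i\<in>UNIV. ((x v* R) $ i)\<^sup>2 * (indicator {0<..} s * (s powr (-e) / (\<nu> i + s))))
       (\<Sum>i\<in>UNIV. ((x v* R) $ i)\<^sup>2 * (powr_const e * \<nu> i powr (-e)))"
      by (intro has_bochner_integral_sum has_bochner_integral_mult_right powr_resolvent_integral e e1 \<nu>)
    have G: "has_bochner_integral lborel (\<lambda>s. \<Sum>i\<in>UNIV. ((x v* Q) $ i)\<^sup>2 * (indicator {0<..} s * (s powr (-e) / (n * \<mu> i + s))))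
       (\<Sum>i\<in>UNIV. ((x v* Q) $ i)\<^sup>2 * (powr_const e * (n * \<mu> i) powr (-e)))"
      by (intro has_bochner_integral_sum has_bochner_integral_mult_right powr_resolvent_integral e e1) (use \<mu> n in simp)
    have ptw: "(\<Sum>i\<in>UNIV. ((x v* R) $ i)\<^sup>2 * (indicator {0<..} s * (s powr (-e) / (\<nu> i + s))))
       \<le> (\<Sum>i\<in>UNIV. ((x v* Q) $ i)\<^sup>2 * (indicator {0<..} s * (s powr (-e) / (n * \<mu> i + s))))" for s
    proof (cases "s > 0")
      case True
      have "s powr (-e) * f s \<le> s powr (-e) * g s" using fg[of s] True by (intro mult_left_mono) auto
      thus ?thesis using True by (simp add: f_def g_def sum_distrib_left mult_ac)
    qed simp
    have "(\<Sum>i\<in>UNIV. ((x v* R) $ i)\<^sup>2 * (powr_const e * \<nu> i powr (-e)))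
      \<le> (\<Sum>i\<in>UNIV. ((x v* Q) $ i)\<^sup>2 * (powr_const e * (n * \<mu> i) powr (-e)))"
      unfolding has_bochner_integral_integral_eq[OF F, symmetric] has_bochner_integral_integral_eq[OF G, symmetric]
      using F G ptw by (intro integral_mono) (auto simp: has_bochner_integral_iff)
    also have "(\<Sum>i\<in>UNIV. ((x v* R) $ i)\<^sup>2 * (powr_const e * \<nu> i powr (-e)))
        = powr_const e * (x \<bullet> (spec R (\<lambda>i. \<nu> i powr (-e)) *v x))"
      unfolding inner_spec sum_distrib_left by (intro sum.cong refl) (simp add: power2_eq_square)
    also have "(\<Sum>i\<in>UNIV. ((x v* Q) $ i)\<^sup>2 * (powr_const e * (n * \<mu> i) powr (-e)))
        = powr_const e * (n powr (-e) * (x \<bullet> (spec Q (\<lambda>i. \<mu> i powr (-e)) *v x)))"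
      unfolding inner_spec sum_distrib_left
      by (intro sum.cong refl) (use \<mu> n in \<open>simp add: power2_eq_square powr_mult less_imp_le\<close>)
    finally show ?thesis using powr_const_pos[OF e(1) e1] by simp
  qed
qed

section \<open>Comparison of two noncommuting matrices by a single factor\<close>

lemma powr_neg_tangent:
  assumes "z > (0::real)"
  shows "z powr (-q) \<ge> 1 - q * ln z"
  using exp_ge_add_one_self[of "-q * ln z"] assms by (simp add: powr_def)

lemma powr_gap_nonneg:
  assumes "z > (0::real)" "q > 0"
  shows "z powr (-q) + q * z - (q + 1) \<ge> 0"
proof -
  have "q * ln z \<le> q * (z - 1)" using assms ln_le_minus_one[of z] by (intro mult_left_mono) auto
  thus ?thesis using powr_neg_tangent[OF assms(1), of q] by (simp add: algebra_simps)
qed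

text \<open>For \<open>q \<le> 1\<close> the comparison factor is the smallest eigenvalue of \<open>N\<close> relative to \<open>M\<close>
  and passes to \<open>q\<close>-th powers by the Loewner--Heinz inequality; for \<open>q > 1\<close> it comes from
  the largest eigenvalue of \<open>N powr (-q)\<close> relative to \<open>M powr (-q)\<close>, to which the gap
  inequality applies with the exponent \<open>1 / q\<close>.\<close>

lemma spec_comparison:
  fixes Q R :: "real^'m^'m"
  assumes Q: "orthogonal_matrix Q" and R: "orthogonal_matrix R"
    and q: "0 < q" and \<mu>: "\<And>i. 0 < \<mu> i" and \<nu>: "\<And>i. 0 < \<nu> i"
    and a: "0 < a" "\<And>i. a \<le> \<mu> i powr (1 - q)"
  obtains \<tau> where "\<tau> > 0"
    "\<And>x. \<tau> powr q * (x \<bullet> (spec R (\<lambda>i. \<nu> i powr (-q)) *v x)) \<le> x \<bullet> (spec Q (\<lambda>i. \<mu> i powr (-q)) *v x)"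
    "\<And>s. s > 0 \<Longrightarrow> a * ((\<tau> / s) powr (-q) + q * (\<tau> / s) - (q + 1))
      \<le> s powr q * trace (spec Q \<mu> ** spec R (\<lambda>k. \<nu> k powr (-q)))
       + q / s * trace (spec Q (\<lambda>i. \<mu> i powr (-q)) ** spec R \<nu>) - (q + 1) * (\<Sum>i\<in>UNIV. \<mu> i powr (1 - q))"
proof (cases "q \<le> 1")
  case True
  obtain n' x where x: "x \<noteq> 0" "spec Q \<mu> *v x = n' *\<^sub>R (spec R \<nu> *v x)"
     "\<And>v. v \<bullet> (spec Q \<mu> *v v) \<le> n' * (v \<bullet> (spec R \<nu> *v v))"
    by (rule extremal_generalized_eigenvector[where A = "spec R \<nu>" and C = "spec Q \<mu>",
        OF transpose_spec spec_pos[where l = \<nu>, OF R \<nu>] transpose_spec], assumption) (rule that)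
  have "x \<bullet> (spec Q \<mu> *v x) = n' * (x \<bullet> (spec R \<nu> *v x))" by (simp add: x(2))
  hence n': "n' > 0"
    using spec_pos[where l = \<mu>, OF Q \<mu> x(1)] spec_pos[where l = \<nu>, OF R \<nu> x(1)] by (simp add: zero_less_mult_iff)
  \<comment> \<open>The largest eigenvalue of M relative to N is the inverse of the smallest one of
    N relative to M.\<close>
  define \<tau> where "\<tau> = 1 / n'"
  have \<tau>: "\<tau> > 0" using n' by (simp add: \<tau>_def)
  have ev: "spec R \<nu> *v x = \<tau> *\<^sub>R (spec Q \<mu> *v x)" using n' by (simp add: \<tau>_def x(2))
  have le: "\<tau> * (v \<bullet> (spec Q \<mu> *v v)) \<le> v \<bullet> (spec R \<nu> *v v)" for v
    using x(3)[of v] n' by (simp add: \<tau>_def field_simps)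
  show ?thesis
  proof (rule that[OF \<tau>])
    fix y
    have "\<tau> powr q * (y \<bullet> (spec R (\<lambda>i. \<nu> i powr (-q)) *v y))
       \<le> \<tau> powr q * (\<tau> powr (-q) * (y \<bullet> (spec Q (\<lambda>i. \<mu> i powr (-q)) *v y)))"
      by (intro mult_left_mono loewner_heinz[OF Q R q True \<mu> \<nu> \<tau> le]) simp
    also have "\<dots> = (\<tau> powr q * \<tau> powr (-q)) * (y \<bullet> (spec Q (\<lambda>i. \<mu> i powr (-q)) *v y))"
      by (simp only: mult.assoc)
    also have "\<tau> powr q * \<tau> powr (-q) = 1" using \<tau> by (simp add: powr_add[symmetric])
    finally show "\<tau> powr q * (y \<bullet> (spec R (\<lambda>i. \<nu> i powr (-q)) *v y)) \<le> y \<bullet> (spec Q (\<lambda>i. \<mu> i powr (-q)) *v y)"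
      by simp
  next
    fix s :: real assume s: "s > 0"
    define b where "b = Min (range \<mu>)"
    have "b \<in> range \<mu>" unfolding b_def by (intro Min_in) auto
    then obtain j where j: "b = \<mu> j" by auto
    have b: "0 < b" by (simp add: j \<mu>)
    have bmin: "b \<le> \<mu> i" for i by (simp add: b_def)
    \<comment> \<open>Dividing N by \<open>s\<close> turns its relative eigenvalue \<tau> into
      \<tau> / s; this is the freedom in \<open>s\<close> that is later used to place the
      tangent.\<close>
    have ev': "spec R (\<lambda>k. 1 / s * \<nu> k) *v x = (\<tau> / s) *\<^sub>R (spec Q \<mu> *v x)"
      by (simp only: spec_scaleR scaleR_matrix_vector_assoc[symmetric] ev) simp
    have gap: "gap q b (\<tau> / s * b) \<le> trace (spec Q \<mu> ** spec R (\<lambda>k. (1 / s * \<nu> k) powr (-q)))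
      + q * trace (spec Q (\<lambda>i. \<mu> i powr (-q)) ** spec R (\<lambda>k. 1 / s * \<nu> k)) - (q + 1) * (\<Sum>i\<in>UNIV. \<mu> i powr (1 - q))"
      by (rule spec_gap_bound(2)[OF Q R q True b bmin _ x(1) ev']) (use \<nu> s in auto)
    have e1: "trace (spec Q \<mu> ** spec R (\<lambda>k. (1 / s * \<nu> k) powr (-q))) = s powr q * trace (spec Q \<mu> ** spec R (\<lambda>k. \<nu> k powr (-q)))"
      unfolding trace_spec_spec sum_distrib_left
    proof (intro sum.cong refl)
      fix i j
      have "(1 / s * \<nu> j) powr (-q) = s powr q * \<nu> j powr (-q)"
        using s \<nu>[of j] by (simp add: powr_divide powr_minus_divide)
      thus "(overlap Q R i j)\<^sup>2 * (\<mu> i * (1 / s * \<nu> j) powr - q) = s powr q * ((overlap Q R i j)\<^sup>2 * (\<mu> i * \<nu> j powr - q))"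
        by simp
    qed
    have e2: "q * trace (spec Q (\<lambda>i. \<mu> i powr (-q)) ** spec R (\<lambda>k. 1 / s * \<nu> k)) = q / s * trace (spec Q (\<lambda>i. \<mu> i powr (-q)) ** spec R \<nu>)"
      unfolding trace_spec_spec sum_distrib_left by (intro sum.cong refl) simp
    have "gap q b (\<tau> / s * b) = b powr (1 - q) * ((\<tau> / s) powr (-q) + q * (\<tau> / s) - (q + 1))"
    proof -
      have "b * (\<tau> / s * b) powr (-q) = b powr (1 - q) * (\<tau> / s) powr (-q)"
        using powr_mult[of "\<tau> / s" b "-q"] powr_mult_base[of b "-q"] b \<tau> s by (simp add: mult_ac)
      moreover have "b powr (-q) * (\<tau> / s * b) = b powr (1 - q) * (\<tau> / s)"
        using powr_mult_base[of b "-q"] b by (simp add: mult_ac)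
      ultimately show ?thesis unfolding gap_def by algebra
    qed
    moreover have "a * ((\<tau> / s) powr (-q) + q * (\<tau> / s) - (q + 1)) \<le> b powr (1 - q) * ((\<tau> / s) powr (-q) + q * (\<tau> / s) - (q + 1))"
      using a(2)[of j] \<tau> s q by (intro mult_right_mono powr_gap_nonneg) (auto simp: j)
    ultimately show "a * ((\<tau> / s) powr (-q) + q * (\<tau> / s) - (q + 1))
      \<le> s powr q * trace (spec Q \<mu> ** spec R (\<lambda>k. \<nu> k powr (-q)))
       + q / s * trace (spec Q (\<lambda>i. \<mu> i powr (-q)) ** spec R \<nu>) - (q + 1) * (\<Sum>i\<in>UNIV. \<mu> i powr (1 - q))"
      using gap unfolding e1 e2 by linarith
  qed
next
  case False
  define e where "e = 1 / q"
  have e: "0 < e" "e \<le> 1" and qe: "q * e = 1" using False by (auto simp: e_def)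
  \<comment> \<open>The exponent -e sends M^(-q) and N^(-q) back to M and N, so the two traces of
    the gap inequality change places; the factor \<open>q\<close> then restores their coefficients,
    as q e = 1.\<close>
  define \<mu>' where "\<mu>' i = \<mu> i powr (-q)" for i
  define \<nu>' where "\<nu>' i = \<nu> i powr (-q)" for i
  have \<mu>': "0 < \<mu>' i" and \<nu>': "0 < \<nu>' i" for i using \<mu>[of i] \<nu>[of i] by (auto simp: \<mu>'_def \<nu>'_def)
  have \<mu>e: "\<mu>' i powr (-e) = \<mu> i" and \<nu>e: "\<nu>' i powr (-e) = \<nu> i" for i
    using \<mu>[of i] \<nu>[of i] qe by (simp_all add: \<mu>'_def \<nu>'_def powr_powr)
  have \<mu>1e: "\<mu>' i powr (1 - e) = \<mu> i powr (1 - q)" for i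
    using qe by (simp add: \<mu>'_def powr_powr algebra_simps)
  obtain n x where x: "x \<noteq> 0" "spec R \<nu>' *v x = n *\<^sub>R (spec Q \<mu>' *v x)"
     "\<And>v. v \<bullet> (spec R \<nu>' *v v) \<le> n * (v \<bullet> (spec Q \<mu>' *v v))"
    by (rule extremal_generalized_eigenvector[where A = "spec Q \<mu>'" and C = "spec R \<nu>'",
        OF transpose_spec spec_pos[where l = \<mu>', OF Q \<mu>'] transpose_spec], assumption) (rule that)
  have "x \<bullet> (spec R \<nu>' *v x) = n * (x \<bullet> (spec Q \<mu>' *v x))" by (simp add: x(2))
  hence n: "n > 0"
    using spec_pos[where l = \<mu>', OF Q \<mu>' x(1)] spec_pos[where l = \<nu>', OF R \<nu>' x(1)] by (simp add: zero_less_mult_iff)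
  \<comment> \<open>Chosen so that \<tau>^q = 1 / n, which makes the extremal property of
    \<open>n\<close> the required comparison.\<close>
  define \<tau> where "\<tau> = n powr (-e)"
  have \<tau>: "\<tau> > 0" using n by (simp add: \<tau>_def)
  have \<tau>q: "\<tau> powr q = 1 / n" "\<tau> powr (-q) = n" using n
    by (simp_all add: \<tau>_def powr_powr mult.commute[of e] qe powr_minus_divide[of n 1])
  show ?thesis
  proof (rule that[OF \<tau>])
    fix y
    show "\<tau> powr q * (y \<bullet> (spec R (\<lambda>i. \<nu> i powr (-q)) *v y)) \<le> y \<bullet> (spec Q (\<lambda>i. \<mu> i powr (-q)) *v y)"
      using x(3)[of y] n unfolding \<tau>q \<mu>'_def \<nu>'_def by (simp add: field_simps)
  next
    fix s :: real assume s: "s > 0"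
    \<comment> \<open>Dividing N by \<open>s\<close> multiplies N^(-q) by s^q.\<close>
    define c where "c = s powr q"
    have c: "c > 0" using s by (simp add: c_def)
    have ce: "c powr (-e) = 1 / s" using s by (simp add: c_def powr_powr qe powr_minus_divide[of s 1])
    define b where "b = Min (range \<mu>')"
    have "b \<in> range \<mu>'" unfolding b_def by (intro Min_in) auto
    then obtain j where j: "b = \<mu>' j" by auto
    have b: "0 < b" by (simp add: j \<mu>')
    have bmin: "b \<le> \<mu>' i" for i by (simp add: b_def)
    have ev': "spec R (\<lambda>k. c * \<nu>' k) *v x = (c * n) *\<^sub>R (spec Q \<mu>' *v x)"
      by (simp only: spec_scaleR scaleR_matrix_vector_assoc[symmetric] x(2)) simp
    have gap: "gap e b (c * n * b) \<le> trace (spec Q \<mu>' ** spec R (\<lambda>k. (c * \<nu>' k) powr (-e)))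
      + e * trace (spec Q (\<lambda>i. \<mu>' i powr (-e)) ** spec R (\<lambda>k. c * \<nu>' k)) - (e + 1) * (\<Sum>i\<in>UNIV. \<mu>' i powr (1 - e))"
      by (rule spec_gap_bound(2)[OF Q R e b bmin _ x(1) ev']) (use \<nu>' c in auto)
    have e1: "trace (spec Q \<mu>' ** spec R (\<lambda>k. (c * \<nu>' k) powr (-e))) = 1 / s * trace (spec Q (\<lambda>i. \<mu> i powr (-q)) ** spec R \<nu>)"
      unfolding trace_spec_spec sum_distrib_left
    proof (intro sum.cong refl)
      fix i j
      have "(c * \<nu>' j) powr (-e) = 1 / s * \<nu> j"
        using c \<nu>'[of j] by (simp add: powr_mult ce \<nu>e)
      thus "(overlap Q R i j)\<^sup>2 * (\<mu>' i * (c * \<nu>' j) powr - e) = 1 / s * ((overlap Q R i j)\<^sup>2 * (\<mu> i powr (-q) * \<nu> j))"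
        by (simp add: \<mu>'_def)
    qed
    have e2: "trace (spec Q (\<lambda>i. \<mu>' i powr (-e)) ** spec R (\<lambda>k. c * \<nu>' k)) = s powr q * trace (spec Q \<mu> ** spec R (\<lambda>k. \<nu> k powr (-q)))"
      unfolding trace_spec_spec sum_distrib_left \<mu>e by (intro sum.cong refl) (simp add: c_def \<nu>'_def)
    have gap_eq: "q * gap e b (c * n * b) = b powr (1 - e) * ((\<tau> / s) powr (-q) + q * (\<tau> / s) - (q + 1))"
    proof -
      have "b * (c * n * b) powr (-e) = b powr (1 - e) * (\<tau> / s)"
        using powr_mult[of "c * n" b "-e"] powr_mult[of c n "-e"] powr_mult_base[of b "-e"] b c n
        by (simp add: mult_ac ce \<tau>_def)
      moreover have "b powr (-e) * (c * n * b) = b powr (1 - e) * (c * n)"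
        using powr_mult_base[of b "-e"] b by (simp add: mult_ac)
      moreover have "(\<tau> / s) powr (-q) = c * n"
        using \<tau> s by (simp add: powr_divide \<tau>q c_def powr_minus_divide)
      ultimately have "q * gap e b (c * n * b)
          = q * (b powr (1 - e) * (\<tau> / s)) + (q * e) * (b powr (1 - e) * (\<tau> / s) powr (-q)) - (q * e + q) * b powr (1 - e)"
        unfolding gap_def by algebra
      thus ?thesis unfolding qe by algebra
    qed
    have "q * gap e b (c * n * b) \<le> q * (1 / s * trace (spec Q (\<lambda>i. \<mu> i powr (-q)) ** spec R \<nu>)
       + e * (s powr q * trace (spec Q \<mu> ** spec R (\<lambda>k. \<nu> k powr (-q)))) - (e + 1) * (\<Sum>i\<in>UNIV. \<mu> i powr (1 - q)))"
      using gap q unfolding e1 e2 \<mu>1e by (intro mult_left_mono) auto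
    also have "\<dots> = q / s * trace (spec Q (\<lambda>i. \<mu> i powr (-q)) ** spec R \<nu>)
       + (q * e) * (s powr q * trace (spec Q \<mu> ** spec R (\<lambda>k. \<nu> k powr (-q)))) - (q * e + q) * (\<Sum>i\<in>UNIV. \<mu> i powr (1 - q))"
      by (simp add: algebra_simps)
    finally have main: "q * gap e b (c * n * b) \<le> q / s * trace (spec Q (\<lambda>i. \<mu> i powr (-q)) ** spec R \<nu>)
       + s powr q * trace (spec Q \<mu> ** spec R (\<lambda>k. \<nu> k powr (-q))) - (1 + q) * (\<Sum>i\<in>UNIV. \<mu> i powr (1 - q))"
      by (simp add: qe)
    have "a * ((\<tau> / s) powr (-q) + q * (\<tau> / s) - (q + 1)) \<le> b powr (1 - e) * ((\<tau> / s) powr (-q) + q * (\<tau> / s) - (q + 1))"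
      using a(2)[of j] \<tau> s q by (intro mult_right_mono powr_gap_nonneg) (auto simp: j \<mu>1e)
    thus "a * ((\<tau> / s) powr (-q) + q * (\<tau> / s) - (q + 1))
      \<le> s powr q * trace (spec Q \<mu> ** spec R (\<lambda>k. \<nu> k powr (-q)))
       + q / s * trace (spec Q (\<lambda>i. \<mu> i powr (-q)) ** spec R \<nu>) - (q + 1) * (\<Sum>i\<in>UNIV. \<mu> i powr (1 - q))"
      using main unfolding gap_eq by (simp add: add.commute)
  qed
qed

subsection \<open>Designs and information matrices\<close>

lemma design_prob_space: "design X \<xi> \<Longrightarrow> prob_space \<xi>"
  and design_sets: "design X \<xi> \<Longrightarrow> sets \<xi> = sets borel"
  by (auto simp: design_def)

lemma design_AE:
  assumes "design X \<xi>" "compact X"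
  shows "AE x in \<xi>. x \<in> X"
proof -
  interpret prob_space \<xi> using assms(1) by (rule design_prob_space)
  have "X \<in> sets \<xi>" using assms by (simp add: design_sets borel_compact)
  moreover have "prob X = 1" using assms(1) by (simp add: design_def measure_def)
  ultimately show ?thesis by (simp add: prob_eq_1)
qed

lemma design_integrable:
  fixes f :: "real^'m \<Rightarrow> real"
  assumes \<xi>: "design X \<xi>" and X: "compact X" and f: "continuous_on UNIV f"
  shows "integrable \<xi> f"
proof -
  interpret prob_space \<xi> using \<xi> by (rule design_prob_space)
  have "compact (f ` X)" using f X by (meson compact_continuous_image continuous_on_subset subset_UNIV)
  then obtain B where B: "\<And>x. x \<in> X \<Longrightarrow> norm (f x) \<le> B"
    by (metis bounded_iff compact_imp_bounded imageI)
  show ?thesis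
  proof (rule integrable_const_bound)
    show "AE x in \<xi>. norm (f x) \<le> B" using design_AE[OF \<xi> X] B by auto
    have "f \<in> borel_measurable borel" using f by (rule borel_measurable_continuous_onI)
    thus "f \<in> borel_measurable \<xi>" by (simp add: measurable_def design_sets[OF \<xi>] sets_eq_imp_space_eq[OF design_sets[OF \<xi>]])
  qed
qed

lemma trace_info_matrix:
  fixes A :: "real^'m^'m"
  assumes \<xi>: "design X \<xi>" and X: "compact X"
  shows "trace (A ** info_matrix \<xi>) = (LINT x|\<xi>. x \<bullet> (A *v x))"
proof -
  have int: "integrable \<xi> (\<lambda>x. x $ j * x $ i)" for i j
    by (rule design_integrable[OF \<xi> X]) (intro continuous_intros)
  have "(LINT x|\<xi>. x \<bullet> (A *v x)) = (LINT x|\<xi>. (\<Sum>i\<in>UNIV. \<Sum>j\<in>UNIV. A $ i $ j * (x $ j * x $ i)))"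
    by (simp add: inner_vec_def matrix_vector_mult_def sum_distrib_left mult_ac)
  also have "\<dots> = (\<Sum>i\<in>UNIV. \<Sum>j\<in>UNIV. A $ i $ j * (LINT x|\<xi>. x $ j * x $ i))"
    using int by simp
  also have "\<dots> = trace (A ** info_matrix \<xi>)"
    by (simp add: trace_def matrix_matrix_mult_def info_matrix_def)
  finally show ?thesis by simp
qed

lemma info_matrix_quadratic:
  assumes \<xi>: "design X \<xi>" and X: "compact X"
  shows "v \<bullet> (info_matrix \<xi> *v v) = (LINT x|\<xi>. (v \<bullet> x)\<^sup>2)"
proof -
  have int: "integrable \<xi> (\<lambda>x. x $ i * x $ j)" for i j
    by (rule design_integrable[OF \<xi> X]) (intro continuous_intros)
  have "(LINT x|\<xi>. (v \<bullet> x)\<^sup>2) = (LINT x|\<xi>. (\<Sum>i\<in>UNIV. \<Sum>j\<in>UNIV. (v $ i * v $ j) * (x $ i * x $ j)))"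
    by (simp add: inner_vec_def power2_eq_square sum_product mult_ac)
  also have "\<dots> = (\<Sum>i\<in>UNIV. \<Sum>j\<in>UNIV. (v $ i * v $ j) * (LINT x|\<xi>. x $ i * x $ j))"
    using int by simp
  also have "\<dots> = v \<bullet> (info_matrix \<xi> *v v)"
    by (simp add: inner_vec_def matrix_vector_mult_def info_matrix_def sum_distrib_left mult_ac)
  finally show ?thesis by simp
qed

lemma info_matrix_nonneg:
  assumes "design X \<xi>" "compact X"
  shows "v \<bullet> (info_matrix \<xi> *v v) \<ge> 0"
  by (simp add: info_matrix_quadratic[OF assms])

lemma spec_eigenvector:
  fixes Q :: "real^'m^'m"
  assumes Q: "orthogonal_matrix Q"
  defines "u \<equiv> \<lambda>i. Q *v axis i 1"
  shows "norm (u i) = 1" "spec Q l *v u i = l i *\<^sub>R u i" "u i \<bullet> (spec Q l *v u i) = l i"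
proof -
  have uQ: "u i v* Q = axis i 1"
  proof -
    have "transpose Q *v (Q *v axis i 1) = axis i 1"
      by (metis Q matrix_vector_mul_assoc matrix_vector_mul_lid orthogonal_matrix_def)
    thus ?thesis by (simp add: u_def)
  qed
  have "u i \<bullet> u i = (\<Sum>j\<in>UNIV. (axis i 1 :: real^'m) $ j * (axis i 1 :: real^'m) $ j)"
    using inner_orthogonal_coords[OF Q, of "u i" "u i"] by (simp add: uQ)
  also have "\<dots> = 1" by (simp add: axis_def mult_delta_left)
  finally show n: "norm (u i) = 1" by (simp add: norm_eq_1)
  have "spec Q l *v u i = Q *v (diag_mat l *v (transpose Q *v u i))"
    by (simp add: spec_def matrix_vector_mul_assoc[symmetric] del: transpose_matrix_vector)
  also have "\<dots> = Q *v (l i *\<^sub>R axis i 1)"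
  proof -
    have "diag_mat l *v (axis i 1 :: real^'m) = l i *\<^sub>R axis i 1"
      by (simp add: diag_mat_mult_vec axis_def vec_eq_iff)
    thus ?thesis by (simp add: uQ)
  qed
  finally show e: "spec Q l *v u i = l i *\<^sub>R u i" by (simp add: u_def matrix_vector_mult_scaleR)
  show "u i \<bullet> (spec Q l *v u i) = l i" using n by (simp add: e norm_eq_1)
qed

lemma info_matrix_spec:
  fixes \<xi> :: "(real^'m) measure"
  assumes \<xi>: "design X \<xi>" and X: "compact X"
  obtains Q l where "orthogonal_matrix Q" "\<And>i. l i \<ge> 0" "info_matrix \<xi> = spec Q l"
proof -
  have "transpose (info_matrix \<xi>) = info_matrix \<xi>"
    by (simp add: info_matrix_def transpose_def vec_eq_iff mult.commute)
  then obtain Q l where Q: "orthogonal_matrix Q" "info_matrix \<xi> = spec Q l"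
    by (rule spectral_decomposition)
  have "l i \<ge> 0" for i
    using info_matrix_nonneg[OF assms] spec_eigenvector(3)[OF Q(1), of i l] by (metis Q(2))
  with Q show ?thesis using that by blast
qed

lemma invertible_spec:
  fixes Q :: "real^'m^'m"
  assumes Q: "orthogonal_matrix Q" and l: "\<And>i. l i \<ge> 0"
  shows "invertible (spec Q l) \<longleftrightarrow> (\<forall>i. l i > 0)"
proof
  assume inv: "invertible (spec Q l)"
  show "\<forall>i. l i > 0"
  proof (rule allI, rule ccontr)
    fix i assume "\<not> l i > 0"
    hence "l i = 0" using l[of i] by simp
    hence "spec Q l *v (Q *v axis i 1) = 0" using spec_eigenvector(2)[OF Q, of l i] by simp
    moreover obtain B where "B ** spec Q l = mat 1" using inv by (auto simp: invertible_def)
    ultimately have "Q *v axis i 1 = 0"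
      by (metis matrix_vector_mul_assoc matrix_vector_mul_lid matrix_vector_mult_0_right)
    thus False using spec_eigenvector(1)[OF Q, of i] by simp
  qed
next
  assume pos: "\<forall>i. l i > 0"
  have inv: "(\<lambda>i. l i * inverse (l i)) = (\<lambda>i. 1)" "(\<lambda>i. inverse (l i) * l i) = (\<lambda>i. 1)"
    using pos by (auto simp: less_imp_neq[symmetric])
  have "spec Q l ** spec Q (\<lambda>i. inverse (l i)) = mat 1" "spec Q (\<lambda>i. inverse (l i)) ** spec Q l = mat 1"
    unfolding spec_mult[OF Q] inv spec_one[OF Q] by simp_all
  thus "invertible (spec Q l)" unfolding invertible_def by blast
qed

lemma det_spec:
  fixes Q :: "real^'m^'m"
  assumes Q: "orthogonal_matrix Q"
  shows "det (spec Q l) = (\<Prod>i\<in>UNIV. l i)"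
proof -
  have "det Q * det Q = 1" using det_orthogonal_matrix[OF Q] by auto
  moreover have "det (diag_mat l) = (\<Prod>i\<in>UNIV. l i)"
    by (subst det_diagonal) (simp_all add: diag_mat_def)
  ultimately show ?thesis by (simp add: spec_def det_mul mult_ac)
qed

lemma trace_scaleR: "trace (c *\<^sub>R A) = c * trace (A :: real^'m^'m)"
  by (simp add: trace_def sum_distrib_left)

lemma trace_mult_combination:
  fixes A :: "real^'m^'m"
  shows "trace (A ** (a *\<^sub>R B + b *\<^sub>R C)) = a * trace (A ** B) + b * trace (A ** C)"
  by (simp add: matrix_add_ldistrib matrix_scalar_ac trace_add scalar_matrix_assoc[symmetric] trace_scaleR)

text \<open>The mixture is a two-stage experiment: a Bernoulli variable with parameter
  \<open>d\<close> selects the design from which the point is drawn.\<close>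

lemma design_mixture:
  fixes \<xi>1 \<xi>2 :: "(real^'m) measure"
  assumes 1: "design X \<xi>1" and 2: "design X \<xi>2" and X: "compact X" and d: "0 \<le> d" "d \<le> 1"
  obtains \<eta> where "design X \<eta>" "info_matrix \<eta> = (1 - d) *\<^sub>R info_matrix \<xi>1 + d *\<^sub>R info_matrix \<xi>2"
proof -
  define N where "N = (\<lambda>b. if b then \<xi>2 else \<xi>1)"
  define \<eta> where "\<eta> = measure_pmf (bernoulli_pmf d) \<bind> N"
  have N: "design X (N b)" for b using 1 2 by (simp add: N_def)
  have sub: "N b \<in> space (subprob_algebra borel)" for b
    using N[of b] by (auto simp: space_subprob_algebra design_def intro: prob_space_imp_subprob_space)
  have Nm: "N \<in> measurable (measure_pmf (bernoulli_pmf d)) (subprob_algebra borel)"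
    using sub by (auto simp: measurable_def)
  have sets\<eta>: "sets \<eta> = sets borel" unfolding \<eta>_def
    by (rule sets_bind) (use N design_sets in auto)
  have XB: "X \<in> sets borel" using X by (rule borel_compact)
  have "prob_space \<eta>" unfolding \<eta>_def
    by (rule measure_pmf.prob_space_bind[OF _ Nm]) (use N design_prob_space in auto)
  moreover have "emeasure \<eta> X = 1"
  proof -
    have "emeasure \<eta> X = (\<integral>\<^sup>+b. emeasure (N b) X \<partial>measure_pmf (bernoulli_pmf d))"
      unfolding \<eta>_def by (rule emeasure_bind[OF _ Nm XB]) simp
    also have "\<dots> = (\<integral>\<^sup>+b. 1 \<partial>measure_pmf (bernoulli_pmf d))"
      using N by (simp add: design_def)
    finally show ?thesis by (simp add: measure_pmf.emeasure_space_1)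
  qed
  ultimately have \<eta>: "design X \<eta>" using sets\<eta> by (simp add: design_def)
  have "(LINT x|\<eta>. x $ i * x $ j) = (1 - d) * (LINT x|\<xi>1. x $ i * x $ j) + d * (LINT x|\<xi>2. x $ i * x $ j)" for i j
  proof -
    \<comment> \<open>The integral over a bind is taken for a globally bounded integrand; truncation
      to \<open>X\<close> provides the bound and changes nothing almost everywhere.\<close>
    define f where "f x = indicator X x * (x $ i * x $ j)" for x :: "real^'m"
    have meas: "(\<lambda>x :: real^'m. x $ i * x $ j) \<in> borel_measurable borel"
      by (intro borel_measurable_continuous_onI continuous_intros)
    have fm: "f \<in> borel_measurable borel"
      unfolding f_def using meas XB by (intro borel_measurable_times borel_measurable_indicator) auto
    have "compact ((\<lambda>x. x $ i * x $ j) ` X)" using X by (intro compact_continuous_image continuous_intros)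
    then obtain B0 where B0: "\<And>x. x \<in> X \<Longrightarrow> \<bar>x $ i * x $ j\<bar> \<le> B0"
      by (metis (no_types, lifting) bounded_iff compact_imp_bounded imageI real_norm_def)
    have fb: "\<bar>f x\<bar> \<le> max B0 0" for x using B0[of x] by (cases "x \<in> X") (simp_all add: f_def le_max_iff_disj)
    have AEf: "(LINT x|\<zeta>. x $ i * x $ j) = (LINT x|\<zeta>. f x)" if \<zeta>: "design X \<zeta>" for \<zeta>
    proof (rule integral_cong_AE)
      show "AE x in \<zeta>. x $ i * x $ j = f x"
        using design_AE[OF \<zeta> X] by eventually_elim (simp add: f_def)
    qed (use meas fm design_sets[OF \<zeta>] in \<open>auto cong: measurable_cong_sets\<close>)
    have "(LINT x|\<eta>. f x) = (LINT b|measure_pmf (bernoulli_pmf d). LINT x|N b. f x)"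
      unfolding \<eta>_def
    proof (rule integral_bind[OF fm fb Nm])
      show "finite_measure (measure_pmf (bernoulli_pmf d))" by unfold_locales
      show "AE b in measure_pmf (bernoulli_pmf d). emeasure (N b) (space (N b)) \<le> ennreal 1"
        by (rule AE_I2) (simp add: prob_space.emeasure_space_1[OF design_prob_space[OF N]])
    qed
    also have "\<dots> = (1 - d) * (LINT x|\<xi>1. f x) + d * (LINT x|\<xi>2. f x)"
      using d by (simp add: N_def mult.commute)
    finally show ?thesis using AEf 1 2 \<eta> by simp
  qed
  hence "info_matrix \<eta> = (1 - d) *\<^sub>R info_matrix \<xi>1 + d *\<^sub>R info_matrix \<xi>2"
    by (simp add: info_matrix_def vec_eq_iff)
  with \<eta> show ?thesis by (rule that)
qed

lemma design_return:
  assumes "x \<in> X" "compact X"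
  shows "design X (return borel x)"
  using assms by (auto simp: design_def prob_space_return borel_compact emeasure_return)

lemma trace_info_matrix_return:
  fixes A :: "real^'m^'m"
  assumes "x \<in> X" "compact X"
  shows "trace (A ** info_matrix (return borel x)) = x \<bullet> (A *v x)"
proof -
  have "(\<lambda>x. x \<bullet> (A *v x)) \<in> borel_measurable borel"
    by (intro borel_measurable_continuous_onI continuous_intros)
  thus ?thesis
    using trace_info_matrix[OF design_return[OF assms] assms(2), of A] by (simp add: integral_return)
qed

subsection \<open>Optimality\<close>

text \<open>An antiderivative of \<open>x powr (-(p+1))\<close>: maximizing \<open>\<Phi>\<^sub>p\<^sup>+\<close> amounts to maximizing the sum of this
  concave function over the eigenvalues.\<close>

definition pot :: "real \<Rightarrow> real \<Rightarrow> real" where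
  "pot p x = (if p = 0 then ln x else - (x powr (-p)) / p)"

text \<open>Concavity, reduced by z = x / y to the base point 1; there it is ln z \<le> z - 1, the
  exponential inequality, or Young's inequality for p < 0. For p \<ge> 0 the point \<open>x\<close>
  must be positive, since \<open>ln 0 = 0\<close> and \<open>0 powr (-p) = 0\<close> are not the
  limits at 0.\<close>

lemma pot_tangent:
  assumes p: "p > -1" and x: "x \<ge> 0" "p \<ge> 0 \<Longrightarrow> x > 0" and y: "y > 0"
  shows "pot p x - pot p y \<le> y powr (-(p+1)) * (x - y)"
proof -
  define z where "z = x / y"
  have z: "z \<ge> 0" "p \<ge> 0 \<Longrightarrow> z > 0" using x y by (auto simp: z_def)
  have x_eq: "x = z * y" using y by (simp add: z_def)
  have yp: "y powr (-(p+1)) * y = y powr (-p)"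
    using powr_mult_base[of y "-(p+1)"] y by (simp add: mult.commute)
  have rhs: "y powr (-(p+1)) * (x - y) = y powr (-p) * (z - 1)"
    using yp by (simp add: x_eq algebra_simps)
  consider "p = 0" | "p > 0" | "p < 0" by linarith
  thus ?thesis
  proof cases
    case 1
    have "ln x - ln y = ln z" using x y 1 by (simp add: z_def ln_div)
    also have "\<dots> \<le> z - 1" using z 1 by (intro ln_le_minus_one) auto
    finally show ?thesis unfolding rhs using y 1 by (simp add: pot_def)
  next
    case 2
    have z0: "z > 0" using z 2 by simp
    have "p * ln z \<le> p * (z - 1)" using z0 2 ln_le_minus_one[of z] by (intro mult_left_mono) auto
    hence "1 - z powr (-p) \<le> p * (z - 1)" using powr_neg_tangent[OF z0, of p] by simp
    hence "y powr (-p) * (1 - z powr (-p)) \<le> y powr (-p) * (p * (z - 1))" by (intro mult_left_mono) auto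
    hence "(y powr (-p) * (1 - z powr (-p))) / p \<le> y powr (-p) * (z - 1)"
      using 2 by (simp add: pos_divide_le_eq mult_ac)
    moreover have "pot p x - pot p y = (y powr (-p) * (1 - z powr (-p))) / p"
      using 2 y z0 by (simp add: pot_def x_eq powr_mult field_simps)
    ultimately show ?thesis unfolding rhs by simp
  next
    case 3
    define r where "r = - p"
    have r: "0 < r" "r < 1" using 3 p by (auto simp: r_def)
    have "z powr r \<le> 1 + r * (z - 1)"
    proof (cases "z = 0")
      case False
      hence "z > 0" using z by simp
      thus ?thesis using Youngs_inequality_0[of r "1 - r" z 1] r by (simp add: algebra_simps)
    qed (use r in simp)
    hence "y powr r * (z powr r - 1) \<le> y powr r * (r * (z - 1))" by (intro mult_left_mono) auto
    hence "(y powr r * (z powr r - 1)) / r \<le> y powr r * (z - 1)"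
      using r by (simp add: pos_divide_le_eq mult_ac)
    moreover have "pot p x - pot p y = (y powr r * (z powr r - 1)) / r"
      using 3 y z by (simp add: pot_def x_eq powr_mult field_simps r_def)
    ultimately show ?thesis unfolding rhs by (simp add: r_def)
  qed
qed

lemma Phi_plus_spec:
  fixes Q :: "real^'m^'m"
  assumes Q: "orthogonal_matrix Q" and l: "\<And>i. l i \<ge> 0"
  shows "Phi_plus p (spec Q l) = (if p = 0 then (\<Prod>i\<in>UNIV. l i) powr (1 / real CARD('m))
      else if p > 0 \<and> \<not> (\<forall>i. l i > 0) then 0
      else ((\<Sum>i\<in>UNIV. l i powr (-p)) / real CARD('m)) powr (-1/p))"
  unfolding Phi_plus_def mpow_spec[OF Q l] trace_spec[OF Q] det_spec[OF Q] invertible_spec[OF Q l]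
  by auto

text \<open>For each sign of \<open>p\<close> the criterion is a strictly increasing function of the
  sum of \<open>pot p\<close> over positive eigenvalues. For p \<ge> 0 a singular matrix has
  criterion value 0, below the positive value at \<open>spec Q \<mu>\<close>.\<close>

lemma Phi_plus_le_pot:
  fixes Q R :: "real^'m^'m"
  assumes Q: "orthogonal_matrix Q" and R: "orthogonal_matrix R"
    and \<mu>: "\<And>i. \<mu> i > 0" and \<nu>: "\<And>i. \<nu> i \<ge> 0"
    and le: "Phi_plus p (spec Q \<mu>) \<le> Phi_plus p (spec R \<nu>)"
  shows "p \<ge> 0 \<Longrightarrow> \<nu> i > 0" and "(\<Sum>i\<in>UNIV. pot p (\<mu> i)) \<le> (\<Sum>k\<in>UNIV. pot p (\<nu> k))"
proof -
  let ?m = "real CARD('m)"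
  have m: "?m > 0" by simp
  have \<mu>': "\<mu> i \<ge> 0" for i using \<mu>[of i] by simp
  note le = le[unfolded Phi_plus_spec[OF Q \<mu>'] Phi_plus_spec[OF R \<nu>]]
  have S: "(\<Sum>i\<in>UNIV. l i powr (-p)) > 0" if "\<And>i. l i > 0" for l :: "'m \<Rightarrow> real"
    using that by (intro sum_pos) (auto simp: less_imp_neq[symmetric])
  have pos: "\<forall>k. \<nu> k > 0" if p: "p \<ge> 0"
  proof (cases "p = 0")
    case True
    have "0 < (\<Prod>i\<in>UNIV. \<mu> i) powr (1 / ?m)" using \<mu> by (simp add: prod_pos less_imp_neq[symmetric])
    also have "\<dots> \<le> (\<Prod>i\<in>UNIV. \<nu> i) powr (1 / ?m)" using le True by simp
    finally have "(\<Prod>i\<in>UNIV. \<nu> i) \<noteq> 0" by auto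
    hence "\<nu> k \<noteq> 0" for k by auto
    thus ?thesis using \<nu> by (simp add: less_le)
  next
    case False
    hence p0: "p > 0" using p by simp
    have "0 < ((\<Sum>i\<in>UNIV. \<mu> i powr (-p)) / ?m) powr (-1/p)"
      using S[OF \<mu>] m by (simp add: less_imp_neq[symmetric])
    thus ?thesis using le p0 \<mu> by (auto split: if_splits)
  qed
  thus "p \<ge> 0 \<Longrightarrow> \<nu> i > 0" by blast
  consider "p = 0" | "p > 0" | "p < 0" by linarith
  thus "(\<Sum>i\<in>UNIV. pot p (\<mu> i)) \<le> (\<Sum>k\<in>UNIV. pot p (\<nu> k))"
  proof cases
    case 1
    have \<nu>0: "\<nu> k > 0" for k using pos 1 by simp
    have P: "(\<Prod>i\<in>UNIV. \<mu> i) > 0" "(\<Prod>i\<in>UNIV. \<nu> i) > 0" using \<mu> \<nu>0 by (simp_all add: prod_pos)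
    have "(\<Prod>i\<in>UNIV. \<mu> i) powr (1 / ?m) \<le> (\<Prod>i\<in>UNIV. \<nu> i) powr (1 / ?m)" using le 1 by simp
    hence "(\<Prod>i\<in>UNIV. \<mu> i) \<le> (\<Prod>i\<in>UNIV. \<nu> i)"
      using P m by (meson divide_pos_pos less_eq_real_def not_le powr_less_mono2 zero_less_one)
    hence "ln (\<Prod>i\<in>UNIV. \<mu> i) \<le> ln (\<Prod>i\<in>UNIV. \<nu> i)" using P by simp
    moreover have "ln (\<Prod>i\<in>UNIV. l i) = (\<Sum>i\<in>UNIV. ln (l i))" if "\<And>i. l i > 0" for l :: "'m \<Rightarrow> real"
      by (intro ln_prod) (use that in \<open>auto simp: less_imp_neq[OF that, symmetric]\<close>)
    ultimately show ?thesis using \<mu> \<nu>0 1 by (simp add: pot_def)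
  next
    case 2
    have \<nu>0: "\<nu> k > 0" for k using pos 2 by simp
    have "((\<Sum>i\<in>UNIV. \<mu> i powr (-p)) / ?m) powr (-1/p) \<le> ((\<Sum>i\<in>UNIV. \<nu> i powr (-p)) / ?m) powr (-1/p)"
      using le 2 \<mu> \<nu>0 by simp
    moreover have "((\<Sum>i\<in>UNIV. \<nu> i powr (-p)) / ?m) powr (-1/p) < ((\<Sum>i\<in>UNIV. \<mu> i powr (-p)) / ?m) powr (-1/p)"
      if "(\<Sum>i\<in>UNIV. \<mu> i powr (-p)) < (\<Sum>i\<in>UNIV. \<nu> i powr (-p))"
      using that S[OF \<mu>] m 2 by (intro powr_less_mono2_neg) (auto simp: divide_strict_right_mono)
    ultimately have "(\<Sum>i\<in>UNIV. \<nu> i powr (-p)) \<le> (\<Sum>i\<in>UNIV. \<mu> i powr (-p))" by force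
    thus ?thesis using 2 by (simp add: pot_def sum_negf sum_divide_distrib[symmetric] divide_right_mono)
  next
    case 3
    have "((\<Sum>i\<in>UNIV. \<mu> i powr (-p)) / ?m) powr (-1/p) \<le> ((\<Sum>i\<in>UNIV. \<nu> i powr (-p)) / ?m) powr (-1/p)"
      using le 3 by simp
    moreover have "((\<Sum>i\<in>UNIV. \<nu> i powr (-p)) / ?m) powr (-1/p) < ((\<Sum>i\<in>UNIV. \<mu> i powr (-p)) / ?m) powr (-1/p)"
      if "(\<Sum>i\<in>UNIV. \<nu> i powr (-p)) < (\<Sum>i\<in>UNIV. \<mu> i powr (-p))"
      using that m 3 by (intro powr_less_mono2) (auto simp: divide_strict_right_mono sum_nonneg divide_pos_neg)
    ultimately have "(\<Sum>i\<in>UNIV. \<mu> i powr (-p)) \<le> (\<Sum>i\<in>UNIV. \<nu> i powr (-p))" by force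
    thus ?thesis using 3
      by (simp add: pot_def sum_negf sum_divide_distrib[symmetric] divide_right_mono_neg)
  qed
qed

text \<open>Klein's inequality for the concave function \<open>pot p\<close>: the scalar tangent
  inequalities are averaged with the squared overlaps, whose row and column sums are 1.\<close>

lemma pot_trace_tangent:
  fixes Q R :: "real^'m^'m"
  assumes Q: "orthogonal_matrix Q" and R: "orthogonal_matrix R" and p: "p > -1"
    and \<mu>: "\<And>i. \<mu> i > 0" and \<nu>: "\<And>i. \<nu> i \<ge> 0" "\<And>i. p \<ge> 0 \<Longrightarrow> \<nu> i > 0"
  shows "(\<Sum>k\<in>UNIV. pot p (\<nu> k)) - (\<Sum>i\<in>UNIV. pot p (\<mu> i))
    \<le> trace (spec Q (\<lambda>i. \<mu> i powr (-(p+1))) ** spec R \<nu>) - (\<Sum>i\<in>UNIV. \<mu> i powr (-p))"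
proof -
  have "(\<Sum>k\<in>UNIV. pot p (\<nu> k)) - (\<Sum>i\<in>UNIV. pot p (\<mu> i))
     = (\<Sum>i\<in>UNIV. \<Sum>k\<in>UNIV. (overlap Q R i k)\<^sup>2 * (pot p (\<nu> k) - pot p (\<mu> i)))"
    by (simp add: right_diff_distrib sum_subtractf sum_overlap_left[OF Q R] sum_overlap_right[OF Q R])
  also have "\<dots> \<le> (\<Sum>i\<in>UNIV. \<Sum>k\<in>UNIV. (overlap Q R i k)\<^sup>2 * (\<mu> i powr (-(p+1)) * (\<nu> k - \<mu> i)))"
    by (intro sum_mono mult_left_mono pot_tangent p \<mu> \<nu>) auto
  also have "\<dots> = (\<Sum>i\<in>UNIV. \<Sum>k\<in>UNIV. (overlap Q R i k)\<^sup>2 * (\<mu> i powr (-(p+1)) * \<nu> k))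
      - (\<Sum>i\<in>UNIV. \<Sum>k\<in>UNIV. (overlap Q R i k)\<^sup>2 * \<mu> i powr (-p))"
    unfolding sum_subtractf[symmetric]
  proof (intro sum.cong refl)
    fix i k
    have "\<mu> i powr (-(p+1)) * \<mu> i = \<mu> i powr (-p)"
      using powr_mult_base[of "\<mu> i" "-(p+1)"] \<mu>[of i] by (simp add: mult.commute)
    thus "(overlap Q R i k)\<^sup>2 * (\<mu> i powr (-(p+1)) * (\<nu> k - \<mu> i))
       = (overlap Q R i k)\<^sup>2 * (\<mu> i powr (-(p+1)) * \<nu> k) - (overlap Q R i k)\<^sup>2 * \<mu> i powr (-p)"
      by (simp only: right_diff_distrib)
  qed
  finally show ?thesis by (simp only: trace_spec_spec sum_overlap_left[OF Q R])
qed

lemma spec_lower_bound: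
  fixes Q :: "real^'m^'m"
  assumes Q: "orthogonal_matrix Q" and c: "\<And>i. c \<le> l i"
  shows "c * (v \<bullet> v) \<le> v \<bullet> (spec Q l *v v)"
  unfolding inner_spec inner_orthogonal_coords[OF Q, of v v] sum_distrib_left mult.assoc
  by (intro sum_mono mult_right_mono c) simp

lemma trace_spec_powr_self:
  fixes Q :: "real^'m^'m"
  assumes Q: "orthogonal_matrix Q" and \<mu>: "\<And>i. \<mu> i > 0"
  shows "trace (spec Q (\<lambda>i. \<mu> i powr (-(p+1))) ** spec Q \<mu>) = (\<Sum>i\<in>UNIV. \<mu> i powr (-p))"
proof -
  have "\<mu> i powr (-(p+1)) * \<mu> i = \<mu> i powr (-p)" for i
    using powr_mult_base[of "\<mu> i" "-(p+1)"] \<mu>[of i] by (simp add: mult.commute)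
  thus ?thesis by (simp add: spec_mult[OF Q] trace_spec[OF Q])
qed

text \<open>Positivity of the mixture is left as a premise because it has two sources: a nonsingular
  competitor in \<open>optimal_nonsingular\<close>, a nonsingular optimum in
  \<open>optimal_gradient\<close>.\<close>

lemma optimal_mixture:
  fixes \<xi>s \<eta> :: "(real^'m) measure"
  assumes opt: "phi_optimal X p \<xi>s" and X: "compact X" and \<eta>: "design X \<eta>"
    and R: "orthogonal_matrix R" and \<nu>: "\<And>k. \<nu> k \<ge> 0" and eq: "info_matrix \<xi>s = spec R \<nu>"
    and d: "0 \<le> d" "d \<le> 1"
  obtains Q \<mu> where "orthogonal_matrix Q" "\<And>i. \<mu> i \<ge> 0"
    "spec Q \<mu> = (1 - d) *\<^sub>R spec R \<nu> + d *\<^sub>R info_matrix \<eta>"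
    "(\<And>i. \<mu> i > 0) \<Longrightarrow> (\<Sum>i\<in>UNIV. pot p (\<mu> i)) \<le> (\<Sum>k\<in>UNIV. pot p (\<nu> k))"
proof -
  have \<xi>s: "design X \<xi>s" using opt by (simp add: phi_optimal_def)
  obtain \<zeta> where \<zeta>: "design X \<zeta>"
    "info_matrix \<zeta> = (1 - d) *\<^sub>R info_matrix \<xi>s + d *\<^sub>R info_matrix \<eta>"
    by (rule design_mixture[OF \<xi>s \<eta> X d])
  obtain Q \<mu> where Q: "orthogonal_matrix Q" "\<And>i. \<mu> i \<ge> 0" "info_matrix \<zeta> = spec Q \<mu>"
    by (rule info_matrix_spec[OF \<zeta>(1) X]) (rule that; blast)
  have le: "Phi_plus p (spec Q \<mu>) \<le> Phi_plus p (spec R \<nu>)"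
    using opt \<zeta>(1) by (simp add: phi_optimal_def flip: eq Q(3))
  show ?thesis
  proof (rule that[OF Q(1,2)])
    show "spec Q \<mu> = (1 - d) *\<^sub>R spec R \<nu> + d *\<^sub>R info_matrix \<eta>"
      using \<zeta>(2) by (simp add: eq Q(3))
    show "(\<Sum>i\<in>UNIV. pot p (\<mu> i)) \<le> (\<Sum>k\<in>UNIV. pot p (\<nu> k))" if "\<And>i. \<mu> i > 0"
      by (rule Phi_plus_le_pot(2)[OF Q(1) R that \<nu> le])
  qed
qed

text \<open>For \<open>p < 0\<close> the criterion does not vanish on singular matrices. If \<open>M\<close> were singular and
  optimal, the gradient of the criterion at \<open>(1 - d) M + d N\<close> in the direction \<open>N - M\<close> would have to be
  nonpositive, while its part along \<open>N\<close> blows up as \<open>d\<close> tends to \<open>0\<close>.\<close>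

lemma optimal_nonsingular:
  fixes \<xi> \<xi>s :: "(real^'m) measure"
  assumes opt: "phi_optimal X p \<xi>s" and X: "compact X" and p: "p > -1"
    and \<xi>: "design X \<xi>" and inv: "invertible (info_matrix \<xi>)"
    and R: "orthogonal_matrix R" and \<nu>: "\<And>k. \<nu> k \<ge> 0" and eq: "info_matrix \<xi>s = spec R \<nu>"
  shows "\<nu> k > 0"
proof -
  obtain Q0 \<mu>0 where Q0: "orthogonal_matrix Q0" "\<And>i. \<mu>0 i \<ge> 0" "info_matrix \<xi> = spec Q0 \<mu>0"
    by (rule info_matrix_spec[OF \<xi> X]) (rule that; blast)
  have \<mu>0: "\<mu>0 i > 0" for i using inv invertible_spec[OF Q0(1,2)] Q0(3) by simp
  show ?thesis
  proof (cases "p \<ge> 0")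
    case True
    have "Phi_plus p (spec Q0 \<mu>0) \<le> Phi_plus p (spec R \<nu>)"
      using opt \<xi> by (simp add: phi_optimal_def flip: eq Q0(3))
    from Phi_plus_le_pot(1)[OF Q0(1) R \<mu>0 \<nu> this True] show ?thesis .
  next
    case False
    define q where "q = p + 1"
    have q: "0 < q" "q < 1" using p False by (auto simp: q_def)
    show ?thesis
    proof (rule ccontr)
      assume "\<not> \<nu> k > 0"
      hence \<nu>k: "\<nu> k = 0" using \<nu>[of k] by simp
      define u where "u = R *v axis k 1"
      have u: "norm u = 1" "u \<bullet> (spec R \<nu> *v u) = 0"
        using spec_eigenvector(1)[OF R] spec_eigenvector(3)[OF R, of k \<nu>] \<nu>k by (auto simp: u_def)
      have uu: "u \<bullet> u = 1" using u(1) by (simp add: norm_eq_1)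
      define c where "c = Min (range \<mu>0)"
      have "c \<in> range \<mu>0" unfolding c_def by (intro Min_in) auto
      hence c: "c > 0" using \<mu>0 by auto
      have c_le: "c \<le> \<mu>0 i" for i by (simp add: c_def)
      define b where "b = u \<bullet> (spec Q0 \<mu>0 *v u)"
      have b: "b > 0" unfolding b_def by (rule spec_pos[OF Q0(1) \<mu>0]) (use u in auto)
      define K where "K = sum \<nu> UNIV + sum \<mu>0 UNIV"
      define m where "m = real CARD('m)"
      \<comment> \<open>The right side does not depend on \<open>d\<close>. The left side blows up:
        as \<open>u\<close> lies in the kernel of the optimal matrix, the mixture has an eigenvalue
        at most d b.\<close>
      have main: "c * (d * b) powr (-q) \<le> 2 * (m + K)" if d: "0 < d" "d \<le> 1/2" for d
      proof -
        obtain Q \<mu> where Q: "orthogonal_matrix Q" "\<And>i. \<mu> i \<ge> 0"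
          "spec Q \<mu> = (1 - d) *\<^sub>R spec R \<nu> + d *\<^sub>R spec Q0 \<mu>0"
          "(\<And>i. \<mu> i > 0) \<Longrightarrow> (\<Sum>i\<in>UNIV. pot p (\<mu> i)) \<le> (\<Sum>k\<in>UNIV. pot p (\<nu> k))"
          using optimal_mixture[OF opt X \<xi> R \<nu> eq, of d thesis] d unfolding Q0(3) by auto
        have quad: "v \<bullet> (spec Q \<mu> *v v) = (1 - d) * (v \<bullet> (spec R \<nu> *v v)) + d * (v \<bullet> (spec Q0 \<mu>0 *v v))" for v
          by (simp add: Q(3) matrix_vector_mult_add_rdistrib scaleR_matrix_vector_assoc[symmetric] inner_add_right)
        have Rn: "v \<bullet> (spec R \<nu> *v v) \<ge> 0" for v
          using spec_lower_bound[where l = \<nu>, OF R \<nu>, of v] by simp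
        have \<mu>: "\<mu> i > 0" for i
        proof -
          define w where "w = Q *v axis i 1"
          have w: "norm w = 1" "w \<bullet> (spec Q \<mu> *v w) = \<mu> i"
            using spec_eigenvector(1)[OF Q(1)] spec_eigenvector(3)[OF Q(1), of i \<mu>] by (auto simp: w_def)
          have "w \<noteq> 0" using w(1) by auto
          from spec_pos[OF Q0(1) \<mu>0 this] have "0 < d * (w \<bullet> (spec Q0 \<mu>0 *v w))" using d by simp
          moreover have "0 \<le> (1 - d) * (w \<bullet> (spec R \<nu> *v w))" using d Rn[of w] by simp
          ultimately show ?thesis using w(2) quad[of w] by simp
        qed
        define T1 where "T1 = trace (spec Q (\<lambda>i. \<mu> i powr (-(p+1))) ** spec R \<nu>)"
        define T2 where "T2 = trace (spec Q (\<lambda>i. \<mu> i powr (-(p+1))) ** spec Q0 \<mu>0)"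
        define S where "S = (\<Sum>i\<in>UNIV. \<mu> i powr (-p))"
        have "(\<Sum>k\<in>UNIV. pot p (\<nu> k)) - (\<Sum>i\<in>UNIV. pot p (\<mu> i)) \<le> T1 - S"
          unfolding T1_def S_def by (rule pot_trace_tangent[OF Q(1) R p \<mu> \<nu>]) (use False in simp)
        \<comment> \<open>The tangent is taken at the mixture, which is no better than the optimum.
          As \<open>S\<close> mixes \<open>T1\<close> and \<open>T2\<close> in the same proportion,
          S \<le> T1 amounts to T2 \<le> T1.\<close>
        hence "0 \<le> T1 - S" using Q(4)[OF \<mu>] by linarith
        moreover have S_eq: "S = (1 - d) * T1 + d * T2"
          unfolding S_def T1_def T2_def trace_spec_powr_self[OF Q(1) \<mu>, symmetric]
          by (subst Q(3)) (rule trace_mult_combination)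
        ultimately have "d * T2 \<le> d * T1" by (simp add: algebra_simps)
        hence T21: "T2 \<le> T1" using d by simp
        have T2: "c * (\<Sum>i\<in>UNIV. \<mu> i powr (-q)) \<le> T2"
        proof -
          have "c * (\<Sum>i\<in>UNIV. \<mu> i powr (-q))
              = (\<Sum>i\<in>UNIV. \<Sum>j\<in>UNIV. (overlap Q Q0 i j)\<^sup>2 * (\<mu> i powr (-q) * c))"
            unfolding sum_overlap_left[OF Q(1) Q0(1)] sum_distrib_left by (intro sum.cong refl) simp
          also have "\<dots> \<le> T2" unfolding T2_def trace_spec_spec q_def
            by (intro sum_mono mult_left_mono c_le) auto
          finally show ?thesis .
        qed
        have "0 \<le> c * (\<Sum>i\<in>UNIV. \<mu> i powr (-q))" using c by (intro mult_nonneg_nonneg sum_nonneg) auto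
        hence T20: "0 \<le> T2" using T2 by linarith
        have "T1 * (1/2) \<le> T1 * (1 - d)" using d T21 T20 by (intro mult_left_mono) auto
        also have "\<dots> \<le> S" using S_eq T20 d by (simp add: mult.commute)
        finally have T1_le: "T1 \<le> 2 * S" by simp
        have S_le: "S \<le> m + K"
        proof -
          \<comment> \<open>Since 0 < -p < 1, the sum \<open>S\<close> is controlled by the trace,
            which is bounded along the segment.\<close>
          have "\<mu> i powr (-p) \<le> 1 + \<mu> i" for i
          proof (cases "\<mu> i \<le> 1")
            case True
            have "\<mu> i powr (-p) \<le> 1 powr (-p)" using True \<mu>[of i] False by (intro powr_mono2) auto
            thus ?thesis using \<mu>[of i] by simp
          next
            case False
            have "\<mu> i powr (-p) \<le> \<mu> i powr 1" using False p by (intro powr_mono) auto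
            thus ?thesis using \<mu>[of i] by simp
          qed
          hence "S \<le> (\<Sum>i\<in>UNIV. 1 + \<mu> i)" unfolding S_def by (intro sum_mono) auto
          also have "\<dots> = m + trace (spec Q \<mu>)" by (simp add: sum.distrib m_def trace_spec[OF Q(1)])
          also have "trace (spec Q \<mu>) = (1 - d) * sum \<nu> UNIV + d * sum \<mu>0 UNIV"
            by (simp add: Q(3) trace_add trace_scaleR trace_spec[OF R] trace_spec[OF Q0(1)])
          also have "\<dots> \<le> 1 * sum \<nu> UNIV + 1 * sum \<mu>0 UNIV"
            using d \<nu> \<mu>0 by (intro add_mono mult_right_mono sum_nonneg) (auto simp: less_imp_le)
          finally show ?thesis by (simp add: K_def)
        qed
        have "2 * S \<le> 2 * (m + K)" by (rule mult_left_mono[OF S_le]) simp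
        hence T2_up: "T2 \<le> 2 * (m + K)" using T21 T1_le by (meson order.trans)
        define e where "e = Min (range \<mu>)"
        have "e \<in> range \<mu>" unfolding e_def by (intro Min_in) auto
        then obtain j where j: "e = \<mu> j" by auto
        have e_le: "e \<le> \<mu> i" for i by (simp add: e_def)
        have "e \<le> d * b"
          using spec_lower_bound[where l = \<mu>, OF Q(1) e_le, of u] by (simp add: uu quad u(2) b_def)
        hence "(d * b) powr (-q) \<le> \<mu> j powr (-q)"
          using \<mu>[of j] q by (intro powr_mono2') (auto simp: j)
        also have "\<dots> \<le> (\<Sum>i\<in>UNIV. \<mu> i powr (-q))" by (rule member_le_sum) auto
        finally have "c * (d * b) powr (-q) \<le> c * (\<Sum>i\<in>UNIV. \<mu> i powr (-q))"
          using c by (intro mult_left_mono) auto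
        thus ?thesis using T2 T2_up by linarith
      qed
      \<comment> \<open>\<open>c * W\<close> exceeds the bound of \<open>main\<close> by 1, and
        \<open>d\<close> is taken so small that (d b)^(-q) is at least \<open>W\<close>.\<close>
      define W where "W = (2 * (m + K) + 1) / c"
      have "K \<ge> 0" unfolding K_def using \<nu> \<mu>0 by (intro add_nonneg_nonneg sum_nonneg) (auto simp: less_imp_le)
      hence W: "W > 0" using c by (simp add: W_def m_def add_nonneg_pos)
      define d where "d = min (1/2) (W powr (-1/q) / b)"
      have d: "0 < d" using W b by (simp add: d_def)
      have d2: "d \<le> 1/2" unfolding d_def by (rule min.cobounded1)
      have "d * b \<le> W powr (-1/q)" using b by (simp add: d_def min_def field_simps)
      hence "(W powr (-1/q)) powr (-q) \<le> (d * b) powr (-q)" using d b q by (intro powr_mono2') auto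
      hence "W \<le> (d * b) powr (-q)" using W q by (simp add: powr_powr)
      hence "c * W \<le> c * (d * b) powr (-q)" using c by simp
      with main[OF d d2] c show False by (simp add: W_def)
    qed
  qed
qed

text \<open>The first-order condition comes from a bound with quadratic error instead of a
  derivative of a matrix function: along the segment the sum of \<open>pot p\<close> grows by at
  least d D - d^2 L G, which is positive for small \<open>d\<close> if D > 0.\<close>

lemma optimal_gradient:
  fixes \<xi>s \<eta> :: "(real^'m) measure"
  assumes opt: "phi_optimal X p \<xi>s" and X: "compact X" and p: "p > -1" and \<eta>: "design X \<eta>"
    and R: "orthogonal_matrix R" and \<nu>: "\<And>k. \<nu> k > 0" and eq: "info_matrix \<xi>s = spec R \<nu>"
  shows "trace (spec R (\<lambda>i. \<nu> i powr (-(p+1))) ** info_matrix \<eta>) \<le> (\<Sum>i\<in>UNIV. \<nu> i powr (-p))"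
proof (rule ccontr)
  define q where "q = p + 1"
  have q: "q > 0" using p by (simp add: q_def)
  define A where "A = spec R (\<lambda>i. \<nu> i powr (-q))"
  define D where "D = trace (A ** info_matrix \<eta>) - (\<Sum>i\<in>UNIV. \<nu> i powr (-p))"
  assume "\<not> ?thesis"
  hence D: "D > 0" by (simp add: D_def A_def q_def)
  define c where "c = Min (range \<nu>)"
  have "c \<in> range \<nu>" unfolding c_def by (intro Min_in) auto
  hence c: "c > 0" using \<nu> by auto
  have c_le: "c \<le> \<nu> i" for i by (simp add: c_def)
  \<comment> \<open>A Lipschitz constant of x^(-q) on x \<ge> c / 2, where the eigenvalues of the
    mixture stay for d \<le> 1/2.\<close>
  define L where "L = q * (c / 2) powr (-(q+1))"
  \<comment> \<open>The squared Frobenius distance of the two information matrices, expanded into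
    traces.\<close>
  define G where "G = trace (info_matrix \<eta> ** info_matrix \<eta>) - 2 * trace (spec R \<nu> ** info_matrix \<eta>)
     + trace (spec R \<nu> ** spec R \<nu>)"
  have lip: "(x powr (-q) - y powr (-q)) * (x - y) \<ge> - L * (x - y)\<^sup>2" if "x \<ge> c / 2" "y \<ge> c / 2" for x y
  proof -
    have *: "(x powr (-q) - y powr (-q)) * (x - y) \<ge> - L * (x - y)\<^sup>2" if "x \<ge> y" "y \<ge> c / 2" for x y
    proof -
      \<comment> \<open>\<open>pot\<close> is taken with parameter \<open>q\<close> instead of
        \<open>p\<close>: up to the factor -1/q it is x^(-q), so its tangent inequality yields the
        Lipschitz bound.\<close>
      have "pot q x - pot q y \<le> y powr (-(q+1)) * (x - y)"
        using that c q by (intro pot_tangent) auto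
      hence "(y powr (-q) - x powr (-q)) / q \<le> y powr (-(q+1)) * (x - y)"
        using q by (simp add: pot_def diff_divide_distrib)
      hence "y powr (-q) - x powr (-q) \<le> q * y powr (-(q+1)) * (x - y)"
        using q by (simp add: pos_divide_le_eq mult_ac)
      also have "\<dots> \<le> L * (x - y)" unfolding L_def
        using that c q by (intro mult_right_mono mult_left_mono powr_mono2') auto
      finally have "(y powr (-q) - x powr (-q)) * (x - y) \<le> L * (x - y) * (x - y)"
        using that by (intro mult_right_mono) auto
      thus ?thesis by (simp add: power2_eq_square algebra_simps)
    qed
    show ?thesis using *[of x y] *[of y x] that
      by (cases "x \<ge> y") (auto simp: power2_commute algebra_simps)
  qed
  have main: "D \<le> d * (L * G)" if d: "0 < d" "d \<le> 1/2" for d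
  proof -
    have \<nu>': "\<nu> k \<ge> 0" for k using \<nu>[of k] by simp
    obtain Q \<mu> where Q: "orthogonal_matrix Q" "\<And>i. \<mu> i \<ge> 0"
      "spec Q \<mu> = (1 - d) *\<^sub>R spec R \<nu> + d *\<^sub>R info_matrix \<eta>"
      "(\<And>i. \<mu> i > 0) \<Longrightarrow> (\<Sum>i\<in>UNIV. pot p (\<mu> i)) \<le> (\<Sum>k\<in>UNIV. pot p (\<nu> k))"
      using optimal_mixture[OF opt X \<eta> R \<nu>' eq, of d thesis] d by auto
    have \<mu>c: "\<mu> i \<ge> c / 2" for i
    proof -
      define w where "w = Q *v axis i 1"
      have w: "norm w = 1" "w \<bullet> (spec Q \<mu> *v w) = \<mu> i"
        using spec_eigenvector(1)[OF Q(1)] spec_eigenvector(3)[OF Q(1), of i \<mu>] by (auto simp: w_def)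
      have "c * (1 / 2) \<le> c * (1 - d)" using c d by (intro mult_left_mono) auto
      also have "\<dots> \<le> (w \<bullet> (spec R \<nu> *v w)) * (1 - d)"
        using spec_lower_bound[where l = \<nu>, OF R c_le, of w] w(1) d by (intro mult_right_mono) (auto simp: norm_eq_1)
      also have "\<dots> \<le> (1 - d) * (w \<bullet> (spec R \<nu> *v w)) + d * (w \<bullet> (info_matrix \<eta> *v w))"
        using info_matrix_nonneg[OF \<eta> X, of w] d by simp
      also have "\<dots> = \<mu> i" unfolding w(2)[symmetric]
        by (simp add: Q(3) matrix_vector_mult_add_rdistrib scaleR_matrix_vector_assoc[symmetric] inner_add_right)
      finally show ?thesis by simp
    qed
    have \<mu>: "\<mu> i > 0" for i using \<mu>c[of i] c by simp
    have \<nu>c: "\<nu> k \<ge> c / 2" for k using c_le[of k] c by simp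
    have "0 \<ge> (\<Sum>i\<in>UNIV. pot p (\<mu> i)) - (\<Sum>k\<in>UNIV. pot p (\<nu> k))" using Q(4)[OF \<mu>] by simp
    also have "(\<Sum>i\<in>UNIV. pot p (\<mu> i)) - (\<Sum>k\<in>UNIV. pot p (\<nu> k))
       = (\<Sum>i\<in>UNIV. \<Sum>k\<in>UNIV. (overlap R Q i k)\<^sup>2 * (pot p (\<mu> k) - pot p (\<nu> i)))"
      by (simp add: right_diff_distrib sum_subtractf sum_overlap_left[OF R Q(1)] sum_overlap_right[OF R Q(1)])
    also have "\<dots> \<ge> (\<Sum>i\<in>UNIV. \<Sum>k\<in>UNIV. (overlap R Q i k)\<^sup>2 * (\<nu> i powr (-q) * (\<mu> k - \<nu> i) - L * (\<mu> k - \<nu> i)\<^sup>2))"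
    proof (intro sum_mono mult_left_mono)
      fix i k
      have "pot p (\<nu> i) - pot p (\<mu> k) \<le> \<mu> k powr (-q) * (\<nu> i - \<mu> k)"
        unfolding q_def by (rule pot_tangent) (use p \<mu> \<nu> \<nu>' in auto)
      moreover have "(\<mu> k powr (-q) - \<nu> i powr (-q)) * (\<mu> k - \<nu> i) \<ge> - L * (\<mu> k - \<nu> i)\<^sup>2"
        by (rule lip[OF \<mu>c \<nu>c])
      ultimately show "\<nu> i powr (-q) * (\<mu> k - \<nu> i) - L * (\<mu> k - \<nu> i)\<^sup>2 \<le> pot p (\<mu> k) - pot p (\<nu> i)"
        by (simp add: algebra_simps)
    qed simp
    also have "(\<Sum>i\<in>UNIV. \<Sum>k\<in>UNIV. (overlap R Q i k)\<^sup>2 * (\<nu> i powr (-q) * (\<mu> k - \<nu> i) - L * (\<mu> k - \<nu> i)\<^sup>2))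
      = (\<Sum>i\<in>UNIV. \<Sum>k\<in>UNIV. (overlap R Q i k)\<^sup>2 * (\<nu> i powr (-q) * \<mu> k))
      - (\<Sum>i\<in>UNIV. \<Sum>k\<in>UNIV. (overlap R Q i k)\<^sup>2 * (\<nu> i powr (-q) * \<nu> i))
      - L * ((\<Sum>i\<in>UNIV. \<Sum>k\<in>UNIV. (overlap R Q i k)\<^sup>2 * (\<mu> k * \<mu> k))
         - 2 * (\<Sum>i\<in>UNIV. \<Sum>k\<in>UNIV. (overlap R Q i k)\<^sup>2 * (\<nu> i * \<mu> k))
         + (\<Sum>i\<in>UNIV. \<Sum>k\<in>UNIV. (overlap R Q i k)\<^sup>2 * (\<nu> i * \<nu> i)))"
      unfolding sum_distrib_left sum.distrib[symmetric] sum_subtractf[symmetric]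
      by (intro sum.cong refl) (simp add: power2_eq_square algebra_simps)
    also have "\<dots> = trace (A ** spec Q \<mu>) - trace (A ** spec R \<nu>)
      - L * (trace (spec Q \<mu> ** spec Q \<mu>) - 2 * trace (spec R \<nu> ** spec Q \<mu>) + trace (spec R \<nu> ** spec R \<nu>))"
      unfolding A_def sum_overlap_left[OF R Q(1)] sum_overlap_right[OF R Q(1)]
        spec_mult[OF R] spec_mult[OF Q(1)] trace_spec[OF R] trace_spec[OF Q(1)] trace_spec_spec[of R _ Q] ..
    also have "trace (A ** spec Q \<mu>) - trace (A ** spec R \<nu>) = d * D"
      unfolding Q(3) trace_mult_combination D_def A_def q_def trace_spec_powr_self[OF R \<nu>]
      by (simp add: algebra_simps)
    also have "trace (spec Q \<mu> ** spec Q \<mu>) - 2 * trace (spec R \<nu> ** spec Q \<mu>) + trace (spec R \<nu> ** spec R \<nu>)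
       = d\<^sup>2 * G"
    proof -
      have comb: "trace (B ** spec Q \<mu>) = (1 - d) * trace (B ** spec R \<nu>) + d * trace (B ** info_matrix \<eta>)" for B
        unfolding Q(3) by (rule trace_mult_combination)
      show ?thesis
        using comb[of "spec Q \<mu>"] comb[of "spec R \<nu>"] comb[of "info_matrix \<eta>"]
          trace_mul_sym[of "spec Q \<mu>" "spec R \<nu>"] trace_mul_sym[of "spec Q \<mu>" "info_matrix \<eta>"]
          trace_mul_sym[of "info_matrix \<eta>" "spec R \<nu>"]
        unfolding G_def by algebra
    qed
    finally have "d * D \<le> d * (d * (L * G))" by (simp add: power2_eq_square algebra_simps)
    thus ?thesis using d by simp
  qed
  define d where "d = min (1/2) (D / (2 * (\<bar>L * G\<bar> + 1)))"
  have d: "0 < d" using D by (simp add: d_def add_nonneg_pos)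
  have d2: "d \<le> 1/2" unfolding d_def by (rule min.cobounded1)
  have "d * (L * G) \<le> d * (\<bar>L * G\<bar> + 1)" using d by (intro mult_left_mono) auto
  also have "\<dots> \<le> (D / (2 * (\<bar>L * G\<bar> + 1))) * (\<bar>L * G\<bar> + 1)" by (intro mult_right_mono) (auto simp: d_def)
  also have "\<dots> = D / 2" by (simp add: divide_simps)
  finally show False using main[OF d d2] D by simp
qed

text \<open>Complementary slackness: by \<open>optimal_gradient\<close> at point masses the slack t
  - y A y is nonnegative on \<open>X\<close>, and its integral over the optimal design is 0. Strict
  slack at \<open>x\<close> would persist on a ball, which would be a null set.\<close>

lemma optimal_support:
  fixes \<xi>s :: "(real^'m) measure"
  assumes opt: "phi_optimal X p \<xi>s" and X: "compact X" and p: "p > -1"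
    and R: "orthogonal_matrix R" and \<nu>: "\<And>k. \<nu> k > 0" and eq: "info_matrix \<xi>s = spec R \<nu>"
    and x: "x \<in> X" "x \<in> support \<xi>s"
  shows "(\<Sum>i\<in>UNIV. \<nu> i powr (-p)) \<le> x \<bullet> (spec R (\<lambda>i. \<nu> i powr (-(p+1))) *v x)"
proof (rule ccontr)
  define A where "A = spec R (\<lambda>i. \<nu> i powr (-(p+1)))"
  define t where "t = (\<Sum>i\<in>UNIV. \<nu> i powr (-p))"
  assume "\<not> ?thesis"
  hence lt: "x \<bullet> (A *v x) < t" by (simp add: A_def t_def)
  have \<xi>s: "design X \<xi>s" using opt by (simp add: phi_optimal_def)
  interpret prob_space \<xi>s using \<xi>s by (rule design_prob_space)
  have cont: "continuous_on UNIV (\<lambda>y. y \<bullet> (A *v y))" by (intro continuous_intros)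
  have int: "integrable \<xi>s (\<lambda>y. y \<bullet> (A *v y))" by (rule design_integrable[OF \<xi>s X cont])
  have le: "y \<bullet> (A *v y) \<le> t" if "y \<in> X" for y
    using optimal_gradient[OF opt X p design_return[OF that X] R \<nu> eq]
    by (simp add: trace_info_matrix_return[OF that X] A_def t_def)
  have "(LINT y|\<xi>s. t - y \<bullet> (A *v y)) = t - (LINT y|\<xi>s. y \<bullet> (A *v y))"
    using int by (simp add: prob_space)
  also have "(LINT y|\<xi>s. y \<bullet> (A *v y)) = t"
    unfolding trace_info_matrix[OF \<xi>s X, symmetric] eq A_def t_def by (rule trace_spec_powr_self[OF R \<nu>])
  finally have "(LINT y|\<xi>s. t - y \<bullet> (A *v y)) = 0" by simp
  moreover have "AE y in \<xi>s. 0 \<le> t - y \<bullet> (A *v y)"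
    using design_AE[OF \<xi>s X] by eventually_elim (use le in simp)
  moreover have "integrable \<xi>s (\<lambda>y. t - y \<bullet> (A *v y))" using int by simp
  ultimately have "AE y in \<xi>s. t - y \<bullet> (A *v y) = 0"
    by (simp add: integral_nonneg_eq_0_iff_AE)
  hence AE: "AE y in \<xi>s. y \<notin> {y. y \<bullet> (A *v y) < t}" by eventually_elim simp
  have op: "open {y. y \<bullet> (A *v y) < t}"
    using cont by (intro open_Collect_less) auto
  have "x \<in> {y. y \<bullet> (A *v y) < t}" using lt by simp
  with op obtain e where e: "e > 0" "ball x e \<subseteq> {y. y \<bullet> (A *v y) < t}"
    by (rule openE)
  have "AE y in \<xi>s. y \<notin> ball x e" using AE by eventually_elim (use e in auto)
  hence "emeasure \<xi>s (ball x e) = 0"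
    by (subst AE_iff_measurable[symmetric, where P = "\<lambda>y. y \<notin> ball x e"])
      (auto simp: design_sets[OF \<xi>s] sets_eq_imp_space_eq[OF design_sets[OF \<xi>s]])
  thus False using x(2) e(1) by (auto simp: support_def)
qed

text \<open>One side is the optimality hypothesis \<open>pot\<close>. The other is the tangent
  inequality at \<beta> M, where the trace bound is exactly compensated and the sum of
  \<open>pot p\<close> for N is at most that for \<beta> M. The sign of \<open>p\<close> decides
  which of them bounds from above, hence \<open>min\<close> and \<open>max\<close>.\<close>

lemma trace_power_bounds:
  fixes Q R :: "real^'m^'m"
  assumes Q: "orthogonal_matrix Q" and R: "orthogonal_matrix R" and p: "p > -1"
    and \<mu>: "\<And>i. \<mu> i > 0" and \<nu>: "\<And>i. \<nu> i > 0" and \<beta>: "\<beta> > 0"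
    and pot: "(\<Sum>i\<in>UNIV. pot p (\<mu> i)) \<le> (\<Sum>k\<in>UNIV. pot p (\<nu> k))"
    and tr: "trace (spec Q (\<lambda>i. \<mu> i powr (-(p+1))) ** spec R \<nu>) \<le> \<beta> * (\<Sum>i\<in>UNIV. \<mu> i powr (-p))"
  defines "t \<equiv> \<Sum>i\<in>UNIV. \<mu> i powr (-p)"
  shows "t * min 1 (\<beta> powr (-p)) \<le> (\<Sum>i\<in>UNIV. \<nu> i powr (-p))"
    "(\<Sum>i\<in>UNIV. \<nu> i powr (-p)) \<le> t * max 1 (\<beta> powr (-p))"
proof -
  define ts where "ts = (\<Sum>i\<in>UNIV. \<nu> i powr (-p))"
  have t0: "t \<ge> 0" unfolding t_def by (intro sum_nonneg) auto
  have \<nu>': "\<nu> i \<ge> 0" for i using \<nu>[of i] by simp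
  have \<beta>\<mu>: "\<beta> * \<mu> i > 0" for i using \<beta> \<mu>[of i] by simp
  have pw: "(\<beta> * \<mu> i) powr s = \<beta> powr s * \<mu> i powr s" for i s
    using \<beta> \<mu>[of i] by (simp add: powr_mult)
  have "(\<Sum>k\<in>UNIV. pot p (\<nu> k)) - (\<Sum>i\<in>UNIV. pot p (\<beta> * \<mu> i))
    \<le> trace (spec Q (\<lambda>i. (\<beta> * \<mu> i) powr (-(p+1))) ** spec R \<nu>) - (\<Sum>i\<in>UNIV. (\<beta> * \<mu> i) powr (-p))"
    by (rule pot_trace_tangent[OF Q R p \<beta>\<mu> \<nu>' \<nu>])
  also have "trace (spec Q (\<lambda>i. (\<beta> * \<mu> i) powr (-(p+1))) ** spec R \<nu>)
      = \<beta> powr (-(p+1)) * trace (spec Q (\<lambda>i. \<mu> i powr (-(p+1))) ** spec R \<nu>)"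
    unfolding trace_spec_spec pw sum_distrib_left by (intro sum.cong refl) simp
  also have "\<dots> \<le> \<beta> powr (-(p+1)) * (\<beta> * t)" using tr unfolding t_def by (intro mult_left_mono) auto
  also have "\<dots> = (\<beta> * \<beta> powr (-(p+1))) * t" by (simp only: mult_ac)
  also have "\<beta> * \<beta> powr (-(p+1)) = \<beta> powr (-p)" using powr_mult_base[of \<beta> "-(p+1)"] \<beta> by simp
  also have "(\<Sum>i\<in>UNIV. (\<beta> * \<mu> i) powr (-p)) = \<beta> powr (-p) * t"
    by (simp add: pw sum_distrib_left t_def)
  finally have le: "(\<Sum>k\<in>UNIV. pot p (\<nu> k)) \<le> (\<Sum>i\<in>UNIV. pot p (\<beta> * \<mu> i))" by simp
  have "t * min 1 (\<beta> powr (-p)) \<le> ts \<and> ts \<le> t * max 1 (\<beta> powr (-p))"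
  proof (cases "p = 0")
    case True
    thus ?thesis using \<mu> \<nu> \<beta> by (simp add: ts_def t_def less_imp_neq[symmetric])
  next
    case False
    have sums: "(\<Sum>i\<in>UNIV. pot p (\<mu> i)) = - t / p" "(\<Sum>k\<in>UNIV. pot p (\<nu> k)) = - ts / p"
      "(\<Sum>i\<in>UNIV. pot p (\<beta> * \<mu> i)) = - (\<beta> powr (-p) * t) / p"
      using False by (simp_all add: pot_def t_def ts_def sum_negf sum_divide_distrib pw sum_distrib_left)
    have mm: "t * min 1 (\<beta> powr (-p)) \<le> t * 1" "t * min 1 (\<beta> powr (-p)) \<le> t * \<beta> powr (-p)"
      "t * 1 \<le> t * max 1 (\<beta> powr (-p))" "t * \<beta> powr (-p) \<le> t * max 1 (\<beta> powr (-p))"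
      by (intro mult_left_mono t0; simp)+
    show ?thesis
    proof (cases "p > 0")
      case True
      hence "ts \<le> t" "\<beta> powr (-p) * t \<le> ts"
        using pot le unfolding sums by (simp_all add: divide_le_cancel)
      thus ?thesis using mm by (simp add: mult.commute)
    next
      case p: False
      hence "t \<le> ts" "ts \<le> \<beta> powr (-p) * t"
        using pot le False unfolding sums by (simp_all add: divide_le_cancel)
      thus ?thesis using mm by (simp add: mult.commute)
    qed
  qed
  thus "t * min 1 (\<beta> powr (-p)) \<le> (\<Sum>i\<in>UNIV. \<nu> i powr (-p))"
    "(\<Sum>i\<in>UNIV. \<nu> i powr (-p)) \<le> t * max 1 (\<beta> powr (-p))" by (simp_all add: ts_def)
qed

subsection \<open>The scalar equation\<close>

text \<open>With s = (\<beta> - \<alpha> z) / (1 - \<alpha>) the derivative is \<alpha> q (s^(-q-1)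
  - z^(-q-1)), negative exactly while z < s, that is, z < \<beta>. At z = \<beta> it vanishes, so
  the derivative is examined on the open interval only.\<close>

lemma F_fun_strict_decreasing:
  assumes \<alpha>: "0 < \<alpha>" "\<alpha> < 1" and p: "p > -1" and x: "0 < x" "x < y" "y \<le> 1 + \<epsilon> / t"
  shows "F_fun y \<alpha> \<epsilon> t \<gamma> p < F_fun x \<alpha> \<epsilon> t \<gamma> p"
proof -
  define q \<beta> where "q = p + 1" and "\<beta> = 1 + \<epsilon> / t"
  define f where "f z = \<alpha> * z powr (-q) + (1 - \<alpha>) powr (q + 1) * (\<beta> - \<alpha> * z) powr (-q) - \<gamma>" for z
  have q: "q > 0" using p by (simp add: q_def)
  have pos: "\<beta> - \<alpha> * z > 0" if "0 < z" "z \<le> \<beta>" for z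
  proof -
    have "\<alpha> * z < z" using \<alpha> that by simp
    thus ?thesis using that by linarith
  qed
  have F: "F_fun z \<alpha> \<epsilon> t \<gamma> p = f z" for z
    unfolding F_fun_def f_def q_def \<beta>_def powr_minus_divide by (simp add: add.commute)
  have "f y < f x"
  proof (rule DERIV_neg_imp_decreasing_open[OF x(2)])
    fix z assume z: "x < z" "z < y"
    have z0: "0 < z" "z < \<beta>" using z x by (auto simp: \<beta>_def)
    define D where "D = \<alpha> * (-q * z powr (-q-1)) + (1 - \<alpha>) powr (q + 1) * (-q * (\<beta> - \<alpha> * z) powr (-q-1) * (- \<alpha>))"
    have "(f has_real_derivative D) (at z)"
      unfolding f_def D_def using z0 pos[of z]
      by (auto intro!: derivative_eq_intros simp: divide_simps)
    moreover have "D < 0"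
    proof -
      have "(1 - \<alpha>) * z < \<beta> - \<alpha> * z" using z0 by (simp add: algebra_simps)
      hence "(1 - \<alpha>) / (\<beta> - \<alpha> * z) < 1 / z" using z0 pos[of z] by (simp add: field_simps)
      hence "((1 - \<alpha>) / (\<beta> - \<alpha> * z)) powr (q+1) < (1 / z) powr (q+1)"
        using \<alpha> z0 pos[of z] q by (intro powr_less_mono2) auto
      hence lt: "(1 - \<alpha>) powr (q+1) * (\<beta> - \<alpha> * z) powr (-q-1) < z powr (-q-1)"
        using \<alpha> z0 pos[of z] by (simp add: powr_divide powr_minus_divide[of _ "q+1", simplified])
      have "D = \<alpha> * q * ((1 - \<alpha>) powr (q+1) * (\<beta> - \<alpha> * z) powr (-q-1) - z powr (-q-1))"
        by (simp add: D_def algebra_simps)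
      thus ?thesis using lt \<alpha> q by (simp add: mult_pos_neg)
    qed
    ultimately show "\<exists>D. (f has_real_derivative D) (at z) \<and> D < 0" by blast
  next
    have "\<beta> - \<alpha> * z \<noteq> 0" if "z \<in> {x..y}" for z
      using pos[of z] that x by (auto simp: \<beta>_def)
    thus "continuous_on {x..y} f" unfolding f_def
      using x by (intro continuous_intros) auto
  qed
  thus ?thesis by (simp add: F)
qed

text \<open>At the left end the first term alone equals \<gamma>, so the function is positive. At
  the right end the first term is \<alpha> \<gamma>, and the second is at most (1 - \<alpha>)
  \<gamma> because the end does not exceed \<beta>.\<close>

lemma F_fun_unique_root:
  assumes \<alpha>: "0 < \<alpha>" "\<alpha> < 1" and p: "p > -1" and \<gamma>: "\<gamma> > 0"
    and hi: "(1 / \<gamma>) powr (1 / (p+1)) \<le> 1 + \<epsilon> / t"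
  shows "\<exists>!\<omega>. \<omega> \<in> {(\<alpha>/\<gamma>) powr (1/(p+1)) <.. (1/\<gamma>) powr (1/(p+1))} \<and> F_fun \<omega> \<alpha> \<epsilon> t \<gamma> p = 0"
proof -
  define q \<beta> where "q = p + 1" and "\<beta> = 1 + \<epsilon> / t"
  define a b where "a = (\<alpha>/\<gamma>) powr (1/q)" and "b = (1/\<gamma>) powr (1/q)"
  have q: "q > 0" using p by (simp add: q_def)
  have a0: "a > 0" using \<alpha> \<gamma> by (simp add: a_def)
  have ab: "a < b" unfolding a_def b_def using \<alpha> \<gamma> q by (intro powr_less_mono2) (auto simp: divide_strict_right_mono)
  have b\<beta>: "b \<le> \<beta>" using hi by (simp add: b_def \<beta>_def q_def)
  have aq: "a powr q = \<alpha> / \<gamma>" "b powr q = 1 / \<gamma>" using \<alpha> \<gamma> q by (simp_all add: a_def b_def powr_powr)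
  have pos: "\<beta> - \<alpha> * z > 0" if "0 < z" "z \<le> b" for z
  proof -
    have "\<alpha> * z < z" using \<alpha> that by simp
    thus ?thesis using that b\<beta> by linarith
  qed
  define f where "f z = F_fun z \<alpha> \<epsilon> t \<gamma> p" for z
  have f: "f z = \<alpha> / z powr q + (1 - \<alpha>) powr (q + 1) / (\<beta> - \<alpha> * z) powr q - \<gamma>" for z
    by (simp add: f_def F_fun_def q_def \<beta>_def add.commute)
  have fa: "f a > 0" using \<alpha> \<gamma> pos[of a] a0 ab by (simp add: f aq)
  have fb: "f b \<le> 0"
  proof -
    have b0: "b > 0" using a0 ab by simp
    have "(1 - \<alpha>) * b \<le> \<beta> - \<alpha> * b" using b\<beta> by (simp add: algebra_simps)
    hence "((1 - \<alpha>) * b) powr q \<le> (\<beta> - \<alpha> * b) powr q" using \<alpha> b0 q by (intro powr_mono2) auto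
    hence "(1 - \<alpha>) powr q / \<gamma> \<le> (\<beta> - \<alpha> * b) powr q" using \<alpha> b0 by (simp add: powr_mult aq)
    hence "(1 - \<alpha>) powr q \<le> \<gamma> * (\<beta> - \<alpha> * b) powr q" using \<gamma> by (simp add: field_simps)
    hence "(1 - \<alpha>) powr q / (\<beta> - \<alpha> * b) powr q \<le> \<gamma>"
      using pos[of b] b0 by (subst pos_divide_le_eq) auto
    hence "(1 - \<alpha>) * ((1 - \<alpha>) powr q / (\<beta> - \<alpha> * b) powr q) \<le> (1 - \<alpha>) * \<gamma>"
      using \<alpha> by (intro mult_left_mono) auto
    moreover have "(1 - \<alpha>) powr (q + 1) = (1 - \<alpha>) * (1 - \<alpha>) powr q"
      using \<alpha> powr_mult_base[of "1 - \<alpha>" q] by (simp add: add.commute)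
    ultimately have "(1 - \<alpha>) powr (q + 1) / (\<beta> - \<alpha> * b) powr q \<le> (1 - \<alpha>) * \<gamma>" by simp
    moreover have "\<alpha> / (1 / \<gamma>) = \<alpha> * \<gamma>" by simp
    ultimately show ?thesis unfolding f aq by (simp add: left_diff_distrib)
  qed
  have "continuous_on {a..b} f" unfolding f
    using a0 pos by (intro continuous_intros) (force simp: less_imp_neq[symmetric])+
  from IVT2'[OF fb less_imp_le[OF fa] less_imp_le[OF ab] this]
  obtain \<omega> where \<omega>: "a \<le> \<omega>" "\<omega> \<le> b" "f \<omega> = 0" by blast
  have "\<omega> \<noteq> a" using \<omega>(3) fa by auto
  hence \<omega>': "\<omega> \<in> {a<..b}" using \<omega> by auto
  show ?thesis unfolding q_def[symmetric] a_def[symmetric] b_def[symmetric]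
  proof (rule ex1I)
    show "\<omega> \<in> {a<..b} \<and> F_fun \<omega> \<alpha> \<epsilon> t \<gamma> p = 0" using \<omega>' \<omega>(3) by (simp add: f_def)
    fix z assume z: "z \<in> {a<..b} \<and> F_fun z \<alpha> \<epsilon> t \<gamma> p = 0"
    note dec = F_fun_strict_decreasing[OF \<alpha> p, where \<epsilon> = \<epsilon> and t = t and \<gamma> = \<gamma>]
    show "z = \<omega>"
    proof (rule linorder_cases[of z \<omega>])
      assume "z < \<omega>"
      with dec[of z \<omega>] z \<omega> a0 b\<beta> show ?thesis by (auto simp: f_def \<beta>_def)
    next
      assume "\<omega> < z"
      with dec[of \<omega> z] z \<omega> a0 b\<beta> show ?thesis by (auto simp: f_def \<beta>_def)
    qed
  qed
qed

text \<open>The choice of \<open>s\<close> means \<alpha> \<tau> + (1 - \<alpha>) s = \<beta>, so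
  the second term of \<open>F_fun\<close> becomes (1 - \<alpha>) s^(-q). The claim is then the gap
  inequality divided by t s^q.\<close>

lemma F_fun_le:
  assumes \<alpha>: "0 < \<alpha>" "\<alpha> < 1" and p: "p > -1" and t: "t > 0"
    and \<tau>: "0 < \<tau>" "\<tau> \<le> 1 + \<epsilon> / t"
    and s: "s = (1 + \<epsilon> / t - \<alpha> * \<tau>) / (1 - \<alpha>)"
    and le: "\<alpha> * t * ((\<tau> / s) powr (-(p+1)) + (p+1) * (\<tau> / s) - (p + 1 + 1))
      \<le> s powr (p+1) * T1 + (p+1) / s * T2 - (p + 1 + 1) * t"
    and T1: "T1 \<le> \<gamma> * t" and T2: "T2 \<le> (1 + \<epsilon> / t) * t"
  shows "F_fun \<tau> \<alpha> \<epsilon> t \<gamma> p \<le> 0"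
proof -
  define q \<beta> where "q = p + 1" and "\<beta> = 1 + \<epsilon> / t"
  have q: "q > 0" using p by (simp add: q_def)
  have "\<alpha> * \<tau> < \<tau>" using \<alpha> \<tau> by simp
  hence bp: "\<beta> - \<alpha> * \<tau> > 0" using \<tau> unfolding \<beta>_def by linarith
  have s_eq: "s = (\<beta> - \<alpha> * \<tau>) / (1 - \<alpha>)" by (simp add: s \<beta>_def)
  have s0: "s > 0" using bp \<alpha> by (simp add: s_eq)
  have bs: "\<beta> - \<alpha> * \<tau> = (1 - \<alpha>) * s" using \<alpha> by (simp add: s_eq)
  define S where "S = s powr q"
  define U where "U = \<tau> powr q"
  have S0: "S > 0" "U > 0" using s0 \<tau> by (auto simp: S_def U_def)
  have "(\<tau> / s) powr (-q) = S / U"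
    using \<tau> s0 by (simp add: powr_divide powr_minus_divide S_def U_def)
  hence "\<alpha> * t * (S / U + q * (\<tau> / s) - (q + 1)) \<le> S * T1 + q / s * T2 - (q + 1) * t"
    using le by (simp add: q_def S_def)
  also have "\<dots> \<le> S * (\<gamma> * t) + q / s * (\<beta> * t) - (q + 1) * t"
    using T1 T2 S0 q s0 by (intro diff_right_mono add_mono mult_left_mono) (auto simp: \<beta>_def)
  finally have "t * (\<alpha> * (S / U + q * (\<tau> / s) - (q + 1))) \<le> t * (S * \<gamma> + q / s * \<beta> - (q + 1))"
    by (simp add: algebra_simps)
  hence "\<alpha> * (S / U + q * (\<tau> / s) - (q + 1)) \<le> S * \<gamma> + q / s * \<beta> - (q + 1)" using t by simp
  \<comment> \<open>Collecting the terms with q / s leaves q (\<beta> - \<alpha> \<tau>) / s = q (1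
    - \<alpha>), which cancels against the constant up to 1 - \<alpha>.\<close>
  hence "\<alpha> * (S / U) \<le> S * \<gamma> + q * ((\<beta> - \<alpha> * \<tau>) / s) - (q + 1) * (1 - \<alpha>)"
    by (simp add: algebra_simps diff_divide_distrib add_divide_distrib)
  also have "(\<beta> - \<alpha> * \<tau>) / s = 1 - \<alpha>" using s0 by (simp add: bs)
  finally have "S * (\<alpha> / U) + (1 - \<alpha>) \<le> S * \<gamma>" by (simp add: algebra_simps)
  hence "S * (\<alpha> / U + (1 - \<alpha>) / S) \<le> S * \<gamma>" using S0 by (simp add: distrib_left)
  hence main: "\<alpha> / U + (1 - \<alpha>) / S \<le> \<gamma>" using S0 by simp
  have "(1 - \<alpha>) powr (q + 1) / (\<beta> - \<alpha> * \<tau>) powr q = (1 - \<alpha>) / S"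
  proof -
    have "(1 - \<alpha>) powr (q + 1) = (1 - \<alpha>) * (1 - \<alpha>) powr q"
      using \<alpha> powr_mult_base[of "1 - \<alpha>" q] by (simp add: add.commute)
    moreover have "(\<beta> - \<alpha> * \<tau>) powr q = (1 - \<alpha>) powr q * S"
      unfolding bs S_def using \<alpha> s0 by (simp add: powr_mult)
    ultimately show ?thesis using \<alpha> by simp
  qed
  hence "F_fun \<tau> \<alpha> \<epsilon> t \<gamma> p = \<alpha> / U + (1 - \<alpha>) / S - \<gamma>"
    by (simp add: F_fun_def q_def \<beta>_def U_def add.commute)
  thus ?thesis using main by simp
qed

section \<open>Exclusion of points from optimal supports\<close>

lemma lambda_min_spec:
  fixes Q :: "real^'m^'m"
  assumes Q: "orthogonal_matrix Q"
  shows "lambda_min (spec Q l) = Min (range l)"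
proof -
  have "{c. \<exists>v. v \<noteq> 0 \<and> spec Q l *v v = c *\<^sub>R v} = range l"
  proof safe
    fix c v assume v: "v \<noteq> 0" "spec Q l *v v = c *\<^sub>R v"
    have "v \<bullet> v \<noteq> 0" using v by simp
    then obtain i where i: "(v v* Q) $ i \<noteq> 0"
      unfolding inner_orthogonal_coords[OF Q, of v v] by (metis (no_types, lifting) mult_zero_left sum.neutral)
    have "l i * (v v* Q) $ i = c * (v v* Q) $ i"
      unfolding spec_coords[OF Q, symmetric] v(2) by (simp add: vector_matrix_mult_def sum_distrib_left mult_ac)
    hence "l i = c" using i by simp
    thus "c \<in> range l" by blast
  next
    fix i
    have "Q *v axis i 1 \<noteq> 0" using spec_eigenvector(1)[OF Q, of i] by auto
    thus "\<exists>v. v \<noteq> 0 \<and> spec Q l *v v = l i *\<^sub>R v" using spec_eigenvector(2)[OF Q] by blast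
  qed
  thus ?thesis by (simp add: lambda_min_def)
qed

text \<open>The common optimal value fixes the sum of \<open>pot p\<close>, from which the trace is
  read off for p \<noteq> 0; for p = 0 every summand is 1.\<close>

lemma optimal_trace_unique:
  fixes \<xi>1 \<xi>2 :: "(real^'m) measure"
  assumes opt: "phi_optimal X p \<xi>1" "phi_optimal X p \<xi>2"
    and R1: "orthogonal_matrix R1" and \<nu>1: "\<And>k. \<nu>1 k > 0" and eq1: "info_matrix \<xi>1 = spec R1 \<nu>1"
    and R2: "orthogonal_matrix R2" and \<nu>2: "\<And>k. \<nu>2 k > 0" and eq2: "info_matrix \<xi>2 = spec R2 \<nu>2"
  shows "(\<Sum>i\<in>UNIV. \<nu>1 i powr (-p)) = (\<Sum>i\<in>UNIV. \<nu>2 i powr (-p))"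
proof (cases "p = 0")
  case True
  thus ?thesis using \<nu>1 \<nu>2 by (simp add: less_imp_neq[symmetric])
next
  case False
  have le: "Phi_plus p (spec R1 \<nu>1) \<le> Phi_plus p (spec R2 \<nu>2)" "Phi_plus p (spec R2 \<nu>2) \<le> Phi_plus p (spec R1 \<nu>1)"
    using opt by (auto simp: phi_optimal_def simp flip: eq1 eq2)
  have "(\<Sum>i\<in>UNIV. pot p (\<nu>1 i)) = (\<Sum>i\<in>UNIV. pot p (\<nu>2 i))"
    by (rule antisym[OF Phi_plus_le_pot(2)[where \<mu> = \<nu>1 and \<nu> = \<nu>2, OF R1 R2 \<nu>1 less_imp_le[OF \<nu>2] le(1)]
        Phi_plus_le_pot(2)[where \<mu> = \<nu>2 and \<nu> = \<nu>1, OF R2 R1 \<nu>2 less_imp_le[OF \<nu>1] le(2)]])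
  thus ?thesis using False by (simp add: pot_def sum_negf sum_divide_distrib[symmetric])
qed

text \<open>A violation forces the comparison factor \<tau> below \<omega>. Then F(\<tau>) >
  F(\<omega>) = 0 by strict decrease, against F(\<tau>) \<le> 0 from the gap inequality.\<close>

lemma support_point_bound:
  fixes X :: "(real^'m) set" and \<xi> \<xi>s :: "(real^'m) measure"
  assumes X: "compact X" and p: "p > -1" and \<xi>: "design X \<xi>"
    and Q: "orthogonal_matrix Q" and \<mu>: "\<And>i. \<mu> i > 0" and M: "info_matrix \<xi> = spec Q \<mu>"
    and opt: "phi_optimal X p \<xi>s"
    and R: "orthogonal_matrix R" and \<nu>: "\<And>k. \<nu> k > 0" and eq: "info_matrix \<xi>s = spec R \<nu>"
    and t: "t = (\<Sum>i\<in>UNIV. \<mu> i powr (-p))" and ts: "ts = (\<Sum>i\<in>UNIV. \<nu> i powr (-p))"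
    and \<alpha>: "\<alpha> = Min (range (\<lambda>i. \<mu> i powr (-p))) / t" "\<alpha> < 1"
    and \<epsilon>: "trace (spec Q (\<lambda>i. \<mu> i powr (-(p+1))) ** spec R \<nu>) \<le> t + \<epsilon>"
    and \<omega>: "0 < \<omega>" "\<omega> \<le> 1 + \<epsilon> / t" "F_fun \<omega> \<alpha> \<epsilon> t \<gamma> p = 0"
    and \<gamma>: "ts \<le> \<gamma> * t" and B: "B \<le> ts"
    and x: "x \<in> X" "x \<in> support \<xi>s"
  shows "\<omega> powr (p+1) * B \<le> x \<bullet> (spec Q (\<lambda>i. \<mu> i powr (-(p+1))) *v x)"
proof (rule ccontr)
  define q where "q = p + 1"
  have q: "q > 0" using p by (simp add: q_def)
  let ?A = "spec Q (\<lambda>i. \<mu> i powr (-q))"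
  assume "\<not> ?thesis"
  hence "x \<bullet> (?A *v x) < \<omega> powr q * B" by (simp add: q_def)
  also have "\<dots> \<le> \<omega> powr q * ts" using B by (intro mult_left_mono) auto
  finally have lt: "x \<bullet> (?A *v x) < \<omega> powr q * ts" .
  have t0: "t > 0" unfolding t by (intro sum_pos) (use \<mu> in \<open>auto simp: less_imp_neq[symmetric]\<close>)
  have ts0: "ts > 0" unfolding ts by (intro sum_pos) (use \<nu> in \<open>auto simp: less_imp_neq[symmetric]\<close>)
  define a where "a = Min (range (\<lambda>i. \<mu> i powr (-p)))"
  have "a \<in> range (\<lambda>i. \<mu> i powr (-p))" unfolding a_def by (intro Min_in) auto
  hence a: "a > 0" using \<mu> by (auto simp: less_imp_neq[symmetric])
  have a_le: "a \<le> \<mu> i powr (1 - q)" for i by (simp add: a_def q_def)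
  have a_eq: "a = \<alpha> * t" using t0 by (simp add: \<alpha>(1) a_def)
  have \<alpha>0: "\<alpha> > 0" using a t0 by (simp add: \<alpha>(1) a_def)
  obtain \<tau> where \<tau>: "\<tau> > 0"
    "\<And>y. \<tau> powr q * (y \<bullet> (spec R (\<lambda>i. \<nu> i powr (-q)) *v y)) \<le> y \<bullet> (?A *v y)"
    "\<And>s. s > 0 \<Longrightarrow> a * ((\<tau> / s) powr (-q) + q * (\<tau> / s) - (q + 1))
      \<le> s powr q * trace (spec Q \<mu> ** spec R (\<lambda>k. \<nu> k powr (-q)))
       + q / s * trace (?A ** spec R \<nu>) - (q + 1) * (\<Sum>i\<in>UNIV. \<mu> i powr (1 - q))"
    by (rule spec_comparison[where \<mu> = \<mu> and \<nu> = \<nu>, OF Q R q \<mu> \<nu> a a_le]) (rule that; blast)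
  have "ts \<le> x \<bullet> (spec R (\<lambda>i. \<nu> i powr (-q)) *v x)"
    unfolding ts q_def by (rule optimal_support[OF opt X p R \<nu> eq x])
  hence "\<tau> powr q * ts \<le> \<tau> powr q * (x \<bullet> (spec R (\<lambda>i. \<nu> i powr (-q)) *v x))" by (intro mult_left_mono) auto
  hence "\<tau> powr q * ts < \<omega> powr q * ts" using \<tau>(2)[of x] lt by linarith
  hence "\<tau> powr q < \<omega> powr q" using ts0 by simp
  hence \<tau>\<omega>: "\<tau> < \<omega>" using \<tau>(1) \<omega>(1) q by (metis linorder_not_less less_imp_le powr_mono2)
  define s where "s = (1 + \<epsilon> / t - \<alpha> * \<tau>) / (1 - \<alpha>)"
  have "\<alpha> * \<tau> < \<tau>" using \<alpha>(2) \<alpha>0 \<tau>(1) by simp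
  hence s0: "s > 0" using \<tau>\<omega> \<omega>(2) \<alpha>(2) unfolding s_def by (intro divide_pos_pos) auto
  have T1: "trace (spec Q \<mu> ** spec R (\<lambda>k. \<nu> k powr (-q))) \<le> ts"
    using optimal_gradient[OF opt X p \<xi> R \<nu> eq]
    by (subst trace_mul_sym) (simp add: ts q_def M)
  have tsum: "(\<Sum>i\<in>UNIV. \<mu> i powr (1 - q)) = t" by (simp add: t q_def)
  have "F_fun \<tau> \<alpha> \<epsilon> t \<gamma> p \<le> 0"
  proof (rule F_fun_le[OF \<alpha>0 \<alpha>(2) p t0 \<tau>(1) _ s_def])
    show "\<tau> \<le> 1 + \<epsilon> / t" using \<tau>\<omega> \<omega>(2) by simp
    show "\<alpha> * t * ((\<tau> / s) powr (-(p+1)) + (p+1) * (\<tau> / s) - (p + 1 + 1))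
      \<le> s powr (p+1) * trace (spec Q \<mu> ** spec R (\<lambda>k. \<nu> k powr (-q)))
       + (p+1) / s * trace (?A ** spec R \<nu>) - (p + 1 + 1) * t"
      using \<tau>(3)[OF s0] unfolding tsum a_eq by (simp add: q_def)
    show "trace (spec Q \<mu> ** spec R (\<lambda>k. \<nu> k powr (-q))) \<le> \<gamma> * t" using T1 \<gamma> by linarith
    show "trace (?A ** spec R \<nu>) \<le> (1 + \<epsilon> / t) * t" using \<epsilon> t0 by (simp add: q_def distrib_right)
  qed
  moreover have "F_fun \<omega> \<alpha> \<epsilon> t \<gamma> p < F_fun \<tau> \<alpha> \<epsilon> t \<gamma> p"
    by (rule F_fun_strict_decreasing[OF \<alpha>0 \<alpha>(2) p \<tau>(1) \<tau>\<omega> \<omega>(2)])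
  ultimately show False using \<omega>(3) by simp
qed

theorem theorem2:
  fixes X :: "(real^'m) set" and \<xi> :: "(real^'m) measure" and p :: real
  assumes m2: "CARD('m) \<ge> 2"
    and cX: "compact X"
    and p_gt: "p > -1"
    and des: "design X \<xi>"
    and nonsing: "invertible (info_matrix \<xi>)"
  defines "M \<equiv> info_matrix \<xi>"
  defines "t \<equiv> trace (mpow M (-p))"
  defines "\<epsilon> \<equiv> (SUP x\<in>X. x \<bullet> (mpow M (-(p+1)) *v x)) - t"
  defines "\<alpha> \<equiv> lambda_min (mpow M (-p)) / trace (mpow M (-p))"
  defines "\<gamma> \<equiv> max 1 ((1 + \<epsilon> / t) powr (-p))"
  defines "B \<equiv> t * min 1 ((1 + \<epsilon> / t) powr (-p))"
  shows
    "(\<exists>!\<omega>. \<omega> \<in> {(\<alpha>/\<gamma>) powr (1/(p+1)) <.. (1/\<gamma>) powr (1/(p+1))} \<and> F_fun \<omega> \<alpha> \<epsilon> t \<gamma> p = 0)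
     \<and> (\<forall>\<omega>. \<omega> \<in> {(\<alpha>/\<gamma>) powr (1/(p+1)) <.. (1/\<gamma>) powr (1/(p+1))} \<and> F_fun \<omega> \<alpha> \<epsilon> t \<gamma> p = 0 \<longrightarrow>
          (\<forall>\<xi>s. phi_optimal X p \<xi>s \<longrightarrow>
             (\<forall>xs\<in>X. xs \<bullet> (mpow M (-(p+1)) *v xs) < \<omega> powr (p+1) * B \<longrightarrow> xs \<notin> support \<xi>s)))
     \<and> (\<forall>\<xi>s. phi_optimal X p \<xi>s \<longrightarrow>
          (let ts = trace (mpow (info_matrix \<xi>s) (-p)); \<gamma>s = ts / t in
            (\<exists>!\<omega>. \<omega> \<in> {(\<alpha>/\<gamma>s) powr (1/(p+1)) <.. (1/\<gamma>s) powr (1/(p+1))} \<and> F_fun \<omega> \<alpha> \<epsilon> t \<gamma>s p = 0)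
            \<and> (\<forall>\<omega>. \<omega> \<in> {(\<alpha>/\<gamma>s) powr (1/(p+1)) <.. (1/\<gamma>s) powr (1/(p+1))} \<and> F_fun \<omega> \<alpha> \<epsilon> t \<gamma>s p = 0 \<longrightarrow>
                 (\<forall>\<xi>'. phi_optimal X p \<xi>' \<longrightarrow>
                    (\<forall>xs\<in>X. xs \<bullet> (mpow M (-(p+1)) *v xs) < \<omega> powr (p+1) * ts \<longrightarrow> xs \<notin> support \<xi>')))))"
proof -
  obtain Q \<mu> where Q: "orthogonal_matrix Q" and \<mu>': "\<And>i. \<mu> i \<ge> 0" and M: "info_matrix \<xi> = spec Q \<mu>"
    by (rule info_matrix_spec[OF des cX]) (rule that; blast)
  have \<mu>: "\<mu> i > 0" for i using nonsing invertible_spec[OF Q \<mu>'] M by simp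
  define A where "A = spec Q (\<lambda>i. \<mu> i powr (-(p+1)))"
  have A: "mpow M (-(p+1)) = A" unfolding M_def M A_def by (rule mpow_spec[OF Q \<mu>'])
  have Mp: "mpow M (-p) = spec Q (\<lambda>i. \<mu> i powr (-p))" unfolding M_def M by (rule mpow_spec[OF Q \<mu>'])
  have t: "t = (\<Sum>i\<in>UNIV. \<mu> i powr (-p))" by (simp add: t_def Mp trace_spec[OF Q])
  have \<mu>p: "\<mu> i powr (-p) > 0" for i using \<mu>[of i] by simp
  have t0: "t > 0" unfolding t by (intro sum_pos \<mu>p) auto
  define a where "a = Min (range (\<lambda>i. \<mu> i powr (-p)))"
  have \<alpha>: "\<alpha> = a / t" unfolding \<alpha>_def t_def Mp lambda_min_spec[OF Q] a_def ..
  have "a \<in> range (\<lambda>i. \<mu> i powr (-p))" unfolding a_def by (intro Min_in) auto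
  then obtain j where j: "a = \<mu> j powr (-p)" by auto
  have a0: "a > 0" using \<mu>p by (simp add: j)
  \<comment> \<open>With at least two eigenvalues the smallest summand is strictly below the sum, so
    \<alpha> < 1 and division by 1 - \<alpha> is legitimate.\<close>
  have "UNIV - {j} \<noteq> {}"
  proof
    assume "UNIV - {j} = {}"
    hence "UNIV = {j}" by auto
    hence "CARD('m) = 1" by (metis card.empty card.insert empty_iff finite.emptyI One_nat_def)
    with m2 show False by simp
  qed
  hence "0 < (\<Sum>i\<in>UNIV - {j}. \<mu> i powr (-p))" by (intro sum_pos \<mu>p) auto
  hence "a < t" unfolding t j by (subst sum.remove[of _ j]) auto
  hence \<alpha>01: "0 < \<alpha>" "\<alpha> < 1" using a0 t0 by (auto simp: \<alpha>)
  have bdd: "bdd_above ((\<lambda>x. x \<bullet> (A *v x)) ` X)"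
    using cX by (intro bounded_imp_bdd_above compact_imp_bounded compact_continuous_image continuous_intros)
  have sup: "x \<bullet> (A *v x) \<le> t + \<epsilon>" if "x \<in> X" for x
    unfolding \<epsilon>_def A using cSUP_upper[OF that bdd] by simp
  have trace_le: "trace (A ** info_matrix \<eta>) \<le> t + \<epsilon>" if \<eta>: "design X \<eta>" for \<eta>
  proof -
    interpret prob_space \<eta> using \<eta> by (rule design_prob_space)
    have "(LINT x|\<eta>. x \<bullet> (A *v x)) \<le> (LINT x|\<eta>. t + \<epsilon>)"
    proof (rule integral_mono_AE)
      show "integrable \<eta> (\<lambda>x. x \<bullet> (A *v x))" by (rule design_integrable[OF \<eta> cX]) (intro continuous_intros)
      show "AE x in \<eta>. x \<bullet> (A *v x) \<le> t + \<epsilon>" using design_AE[OF \<eta> cX] by eventually_elim (rule sup)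
    qed simp
    thus ?thesis by (simp add: trace_info_matrix[OF \<eta> cX] prob_space)
  qed
  \<comment> \<open>The average of x A x under \<xi> itself is \<open>t\<close>, so its supremum
    over \<open>X\<close> is no smaller.\<close>
  have "trace (A ** info_matrix \<xi>) = t" unfolding A_def M t by (rule trace_spec_powr_self[OF Q \<mu>])
  hence \<epsilon>0: "\<epsilon> \<ge> 0" using trace_le[OF des] by simp
  define \<beta> where "\<beta> = 1 + \<epsilon> / t"
  have \<beta>: "\<beta> \<ge> 1" using \<epsilon>0 t0 by (simp add: \<beta>_def)
  have \<beta>t: "\<beta> * t = t + \<epsilon>" using t0 by (simp add: \<beta>_def distrib_right)
  have opt_spec: "\<exists>R \<nu>. orthogonal_matrix R \<and> (\<forall>k. \<nu> k > 0) \<and> info_matrix \<xi>s = spec R \<nu> \<and>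
      trace (mpow (info_matrix \<xi>s) (-p)) = (\<Sum>k\<in>UNIV. \<nu> k powr (-p)) \<and>
      B \<le> (\<Sum>k\<in>UNIV. \<nu> k powr (-p)) \<and> (\<Sum>k\<in>UNIV. \<nu> k powr (-p)) \<le> \<gamma> * t"
    if opt: "phi_optimal X p \<xi>s" for \<xi>s
  proof -
    have \<xi>s: "design X \<xi>s" using opt by (simp add: phi_optimal_def)
    obtain R \<nu> where R: "orthogonal_matrix R" "\<And>k. \<nu> k \<ge> 0" "info_matrix \<xi>s = spec R \<nu>"
      by (rule info_matrix_spec[OF \<xi>s cX]) (rule that; blast)
    have \<nu>: "\<nu> k > 0" for k by (rule optimal_nonsingular[OF opt cX p_gt des nonsing R])
    have "Phi_plus p (spec Q \<mu>) \<le> Phi_plus p (spec R \<nu>)"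
      using opt des by (simp add: phi_optimal_def flip: M R(3))
    hence pot: "(\<Sum>i\<in>UNIV. pot p (\<mu> i)) \<le> (\<Sum>k\<in>UNIV. pot p (\<nu> k))"
      by (rule Phi_plus_le_pot(2)[OF Q R(1) \<mu> R(2)])
    have tr: "trace (spec Q (\<lambda>i. \<mu> i powr (-(p+1))) ** spec R \<nu>) \<le> \<beta> * (\<Sum>i\<in>UNIV. \<mu> i powr (-p))"
      using trace_le[OF \<xi>s] unfolding t[symmetric] \<beta>t R(3) A_def .
    have "\<beta> > 0" using \<beta> by simp
    note bounds = trace_power_bounds[OF Q R(1) p_gt \<mu> \<nu> this pot tr]
    have bounds': "B \<le> (\<Sum>k\<in>UNIV. \<nu> k powr (-p))" "(\<Sum>k\<in>UNIV. \<nu> k powr (-p)) \<le> \<gamma> * t"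
      using bounds unfolding t[symmetric] B_def \<gamma>_def \<beta>_def by (simp_all add: mult.commute)
    have "trace (mpow (info_matrix \<xi>s) (-p)) = (\<Sum>k\<in>UNIV. \<nu> k powr (-p))"
      by (simp add: R(3) mpow_spec[OF R(1,2)] trace_spec[OF R(1)])
    thus ?thesis using R \<nu> bounds' by blast
  qed
  \<comment> \<open>\<open>g\<close> and \<open>b\<close> stay free, so that both the pair \<gamma>,
    \<open>B\<close> and the pair \<open>ts / t\<close>, \<open>ts\<close> are instances.\<close>
  have excl: "xs \<notin> support \<xi>s"
    if opt: "phi_optimal X p \<xi>s" and xs: "xs \<in> X" "xs \<bullet> (mpow M (-(p+1)) *v xs) < \<omega> powr (p+1) * b"
      and \<omega>: "0 < \<omega>" "\<omega> \<le> \<beta>" "F_fun \<omega> \<alpha> \<epsilon> t g p = 0"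
      and g: "trace (mpow (info_matrix \<xi>s) (-p)) \<le> g * t" and b: "b \<le> trace (mpow (info_matrix \<xi>s) (-p))"
    for \<xi>s xs \<omega> g b
  proof
    assume supp: "xs \<in> support \<xi>s"
    have \<xi>s: "design X \<xi>s" using opt by (simp add: phi_optimal_def)
    obtain R \<nu> where R: "orthogonal_matrix R" "\<forall>k. \<nu> k > 0" "info_matrix \<xi>s = spec R \<nu>"
      and ts: "trace (mpow (info_matrix \<xi>s) (-p)) = (\<Sum>k\<in>UNIV. \<nu> k powr (-p))"
      using opt_spec[OF opt] by blast
    have "\<omega> powr (p+1) * b \<le> xs \<bullet> (spec Q (\<lambda>i. \<mu> i powr (-(p+1))) *v xs)"
      by (rule support_point_bound[OF cX p_gt des Q \<mu> M opt R(1) R(2)[rule_format] R(3) t ts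
          \<alpha>[unfolded a_def] \<alpha>01(2) _ \<omega>(1) \<omega>(2)[unfolded \<beta>_def] \<omega>(3) g b xs(1) supp])
        (use trace_le[OF \<xi>s] in \<open>simp only: R(3) A_def\<close>)
    thus False using xs(2) unfolding A A_def by simp
  qed
  have q: "p + 1 > 0" using p_gt by simp
  have \<gamma>1: "\<gamma> \<ge> 1" by (simp add: \<gamma>_def)
  have hi: "(1/\<gamma>) powr (1/(p+1)) \<le> \<beta>"
  proof -
    have "(1/\<gamma>) powr (1/(p+1)) \<le> 1 powr (1/(p+1))" using \<gamma>1 q by (intro powr_mono2) auto
    thus ?thesis using \<beta> by simp
  qed
  have part1: "\<exists>!\<omega>. \<omega> \<in> {(\<alpha>/\<gamma>) powr (1/(p+1)) <.. (1/\<gamma>) powr (1/(p+1))} \<and> F_fun \<omega> \<alpha> \<epsilon> t \<gamma> p = 0"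
    by (rule F_fun_unique_root[OF \<alpha>01 p_gt _ hi[unfolded \<beta>_def]]) (use \<gamma>1 in simp)
  have part2: "xs \<notin> support \<xi>s"
    if \<omega>: "\<omega> \<in> {(\<alpha>/\<gamma>) powr (1/(p+1)) <.. (1/\<gamma>) powr (1/(p+1))}" "F_fun \<omega> \<alpha> \<epsilon> t \<gamma> p = 0"
      and opt: "phi_optimal X p \<xi>s" and xs: "xs \<in> X" "xs \<bullet> (mpow M (-(p+1)) *v xs) < \<omega> powr (p+1) * B"
    for \<omega> \<xi>s xs
  proof (rule excl[OF opt xs _ _ \<omega>(2)])
    show "0 < \<omega>" using \<omega>(1) by (auto intro: le_less_trans[OF powr_ge_zero])
    show "\<omega> \<le> \<beta>" using \<omega>(1) hi by auto
  qed (use opt_spec[OF opt] in auto)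
  have part3: "(\<exists>!\<omega>. \<omega> \<in> {(\<alpha>/(ts / t)) powr (1/(p+1)) <.. (1/(ts / t)) powr (1/(p+1))} \<and> F_fun \<omega> \<alpha> \<epsilon> t (ts / t) p = 0)
      \<and> (\<forall>\<omega>. \<omega> \<in> {(\<alpha>/(ts / t)) powr (1/(p+1)) <.. (1/(ts / t)) powr (1/(p+1))} \<and> F_fun \<omega> \<alpha> \<epsilon> t (ts / t) p = 0 \<longrightarrow>
           (\<forall>\<xi>'. phi_optimal X p \<xi>' \<longrightarrow>
              (\<forall>xs\<in>X. xs \<bullet> (mpow M (-(p+1)) *v xs) < \<omega> powr (p+1) * ts \<longrightarrow> xs \<notin> support \<xi>')))"
    if opt: "phi_optimal X p \<xi>s" and ts: "ts = trace (mpow (info_matrix \<xi>s) (-p))" for \<xi>s ts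
  proof -
    obtain R \<nu> where R: "orthogonal_matrix R" "\<forall>k. \<nu> k > 0" "info_matrix \<xi>s = spec R \<nu>"
      and ts': "ts = (\<Sum>k\<in>UNIV. \<nu> k powr (-p))" and B: "B \<le> ts"
      using opt_spec[OF opt] unfolding ts by auto
    \<comment> \<open>The exponent -(p+1) lies below both 0 and -p. This bound keeps the right end
      of the interval for \<open>ts / t\<close> at most \<beta>, inside the range where
      \<open>F_fun\<close> decreases.\<close>
    have \<gamma>s: "\<beta> powr (-(p+1)) \<le> ts / t"
    proof -
      have "\<beta> powr (-(p+1)) \<le> \<beta> powr (-p)" "\<beta> powr (-(p+1)) \<le> \<beta> powr 0"
        using \<beta> q by (intro powr_mono; simp)+
      hence "\<beta> powr (-(p+1)) \<le> min 1 (\<beta> powr (-p))" using \<beta> by simp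
      hence "t * \<beta> powr (-(p+1)) \<le> B" unfolding B_def \<beta>_def[symmetric] using t0 by (intro mult_left_mono) auto
      thus ?thesis using B t0 by (simp add: field_simps)
    qed
    have \<beta>q: "\<beta> powr (-(p+1)) > 0" using \<beta> by simp
    have hi: "(1/(ts / t)) powr (1/(p+1)) \<le> \<beta>"
    proof -
      have "1 / (ts / t) \<le> 1 / \<beta> powr (-(p+1))" by (intro frac_le \<gamma>s \<beta>q) simp_all
      also have "\<dots> = \<beta> powr (p+1)" unfolding powr_minus_divide by simp
      finally have "(1/(ts / t)) powr (1/(p+1)) \<le> (\<beta> powr (p+1)) powr (1/(p+1))"
        using less_le_trans[OF \<beta>q \<gamma>s] q t0 by (intro powr_mono2) (simp_all add: zero_less_divide_iff)
      also have "\<dots> = \<beta>" using q \<beta> by (simp add: powr_powr)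
      finally show ?thesis .
    qed
    show ?thesis
    proof (intro conjI allI impI ballI)
      show "\<exists>!\<omega>. \<omega> \<in> {(\<alpha>/(ts / t)) powr (1/(p+1)) <.. (1/(ts / t)) powr (1/(p+1))} \<and> F_fun \<omega> \<alpha> \<epsilon> t (ts / t) p = 0"
        by (rule F_fun_unique_root[OF \<alpha>01 p_gt less_le_trans[OF \<beta>q \<gamma>s] hi[unfolded \<beta>_def]])
    next
      fix \<omega> \<xi>' xs
      assume \<omega>: "\<omega> \<in> {(\<alpha>/(ts / t)) powr (1/(p+1)) <.. (1/(ts / t)) powr (1/(p+1))} \<and> F_fun \<omega> \<alpha> \<epsilon> t (ts / t) p = 0"
        and opt': "phi_optimal X p \<xi>'"
        and xs: "xs \<in> X" "xs \<bullet> (mpow M (-(p+1)) *v xs) < \<omega> powr (p+1) * ts"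
      obtain R' \<nu>' where R': "orthogonal_matrix R'" "\<forall>k. \<nu>' k > 0" "info_matrix \<xi>' = spec R' \<nu>'"
        and tr: "trace (mpow (info_matrix \<xi>') (-p)) = (\<Sum>k\<in>UNIV. \<nu>' k powr (-p))"
        using opt_spec[OF opt'] by blast
      have eq: "trace (mpow (info_matrix \<xi>') (-p)) = ts" unfolding tr ts'
        by (rule optimal_trace_unique[OF opt' opt R'(1) R'(2)[rule_format] R'(3) R(1) R(2)[rule_format] R(3)])
      show "xs \<notin> support \<xi>'"
      proof (rule excl[OF opt' xs])
        show "0 < \<omega>" using \<omega> by (auto intro: le_less_trans[OF powr_ge_zero])
        show "\<omega> \<le> \<beta>" using \<omega> hi by auto
        show "F_fun \<omega> \<alpha> \<epsilon> t (ts / t) p = 0" using \<omega> by blast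
        show "trace (mpow (info_matrix \<xi>') (-p)) \<le> ts / t * t" using t0 by (simp add: eq)
        show "ts \<le> trace (mpow (info_matrix \<xi>') (-p))" by (simp add: eq)
      qed
    qed
  qed
  show ?thesis unfolding Let_def
  proof (intro conjI[OF part1] conjI)
    show "\<forall>\<omega>. \<omega> \<in> {(\<alpha>/\<gamma>) powr (1/(p+1)) <.. (1/\<gamma>) powr (1/(p+1))} \<and> F_fun \<omega> \<alpha> \<epsilon> t \<gamma> p = 0 \<longrightarrow>
          (\<forall>\<xi>s. phi_optimal X p \<xi>s \<longrightarrow>
             (\<forall>xs\<in>X. xs \<bullet> (mpow M (-(p+1)) *v xs) < \<omega> powr (p+1) * B \<longrightarrow> xs \<notin> support \<xi>s))"
      using part2 by blast
  qed (use part3 in blast)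
qed

end
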